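(* Let $\xi$ be a random element in $C([0,1])$. Then $\xi\in\mathrm{RV}(C([0,1]),\cdot,\mathcal{C}_0,g,\mu)$ (for some $g$ and $\mu$) if and only if there exist $\gamma_0\in\Gamma$ and a measurable function $g$ such that the following two conditions are satisfied. (i) For each $\gamma\ge\gamma_0$, $\pi_\gamma\xi\in\mathrm{RV}(\mathbb{R}^{\#\gamma},\cdot,\mathcal{R}_0^{\#\gamma},g,\mu_\gamma)$, where $(\mu_\gamma)_{\gamma\ge\gamma_0}$ is a family of (non-trivial) tail measures, and $$\vartheta=\sup_{\gamma\ge\gamma_0}\mu_\gamma(B_{\#\gamma})<\infty.$$ (ii) For all $\delta>0$, $\lim_{\varepsilon\downarrow0}\limsup_{t\to\infty}g(t)\mathbf{P}\{\varpi_\varepsilon(\xi)>t\delta\}=0$. If (i) and (ii) hold, then $\mu_\gamma=\pi_\gamma\mu$, where $\mu$ is the tail measure of $\xi$ on $\mathcal{C}_0$ (with the normalising function $g$), and $\|\xi\|_\infty\in\mathrm{RV}(\mathbb{R}_+,\cdot,\mathcal{R}_0,g,\vartheta\theta_\alpha)$, where $\alpha$ is the tail index.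
   Context: $C([0,1])$ is the space of continuous functions $x:[0,1]\to\mathbb{R}$ with the uniform metric and norm $\|x\|_\infty$. All spaces carry the linear scaling $T_tx=tx$, denoted by $\cdot$. An ideal is a family of subsets closed under finite unions and subsets. $\mathcal{C}_0$ is the ideal of all $A\subset C([0,1])$ with $\inf_{x\in A}\|x\|_\infty>0$; $\mathcal{R}_0^m$ is the ideal of all $A\subset\mathbb{R}^m$ with $\inf_{y\in A}\max_i|y_i|>0$; $\mathcal{R}_0$ is the ideal of $A\subset\mathbb{R}_+$ with $\inf A>0$. $\Gamma$ is the set of all finite strictly increasing sequences $\gamma=(u_1,\dots,u_m)$ in $[0,1]$, $m\in\mathbb{N}$, ordered by inclusion of the sets $\{u_1,\dots,u_m\}$; $\#\gamma=m$ and $\pi_\gamma x=(x(u_1),\dots,x(u_m))$. $B_m=\{y\in\mathbb{R}^m:\max_i|y_i|>1\}$. $\varpi_\varepsilon(x)=\sup\{|x(u_1)-x(u_2)|:u_1,u_2\in[0,1],|u_1-u_2|\le\varepsilon\}$. $\theta_\alpha(ds)=\alpha s^{-\alpha-1}ds$ on $(0,\infty)$. For a metric space $X$ with ideal $\mathcal{S}$ (where the pair $(X,\mathcal{S})$ is one of $(C([0,1]),\mathcal{C}_0)$, $(\mathbb{R}^m,\mathcal{R}_0^m)$ with $m\in\mathbb{N}$, or $(\mathbb{R}_+,\mathcal{R}_0)$; $U_{\mathcal{S}}$ denotes the union of all sets in $\mathcal{S}$), $\xi\in\mathrm{RV}(X,\cdot,\mathcal{S},g,\mu)$ means: $g:[0,\infty)\to[0,\infty)$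 is measurable with $g(t)\to\infty$; $\mu$ (the tail measure) is a Borel measure finite on Borel sets in $\mathcal{S}$, vanishing outside $U_{\mathcal{S}}$, with $\mu(B)>0$ for some $B\in\mathcal{S}$; and $g(t)\mathbf{E}f(t^{-1}\xi)\to\int f\,d\mu$ as $t\to\infty$ for all bounded continuous $f$ with support (closure of $\{f\ne0\}$) in $\mathcal{S}$. For each of these pairs $(X,\mathcal{S})$, $g$ is automatically regularly varying at infinity with some index $\alpha>0$, called the tail index, and $\mu(tB)=t^{-\alpha}\mu(B)$. $\pi_\gamma\mu$ is the pushforward of $\mu$, considered on sets of $\mathcal{R}_0^{\#\gamma}$. *)

theory Defs
  imports "HOL-Probability.Probability"
begin

section \<open>Borel measures and regular variation of random elements\<close>

definition borel_of :: "'a topology \<Rightarrow> 'a measure" where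
  "borel_of X = sigma (topspace X) {U. openin X U}"

definition normalising :: "(real \<Rightarrow> real) \<Rightarrow> bool" where
  "normalising g \<longleftrightarrow>
     g \<in> restrict_space borel {0..} \<rightarrow>\<^sub>M restrict_space borel {0..} \<and> filterlim g at_top at_top"

definition tail_measure :: "'a topology \<Rightarrow> 'a set set \<Rightarrow> 'a measure \<Rightarrow> bool" where
  "tail_measure X \<S> \<mu> \<longleftrightarrow>
     sets \<mu> = sets (borel_of X) \<and>
     (\<forall>B \<in> sets \<mu> \<inter> \<S>. emeasure \<mu> B < \<infinity>) \<and>
     topspace X - \<Union>\<S> \<in> null_sets \<mu> \<and>
     (\<exists>B \<in> sets \<mu> \<inter> \<S>. 0 < emeasure \<mu> B)"

text \<open>
  The metric of the state space enters only through its topology (continuity, closures, Borel sets),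
  so the state space is given as a topology \<open>X\<close>; \<open>T\<close> is the scaling and \<open>\<S>\<close> the ideal.
\<close>

definition RV ::
  "'w measure \<Rightarrow> ('w \<Rightarrow> 'a) \<Rightarrow> 'a topology \<Rightarrow> (real \<Rightarrow> 'a \<Rightarrow> 'a) \<Rightarrow> 'a set set \<Rightarrow>
     (real \<Rightarrow> real) \<Rightarrow> 'a measure \<Rightarrow> bool" where
  "RV M \<xi> X T \<S> g \<mu> \<longleftrightarrow>
     \<xi> \<in> M \<rightarrow>\<^sub>M borel_of X \<and> normalising g \<and> tail_measure X \<S> \<mu> \<and>
     (\<forall>f :: 'a \<Rightarrow> real.
        continuous_map X euclideanreal f \<and> bounded (f ` topspace X) \<and>
        X closure_of {x \<in> topspace X. f x \<noteq> 0} \<in> \<S> \<longrightarrow>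
        ((\<lambda>t. g t * (\<integral>\<omega>. f (T (inverse t) (\<xi> \<omega>)) \<partial>M)) \<longlongrightarrow> (\<integral>x. f x \<partial>\<mu>)) at_top)"

definition regularly_varying :: "(real \<Rightarrow> real) \<Rightarrow> real \<Rightarrow> bool" where
  "regularly_varying g \<alpha> \<longleftrightarrow>
     eventually (\<lambda>t. 0 < g t) at_top \<and>
     (\<forall>s>0. ((\<lambda>t. g (s * t) / g t) \<longlongrightarrow> s powr \<alpha>) at_top)"

text \<open>
  The infimum over the empty set is \<open>\<infinity>\<close> in the extended reals, so the empty set belongs to the ideal.
\<close>

definition ideal_away :: "'a topology \<Rightarrow> ('a \<Rightarrow> real) \<Rightarrow> 'a set set" where
  "ideal_away X \<tau> = {A. A \<subseteq> topspace X \<and> 0 < (INF x\<in>A. ereal (\<tau> x))}"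

section \<open>The three state spaces\<close>

text \<open>
  Continuous functions on \<open>[0,1]\<close> and vectors in \<open>\<real>\<^sup>m\<close> are functions that are
  \<^const>\<open>undefined\<close> outside \<open>{0..1}\<close> and \<open>{..<m}\<close> respectively; scaling respects this convention.
\<close>

definition scale_on :: "'i set \<Rightarrow> real \<Rightarrow> ('i \<Rightarrow> real) \<Rightarrow> 'i \<Rightarrow> real" where
  "scale_on I t x = (\<lambda>i\<in>I. t * x i)"

definition C01 :: "(real \<Rightarrow> real) topology" where
  "C01 = mtopology_of (cfunspace (top_of_set {0..1::real}) (euclidean_metric :: real metric))"

definition sup_norm :: "(real \<Rightarrow> real) \<Rightarrow> real" where
  "sup_norm x = (SUP u\<in>{0..1}. \<bar>x u\<bar>)"

definition C01_ideal :: "(real \<Rightarrow> real) set set" where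
  "C01_ideal = ideal_away C01 sup_norm"

definition Rm :: "nat \<Rightarrow> (nat \<Rightarrow> real) topology" where
  "Rm m = product_topology (\<lambda>_. euclideanreal) {..<m}"

definition max_norm :: "nat \<Rightarrow> (nat \<Rightarrow> real) \<Rightarrow> real" where
  "max_norm m y = (MAX i\<in>{..<m}. \<bar>y i\<bar>)"

definition Rm_ideal :: "nat \<Rightarrow> (nat \<Rightarrow> real) set set" where
  "Rm_ideal m = ideal_away (Rm m) (max_norm m)"

definition Rplus :: "real topology" where
  "Rplus = top_of_set {0..}"

definition Rplus_ideal :: "real set set" where
  "Rplus_ideal = ideal_away Rplus (\<lambda>s. s)"

abbreviation RV_C01 where
  "RV_C01 M \<xi> g \<mu> \<equiv> RV M \<xi> C01 (scale_on {0..1}) C01_ideal g \<mu>"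

abbreviation RV_Rm where
  "RV_Rm m M \<xi> g \<mu> \<equiv> RV M \<xi> (Rm m) (scale_on {..<m}) (Rm_ideal m) g \<mu>"

abbreviation RV_Rplus where
  "RV_Rplus M \<xi> g \<mu> \<equiv> RV M \<xi> Rplus (*) Rplus_ideal g \<mu>"

lemma topspace_C01: "topspace C01 = {x \<in> extensional {0..1}. continuous_on {0..1} x}"
proof -
  have "bounded (x ` {0..1})" if "continuous_on {0..1} x" for x :: "real \<Rightarrow> real"
    using that compact_continuous_image compact_imp_bounded by blast
  then show ?thesis
    by (auto simp: C01_def)
qed

section \<open>Finite-dimensional projections and the modulus of continuity\<close>

definition \<Gamma> :: "real list set" where
  "\<Gamma> = {\<gamma>. \<gamma> \<noteq> [] \<and> set \<gamma> \<subseteq> {0..1} \<and> sorted_wrt (<) \<gamma>}"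

definition \<Gamma>_above :: "real list \<Rightarrow> real list set" where
  "\<Gamma>_above \<gamma>\<^sub>0 = {\<gamma> \<in> \<Gamma>. set \<gamma>\<^sub>0 \<subseteq> set \<gamma>}"

definition proj :: "real list \<Rightarrow> (real \<Rightarrow> real) \<Rightarrow> nat \<Rightarrow> real" where
  "proj \<gamma> x = (\<lambda>i\<in>{..<length \<gamma>}. x (\<gamma> ! i))"

definition B_set :: "nat \<Rightarrow> (nat \<Rightarrow> real) set" where
  "B_set m = {y \<in> topspace (Rm m). 1 < max_norm m y}"

definition modulus :: "real \<Rightarrow> (real \<Rightarrow> real) \<Rightarrow> real" where
  "modulus \<epsilon> x =
     (SUP (u, v) \<in> {(u, v). u \<in> {0..1} \<and> v \<in> {0..1} \<and> \<bar>u - v\<bar> \<le> \<epsilon>}. \<bar>x u - x v\<bar>)"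

definition sup_mass :: "real list \<Rightarrow> (real list \<Rightarrow> (nat \<Rightarrow> real) measure) \<Rightarrow> ennreal" where
  "sup_mass \<gamma>\<^sub>0 \<mu>f = (SUP \<gamma> \<in> \<Gamma>_above \<gamma>\<^sub>0. emeasure (\<mu>f \<gamma>) (B_set (length \<gamma>)))"

definition fidi_condition ::
  "'w measure \<Rightarrow> ('w \<Rightarrow> real \<Rightarrow> real) \<Rightarrow> real list \<Rightarrow> (real \<Rightarrow> real) \<Rightarrow>
     (real list \<Rightarrow> (nat \<Rightarrow> real) measure) \<Rightarrow> bool" where
  "fidi_condition M \<xi> \<gamma>\<^sub>0 g \<mu>f \<longleftrightarrow>
     (\<forall>\<gamma> \<in> \<Gamma>_above \<gamma>\<^sub>0. RV_Rm (length \<gamma>) M (\<lambda>\<omega>. proj \<gamma> (\<xi> \<omega>)) g (\<mu>f \<gamma>)) \<and>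
     sup_mass \<gamma>\<^sub>0 \<mu>f < \<infinity>"

definition modulus_condition ::
  "'w measure \<Rightarrow> ('w \<Rightarrow> real \<Rightarrow> real) \<Rightarrow> (real \<Rightarrow> real) \<Rightarrow> bool" where
  "modulus_condition M \<xi> g \<longleftrightarrow>
     (\<forall>\<delta>>0. ((\<lambda>\<epsilon>. Limsup at_top
         (\<lambda>t. ereal (g t * measure M {\<omega> \<in> space M. t * \<delta> < modulus \<epsilon> (\<xi> \<omega>)}))) \<longlongrightarrow> 0)
       (at_right 0))"

definition \<theta> :: "real \<Rightarrow> real measure" where
  "\<theta> \<alpha> = density (restrict_space lborel {0..})
     (\<lambda>s. ennreal (indicator {0<..} s * (\<alpha> * s powr (- \<alpha> - 1))))"

text \<open>
  The pushforward may put infinite mass at the origin, so it is compared with a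
  tail measure only on Borel sets of the ideal.
\<close>

definition is_projection ::
  "real list \<Rightarrow> (real \<Rightarrow> real) measure \<Rightarrow> (nat \<Rightarrow> real) measure \<Rightarrow> bool" where
  "is_projection \<gamma> \<mu> \<nu> \<longleftrightarrow>
     (\<forall>A \<in> sets (borel_of (Rm (length \<gamma>))) \<inter> Rm_ideal (length \<gamma>).
        emeasure \<nu> A = emeasure (distr \<mu> (borel_of (Rm (length \<gamma>))) (proj \<gamma>)) A)"

end

theory Submission
  imports Defs
begin

text \<open>
  Regular variation of \<open>\<xi>\<close> in \<open>C([0,1])\<close> is convergence of the measures \<open>g(t) P(\<xi>/t \<in> \<cdot>)\<close> on sets bounded away
  from the zero function, and the characterisation follows the pattern of weak convergence in a function space:
  finite-dimensional limits identify the limit, and the modulus condition supplies the compactness.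

  Necessity. A projection \<^term>\<open>proj \<gamma>\<close> is continuous, commutes with scaling and does not increase the norm, so
  test functions on \<open>\<real>\<^sup>m\<close> pull back to test functions of the path, and the finite-dimensional limits are the
  projections of \<open>\<mu>\<close> without the origin. A single node \<open>u\<close> with \<open>\<mu>{\<bar>x(u)\<bar> > 0} > 0\<close> serves as \<open>\<gamma>\<^sub>0\<close>; one exists because a non-zero
  path is non-zero at a rational point (\<open>RV_imp_fidi\<close>). A ramp of the modulus of continuity is a test function,
  and its \<open>\<mu>\<close>-integral vanishes in the limit of small mesh (\<open>RV_imp_modulus_condition\<close>).

  Sufficiency. A path is replaced by the sequence of its values at a countable dense set of nodes. Limits of tail
  functionals are unique, so the finite-dimensional limits are consistent away from the origin. They have
  possibly infinite mass near the origin; hence Kolmogorov's theorem is applied to each of countably many pieces on which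
  the mass is finite, and the results are added (\<open>ex_measure_on_sequences\<close>, \<open>ex_sample_tail_measure\<close>). The modulus
  condition transfers to the resulting measure \<open>Q\<close> and forces \<open>Q\<close>-almost every sequence to be uniformly
  continuous on the nodes, that is, to be the sample of a path (\<open>Q_regular\<close>); \<open>\<mu>\<close> is the image of \<open>Q\<close>. For a
  Lipschitz test function \<open>f\<close> the values \<open>f(\<xi>/t)\<close> and \<open>f\<close> of the piecewise linear interpolation of \<open>\<xi>/t\<close> differ by an amount that the
  modulus condition controls, and the latter depends on finitely many coordinates (\<open>Lipschitz_limit\<close>). A non-negative
  continuous test function is an increasing limit of Lipschitz ones, its inf-convolutions, which gives the lower
  half of the convergence; applying it to \<open>H + f\<close> and \<open>H - f\<close> with a Lipschitz majorant \<open>H\<close> of \<open>\<bar>f\<bar>\<close> gives both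
  halves (\<open>convergence\<close>).

  The norm. Evaluating the limit of \<open>g(t) E h(\<parallel>\<xi>\<parallel>/t)\<close> for a ramp \<open>h\<close> along \<open>t\<close> and along \<open>st\<close> shows that \<open>g(st)/g(t)\<close>
  converges; the limit is multiplicative and monotone in \<open>s\<close>, hence a power (\<open>regular_variation_exponent\<close>). The
  same comparison makes the law of the norm under \<open>\<mu>\<close> homogeneous, so that it is a multiple of \<open>\<theta>\<^sub>\<alpha>\<close> (\<open>tail_power\<close>), and
  the multiple is \<open>\<mu>{\<parallel>x\<parallel> > 1}\<close>, the limit of the masses of \<open>{max \<bar>x(u)\<bar> > 1}\<close> along refining grids (\<open>sup_mass_eq\<close>).
\<close>

section \<open>Measures determined by continuous test functions\<close>

text \<open>
  Truncated multiples of the distance to the complement increase to the indicator of an open set. The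
  complement of the whole space is empty, where \<^const>\<open>infdist\<close> is 0 by convention, hence the case distinction.
\<close>

lemma lim_integral_open:
  fixes N :: "'a::metric_space measure"
  assumes sN: "sets N = sets borel" and V: "open V" and fin: "emeasure N V < \<infinity>"
  defines "F \<equiv> \<lambda>k x. if V = UNIV then 1 else min 1 (real k * infdist x (- V))"
  shows "(\<lambda>k. \<integral>x. F k x \<partial>N) \<longlonglongrightarrow> measure N V"
proof -
  have cF: "continuous_on UNIV (F k)" for k
    unfolding F_def by (cases "V = UNIV") (auto intro!: continuous_intros)
  have Fm: "F k \<in> borel_measurable N" for k
    using borel_measurable_continuous_onI[OF cF] sN by (simp cong: measurable_cong_sets)
  have Vs: "V \<in> sets N" using V sN by simp
  have F0: "F k x = 0" if "x \<notin> V" for k x using that by (auto simp: F_def)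
  have F1: "0 \<le> F k x" "F k x \<le> 1" for k x by (auto simp: F_def infdist_nonneg)
  have lim: "(\<lambda>k. F k x) \<longlonglongrightarrow> indicator V x" for x
  proof (cases "x \<in> V \<and> V \<noteq> UNIV")
    case True
    then have "0 < infdist x (- V)"
      using V by (metis ComplD ComplI closed_Compl compl_eq_compl_iff double_complement
          in_closed_iff_infdist_zero infdist_nonneg less_eq_real_def Compl_UNIV_eq Compl_empty_eq)
    then obtain n where n: "1 < real n * infdist x (- V)" using reals_Archimedean3 by blast
    have "F k x = indicator V x" if "k \<ge> n" for k
    proof -
      have "real n * infdist x (- V) \<le> real k * infdist x (- V)"
        using that by (intro mult_right_mono) (auto simp: infdist_nonneg)
      then show ?thesis using n True by (auto simp: F_def)
    qed
    then show ?thesis by (intro tendsto_eventually) (auto simp: eventually_sequentially)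
  next
    case False
    then have "F k x = indicator V x" for k using F0 by (auto simp: F_def indicator_def)
    then show ?thesis by simp
  qed
  have "(\<lambda>k. \<integral>x. F k x \<partial>N) \<longlonglongrightarrow> (\<integral>x. indicator V x \<partial>N)"
  proof (rule integral_dominated_convergence[where w = "indicator V"])
    show "integrable N (indicator V :: 'a \<Rightarrow> real)" using Vs fin by (simp add: integrable_indicator_iff)
    show "AE x in N. norm (F k x) \<le> indicator V x" for k
      using F1 F0 by (intro AE_I2) (auto simp: indicator_def)
  qed (use Fm Vs lim in auto)
  then show ?thesis using Vs by simp
qed

text \<open>
  Restriction to \<open>G\<close> makes both measures finite, and the open sets form a generating \<open>\<pi>\<close>-system on which
  they agree by approximation with continuous functions.
\<close>

lemma density_indicator_eqI_open:
  fixes N1 N2 :: "'a::metric_space measure"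
  assumes s1: "sets N1 = sets borel" and s2: "sets N2 = sets borel" and G: "open G"
    and f1: "emeasure N1 G < \<infinity>" and f2: "emeasure N2 G < \<infinity>"
    and eq: "\<And>F::'a \<Rightarrow> real. continuous_on UNIV F \<Longrightarrow> (\<And>x. 0 \<le> F x \<and> F x \<le> 1) \<Longrightarrow> (\<And>x. x \<notin> G \<Longrightarrow> F x = 0)
      \<Longrightarrow> (\<integral>x. F x \<partial>N1) = (\<integral>x. F x \<partial>N2)"
  shows "density N1 (indicator G) = density N2 (indicator G)"
proof (rule measure_eqI_generator_eq[where \<Omega> = UNIV and E = "Collect open" and A = "\<lambda>_::nat. UNIV"])
  have Gs: "G \<in> sets N1" "G \<in> sets N2" using G s1 s2 by auto
  show "Int_stable (Collect open :: 'a set set)" by (auto simp: Int_stable_def)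
  show "sets (density N1 (indicator G)) = sigma_sets UNIV (Collect open)"
    "sets (density N2 (indicator G)) = sigma_sets UNIV (Collect open)"
    using s1 s2 by (simp_all add: sets_borel)
  have e: "emeasure N1 V = emeasure N2 V" if V: "open V" "V \<subseteq> G" for V
  proof -
    have v1: "emeasure N1 V < \<infinity>" using f1 V Gs by (meson emeasure_mono le_less_trans)
    have v2: "emeasure N2 V < \<infinity>" using f2 V Gs by (meson emeasure_mono le_less_trans)
    let ?F = "\<lambda>k x. if V = UNIV then 1 else min 1 (real k * infdist x (- V))"
    have "(\<integral>x. ?F k x \<partial>N1) = (\<integral>x. ?F k x \<partial>N2)" for k
    proof (rule eq)
      show "continuous_on UNIV (?F k)" by (cases "V = UNIV") (auto intro!: continuous_intros)
      show "?F k x = 0" if "x \<notin> G" for x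
      proof -
        have "x \<in> - V" using that V by auto
        then show ?thesis by auto
      qed
    qed (auto simp: infdist_nonneg)
    then have "measure N1 V = measure N2 V"
      using lim_integral_open[OF s1 V(1) v1] lim_integral_open[OF s2 V(1) v2] LIMSEQ_unique by auto
    then show ?thesis using v1 v2 by (simp add: emeasure_eq_ennreal_measure)
  qed
  show "emeasure (density N1 (indicator G)) X = emeasure (density N2 (indicator G)) X" if "X \<in> Collect open" for X
  proof -
    have "X \<in> sets N1" "X \<in> sets N2" using that s1 s2 by auto
    moreover have "emeasure N1 (G \<inter> X) = emeasure N2 (G \<inter> X)" using that G by (intro e) auto
    ultimately show ?thesis using Gs by (simp add: emeasure_density_const emeasure_restricted)
  qed
  show "emeasure (density N1 (indicator G)) UNIV \<noteq> \<infinity>"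
    using f1 Gs s1 sets_eq_imp_space_eq[OF s1] by (simp add: emeasure_restricted)
qed auto

lemma density_indicator_eq_iff:
  assumes s: "sets N1 = sets N2" and G: "G \<in> sets N1"
  shows "density N1 (indicator G) = density N2 (indicator G) \<longleftrightarrow>
    (\<forall>A\<in>sets N1. A \<subseteq> G \<longrightarrow> emeasure N1 A = emeasure N2 A)"
proof
  assume d: "density N1 (indicator G) = density N2 (indicator G)"
  show "\<forall>A\<in>sets N1. A \<subseteq> G \<longrightarrow> emeasure N1 A = emeasure N2 A"
  proof (intro ballI impI)
    fix A assume A: "A \<in> sets N1" "A \<subseteq> G"
    have "emeasure (density N1 (indicator G)) A = emeasure (density N2 (indicator G)) A" by (simp add: d)
    moreover have "G \<inter> A = A" using A by auto
    ultimately show "emeasure N1 A = emeasure N2 A"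
      using A G s by (simp add: emeasure_restricted)
  qed
next
  assume e: "\<forall>A\<in>sets N1. A \<subseteq> G \<longrightarrow> emeasure N1 A = emeasure N2 A"
  show "density N1 (indicator G) = density N2 (indicator G)"
  proof (rule measure_eqI)
    fix A assume "A \<in> sets (density N1 (indicator G))"
    then have A: "A \<in> sets N1" by simp
    then have "emeasure N1 (G \<inter> A) = emeasure N2 (G \<inter> A)" using e G by auto
    then show "emeasure (density N1 (indicator G)) A = emeasure (density N2 (indicator G)) A"
      using A G s by (simp add: emeasure_restricted)
  qed (use s in simp)
qed

lemma integral_density_indicator:
  fixes F :: "'a \<Rightarrow> real"
  assumes F: "F \<in> borel_measurable N" and G: "G \<in> sets N" and z: "\<And>x. x \<in> space N \<Longrightarrow> x \<notin> G \<Longrightarrow> F x = 0"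
  shows "(\<integral>x. F x \<partial>density N (indicator G)) = (\<integral>x. F x \<partial>N)"
proof -
  have "density N (indicator G) = density N (\<lambda>x. ennreal (indicator G x))"
    by (rule arg_cong[where f = "density N"]) (simp add: fun_eq_iff indicator_def)
  then have "(\<integral>x. F x \<partial>density N (indicator G)) = (\<integral>x. indicator G x *\<^sub>R F x \<partial>N)"
    using F G by (subst integral_density[symmetric]) auto
  also have "\<dots> = (\<integral>x. F x \<partial>N)"
    using z by (intro Bochner_Integration.integral_cong) (auto simp: indicator_def)
  finally show ?thesis .
qed

lemma integral_cong_on_set:
  fixes F :: "'a \<Rightarrow> real"
  assumes s: "sets N1 = sets N2" and G: "G \<in> sets N1" and F: "F \<in> borel_measurable N1"
    and z: "\<And>x. x \<in> space N1 \<Longrightarrow> x \<notin> G \<Longrightarrow> F x = 0"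
    and e: "\<And>A. A \<in> sets N1 \<Longrightarrow> A \<subseteq> G \<Longrightarrow> emeasure N1 A = emeasure N2 A"
  shows "(\<integral>x. F x \<partial>N1) = (\<integral>x. F x \<partial>N2)"
proof -
  have "density N1 (indicator G) = density N2 (indicator G)"
    using density_indicator_eq_iff[OF s G] e by auto
  moreover have "F \<in> borel_measurable N2" using F s by (simp cong: measurable_cong_sets)
  ultimately show ?thesis
    using integral_density_indicator[OF F G z] integral_density_indicator[of F N2 G] G s z
      sets_eq_imp_space_eq[OF s] by auto
qed

lemma integrable_bounded_support:
  fixes F :: "'a \<Rightarrow> real"
  assumes F: "F \<in> borel_measurable N" and G: "G \<in> sets N" and fin: "emeasure N G < \<infinity>"
    and b: "\<And>x. x \<in> space N \<Longrightarrow> \<bar>F x\<bar> \<le> B" and z: "\<And>x. x \<in> space N \<Longrightarrow> x \<notin> G \<Longrightarrow> F x = 0"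
  shows "integrable N F"
proof (rule Bochner_Integration.integrable_bound)
  show "integrable N (\<lambda>x. B * indicator G x)" using G fin by (simp add: integrable_indicator_iff)
  show "AE x in N. norm (F x) \<le> norm (B * indicator G x)"
    using b z by (intro AE_I2) (force simp: indicator_def)
qed fact

section \<open>Sums and projective limits of finite measures\<close>

text \<open>
  Countable additivity of the sum is Tonelli's theorem for counting measure.
\<close>

lemma ex_countable_sum_measure:
  fixes Q :: "nat \<Rightarrow> 'a measure"
  assumes s: "\<And>n. sets (Q n) = sets S"
  obtains R where "sets R = sets S" "\<And>A. A \<in> sets S \<Longrightarrow> emeasure R A = (\<Sum>n. emeasure (Q n) A)"
proof
  define R where "R = measure_of (space S) (sets S) (\<lambda>A. \<Sum>n. emeasure (Q n) A)"
  show sR: "sets R = sets S" by (simp add: R_def)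
  show "emeasure R A = (\<Sum>n. emeasure (Q n) A)" if A: "A \<in> sets S" for A
  proof (rule emeasure_measure_of[OF R_def])
    show "countably_additive (sets R) (\<lambda>A. \<Sum>n. emeasure (Q n) A)"
    proof (rule countably_additiveI)
      fix A :: "nat \<Rightarrow> 'a set"
      assume A: "range A \<subseteq> sets R" "disjoint_family A"
      have r: "range A \<subseteq> sets (Q n)" for n using A s sR by auto
      have "(\<Sum>i. \<Sum>n. emeasure (Q n) (A i)) = (\<Sum>n. \<Sum>i. emeasure (Q n) (A i))"
        using nn_integral_suminf[of "\<lambda>i n. emeasure (Q n) (A i)" "count_space UNIV"]
        by (simp add: nn_integral_count_space_nat)
      also have "\<dots> = (\<Sum>n. emeasure (Q n) (\<Union>i. A i))"
        using r A by (simp add: suminf_emeasure)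
      finally show "(\<Sum>i. \<Sum>n. emeasure (Q n) (A i)) = (\<Sum>n. emeasure (Q n) (\<Union>i. A i))" .
    qed
  qed (use A sR sets.sets_into_space in \<open>auto simp: positive_def\<close>)
qed

text \<open>
  Kolmogorov's extension theorem for measures of common finite total mass: divide by that mass and
  multiply again afterwards.
\<close>

lemma ex_projective_limit_finite:
  fixes P :: "nat set \<Rightarrow> (nat \<Rightarrow> real) measure"
  assumes con: "\<And>J H. J \<subseteq> H \<Longrightarrow> finite H \<Longrightarrow>
      P J = distr (P H) (Pi\<^sub>M J (\<lambda>_. borel)) (\<lambda>f. restrict f J)"
    and fin: "emeasure (P {}) (space (P {})) < \<infinity>"
  obtains Q :: "(nat \<Rightarrow> real) measure" where "sets Q = sets borel"
    "\<And>J X. finite J \<Longrightarrow> X \<in> sets (Pi\<^sub>M J (\<lambda>_. borel)) \<Longrightarrow>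
        emeasure Q {y. restrict y J \<in> X} = emeasure (P J) X"
proof -
  define m where "m = emeasure (P {}) (space (P {}))"
  have sP: "sets (P J) = sets (Pi\<^sub>M J (\<lambda>_. borel))" if "finite J" for J
    using that by (subst con[of J J]) auto
  have spP: "space (P J) = space (Pi\<^sub>M J (\<lambda>_. borel :: real measure))" if "finite J" for J
    by (rule sets_eq_imp_space_eq[OF sP[OF that]])
  have rm: "(\<lambda>f. restrict f J) \<in> P H \<rightarrow>\<^sub>M Pi\<^sub>M J (\<lambda>_. borel)" if "J \<subseteq> H" "finite H" for J H
    using measurable_restrict_subset[OF that(1), of "\<lambda>_. borel :: real measure"] sP[OF that(2)]
    by (simp cong: measurable_cong_sets)
  have mP: "emeasure (P J) (space (P J)) = m" if J: "finite J" for J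
  proof -
    have "m = emeasure (distr (P J) (Pi\<^sub>M {} (\<lambda>_. borel)) (\<lambda>f. restrict f {})) (space (P {}))"
      unfolding m_def using con[of "{}" J] J by simp
    also have "\<dots> = emeasure (P J) ((\<lambda>f. restrict f {}) -` space (P {}) \<inter> space (P J))"
      by (rule emeasure_distr[OF rm]) (use J spP[of "{}"] in auto)
    also have "(\<lambda>f. restrict f {}) -` space (P {}) \<inter> space (P J) = space (P J)"
      using spP[of "{}"] by (auto simp: space_PiM)
    finally show ?thesis by simp
  qed
  show thesis
  proof (cases "m = 0")
    case True
    have "emeasure (P J) X = 0" if "finite J" "X \<in> sets (Pi\<^sub>M J (\<lambda>_. borel))" for J X
      using mP[OF that(1)] True emeasure_space[of "P J" X] by auto
    then show thesis by (intro that[of "null_measure borel"]) auto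
  next
    case False
    define P' where "P' J = scale_measure (1 / m) (P J)" for J
    have mf: "m < top" using fin unfolding m_def infinity_ennreal_def .
    have m1: "1 / m * m = 1" using False mf by (simp add: ennreal_divide_times)
    interpret polish_projective UNIV P'
    proof (intro polish_projective.intro projective_family.intro)
      show "P' J = distr (P' H) (Pi\<^sub>M J (\<lambda>_. borel)) (\<lambda>f. restrict f J)"
        if "J \<subseteq> H" "finite H" for J H
      proof (rule measure_eqI)
        have fJ: "finite J" using that finite_subset by blast
        show "sets (P' J) = sets (distr (P' H) (Pi\<^sub>M J (\<lambda>_. borel)) (\<lambda>f. restrict f J))"
          using sP[OF fJ] by (simp add: P'_def)
        fix A assume "A \<in> sets (P' J)"
        then have A: "A \<in> sets (Pi\<^sub>M J (\<lambda>_. borel))" using sP[OF fJ] by (simp add: P'_def)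
        have "emeasure (P J) A = emeasure (P H) ((\<lambda>f. restrict f J) -` A \<inter> space (P H))"
          by (subst con[OF that]) (rule emeasure_distr[OF rm[OF that] A])
        moreover have "(\<lambda>f. restrict f J) \<in> P' H \<rightarrow>\<^sub>M Pi\<^sub>M J (\<lambda>_. borel)"
          using rm[OF that] by (simp add: P'_def cong: measurable_cong_sets)
        ultimately show "emeasure (P' J) A = emeasure (distr (P' H) (Pi\<^sub>M J (\<lambda>_. borel)) (\<lambda>f. restrict f J)) A"
          using A by (simp add: P'_def emeasure_distr space_scale_measure)
      qed
      show "prob_space (P' J)" if "finite J" for J
        by (rule prob_spaceI) (simp add: P'_def mP[OF that] m1 space_scale_measure)
    qed
    let ?Q = "scale_measure m (distr lim borel (\<lambda>y. y))"
    have sl: "sets lim = sets (borel :: (nat \<Rightarrow> real) measure)"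
      using sets_lim sets_PiM_equal_borel by metis
    have idm: "(\<lambda>y. y) \<in> lim \<rightarrow>\<^sub>M borel" using measurable_ident_sets[OF sl] by simp
    show thesis
    proof (rule that[of ?Q])
      fix J :: "nat set" and X
      assume J: "finite J" and X: "X \<in> sets (Pi\<^sub>M J (\<lambda>_. borel :: real measure))"
      have e: "{y. restrict y J \<in> X} = emb UNIV J X" by (auto simp: prod_emb_def space_PiM)
      have "emb UNIV J X \<in> sets borel"
        using sets_PiM_equal_borel measurable_prod_emb[of J UNIV X "\<lambda>_. borel"] X by auto
      then have "emeasure ?Q {y. restrict y J \<in> X} = m * emeasure lim (emb UNIV J X)"
        using idm sets_eq_imp_space_eq[OF sl] by (simp add: e emeasure_distr)
      also have "\<dots> = m * (1 / m * emeasure (P J) X)"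
        using J X by (simp add: emeasure_lim_emb P'_def)
      also have "\<dots> = emeasure (P J) X"
        using m1 by (metis mult.commute mult.assoc mult.right_neutral)
      finally show "emeasure ?Q {y. restrict y J \<in> X} = emeasure (P J) X" .
    qed simp
  qed
qed

section \<open>Infinite measures on sequences\<close>

text \<open>
  Coordinates outside \<open>K\<close> are set to 0 instead of being dropped, so that all finite-dimensional marginals
  live on the one Polish space of real sequences.
\<close>

definition restr :: "nat set \<Rightarrow> (nat \<Rightarrow> real) \<Rightarrow> nat \<Rightarrow> real" where
  "restr K y = (\<lambda>i. if i \<in> K then y i else 0)"

definition exceed :: "nat set \<Rightarrow> real \<Rightarrow> (nat \<Rightarrow> real) set" where
  "exceed K c = {y. \<exists>i\<in>K. c < \<bar>y i\<bar>}"

lemma continuous_on_coord: "continuous_on S (\<lambda>y :: 'i \<Rightarrow> real. y i)"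
  using continuous_on_subset[OF continuous_on_product_coordinates subset_UNIV] .

lemma continuous_restr: "continuous_on UNIV (restr K)"
  unfolding restr_def
proof (rule continuous_on_coordinatewise_then_product)
  show "continuous_on UNIV (\<lambda>y :: nat \<Rightarrow> real. if i \<in> K then y i else 0)" for i
    by (cases "i \<in> K") (simp_all add: continuous_on_coord)
qed

lemma measurable_restr: "restr K \<in> borel \<rightarrow>\<^sub>M borel"
  by (rule borel_measurable_continuous_onI[OF continuous_restr])

lemma open_exceed: "open (exceed K c)"
proof -
  have "exceed K c = (\<Union>i\<in>K. {y. c < \<bar>y i\<bar>})" by (auto simp: exceed_def)
  moreover have "open {y :: nat \<Rightarrow> real. c < \<bar>y i\<bar>}" for i
    by (intro open_Collect_less continuous_intros continuous_on_coord)
  ultimately show ?thesis by auto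
qed

lemma borel_exceed [measurable, simp]: "exceed K c \<in> sets borel"
  using open_exceed by auto

lemma exceed_mono: "K \<subseteq> H \<Longrightarrow> d \<le> c \<Longrightarrow> exceed K c \<subseteq> exceed H d"
  by (force simp: exceed_def)

lemma restr_in_exceed: "K \<subseteq> H \<Longrightarrow> restr H y \<in> exceed K c \<longleftrightarrow> y \<in> exceed K c"
  by (auto simp: restr_def exceed_def)

lemma restr_restr: "restr K (restr H y) = restr (K \<inter> H) y"
  by (auto simp: restr_def)

lemma measurable_restrict_borel: "(\<lambda>y. restrict y J) \<in> (borel :: (nat \<Rightarrow> real) measure) \<rightarrow>\<^sub>M Pi\<^sub>M J (\<lambda>_. borel)"
  using measurable_restrict_subset[of J UNIV "\<lambda>_. borel :: real measure"] sets_PiM_equal_borel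
  by (simp cong: measurable_cong_sets)

text \<open>
  Away from the origin the \<open>\<nu> K\<close> are consistent, because continuous functions determine them there, but their
  total mass may be infinite. Sequence space without the zero sequence is the increasing union of the sets
  \<open>A n = {y. \<exists>i<n. 1/(n+1) < \<bar>y i\<bar>}\<close>, each of which depends on finitely many coordinates and has finite mass.
  Kolmogorov's theorem extends the restrictions to each piece \<open>C n\<close> of the disjointed sequence. A set bounded away from
  zero in the coordinates \<open>K\<close> meets only finitely many pieces, so the sum of the extensions has the right value on it.
\<close>

proposition ex_measure_on_sequences:
  fixes \<nu> :: "nat set \<Rightarrow> (nat \<Rightarrow> real) measure"
  assumes s\<nu>: "\<And>K. finite K \<Longrightarrow> sets (\<nu> K) = sets borel"
    and fin: "\<And>K c. finite K \<Longrightarrow> 0 < c \<Longrightarrow> emeasure (\<nu> K) (exceed K c) < \<infinity>"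
    and con: "\<And>K H c F. K \<subseteq> H \<Longrightarrow> finite H \<Longrightarrow> 0 < c \<Longrightarrow> continuous_on UNIV F \<Longrightarrow>
      (\<And>y. 0 \<le> F y \<and> F y \<le> (1::real)) \<Longrightarrow> (\<And>y. y \<notin> exceed K c \<Longrightarrow> F y = 0) \<Longrightarrow>
      (\<integral>y. F (restr K y) \<partial>\<nu> K) = (\<integral>y. F (restr K y) \<partial>\<nu> H)"
  obtains Q where "sets Q = sets borel" "emeasure Q {\<lambda>_. 0} = 0"
    "\<And>K A c. finite K \<Longrightarrow> 0 < c \<Longrightarrow> A \<in> sets borel \<Longrightarrow> A \<subseteq> exceed K c \<Longrightarrow>
      (\<And>y. restr K y \<in> A \<longleftrightarrow> y \<in> A) \<Longrightarrow> emeasure Q A = emeasure (\<nu> K) A"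
proof -
  have sp: "space (\<nu> K) = UNIV" if "finite K" for K
    using sets_eq_imp_space_eq[OF s\<nu>[OF that]] by simp
  have mr: "restr K \<in> \<nu> H \<rightarrow>\<^sub>M borel" if "finite H" for K H
    using measurable_restr s\<nu>[OF that] by (simp cong: measurable_cong_sets)
  \<comment> \<open>Both sides are values of images under \<^term>\<open>restr K\<close>, to which the test functions of the hypothesis apply.\<close>
  have consistent: "emeasure (\<nu> H) A = emeasure (\<nu> K) A"
    if KH: "K \<subseteq> H" "finite H" and c: "0 < c" and A: "A \<in> sets borel" "A \<subseteq> exceed K c"
      and inv: "\<And>y. restr K y \<in> A \<longleftrightarrow> y \<in> A" for K H A c
  proof -
    have fK: "finite K" using KH finite_subset by blast
    let ?N1 = "distr (\<nu> H) borel (restr K)" and ?N2 = "distr (\<nu> K) borel (restr K)"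
    have e: "emeasure (distr (\<nu> L) borel (restr K)) B = emeasure (\<nu> L) B"
      if "finite L" "B \<in> sets borel" "\<And>y. restr K y \<in> B \<longleftrightarrow> y \<in> B" for L B
      using that mr[of L K] by (subst emeasure_distr) (auto simp: sp vimage_def)
    have fH: "emeasure (\<nu> H) (exceed K c) < \<infinity>"
    proof -
      have "emeasure (\<nu> H) (exceed K c) \<le> emeasure (\<nu> H) (exceed H c)"
        using KH s\<nu> by (intro emeasure_mono exceed_mono) auto
      also have "\<dots> < \<infinity>" by (rule fin) fact+
      finally show ?thesis .
    qed
    have "density ?N1 (indicator (exceed K c)) = density ?N2 (indicator (exceed K c))"
    proof (rule density_indicator_eqI_open)
      show "emeasure ?N1 (exceed K c) < \<infinity>" "emeasure ?N2 (exceed K c) < \<infinity>"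
        using fH fin[OF fK c] e[OF KH(2)] e[OF fK] by (simp_all add: restr_in_exceed)
      fix F :: "(nat \<Rightarrow> real) \<Rightarrow> real"
      assume F: "continuous_on UNIV F" "\<And>x. 0 \<le> F x \<and> F x \<le> 1" "\<And>x. x \<notin> exceed K c \<Longrightarrow> F x = 0"
      have "F \<in> borel_measurable borel" by (rule borel_measurable_continuous_onI) fact
      then show "(\<integral>x. F x \<partial>?N1) = (\<integral>x. F x \<partial>?N2)"
        using con[OF KH c F] mr fK KH by (simp add: integral_distr)
    qed (use open_exceed in auto)
    then have "emeasure ?N1 A = emeasure ?N2 A"
      using A by (subst (asm) density_indicator_eq_iff) auto
    then show ?thesis using A inv e KH fK by simp
  qed
  define A where "A n = exceed {..<n} (1 / real (Suc n))" for n
  define C where "C n = disjointed A n" for n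
  have Cb [measurable]: "C n \<in> sets borel" for n
    unfolding C_def disjointed_def A_def by measurable
  have CA: "C n \<subseteq> A n" for n unfolding C_def by (rule disjointed_subset)
  have C_inv: "restr K y \<in> C n \<longleftrightarrow> y \<in> C n" if "{..<n} \<subseteq> K" for K n y
  proof -
    have "restr K y \<in> A m \<longleftrightarrow> y \<in> A m" if "m \<le> n" for m
      unfolding A_def by (rule restr_in_exceed) (use \<open>{..<n} \<subseteq> K\<close> that in auto)
    then show ?thesis by (auto simp: C_def disjointed_def)
  qed
  define P where "P n J = distr (density (\<nu> (J \<union> {..<n})) (indicator (C n))) (Pi\<^sub>M J (\<lambda>_. borel)) (\<lambda>y. restrict y J)"
    for n J
  have Db: "{y. restrict y J \<in> X} \<in> sets borel"
    if "X \<in> sets (Pi\<^sub>M J (\<lambda>_. borel))" for J :: "nat set" and X :: "(nat \<Rightarrow> real) set"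
    using measurable_sets[OF measurable_restrict_borel that] by (simp add: vimage_def)
  have eP: "emeasure (P n J) X = emeasure (\<nu> (J \<union> {..<n})) (C n \<inter> {y. restrict y J \<in> X})"
    if J: "finite J" and X: "X \<in> sets (Pi\<^sub>M J (\<lambda>_. borel))" for n J X
  proof -
    have fJ: "finite (J \<union> {..<n})" using J by simp
    have "(\<lambda>y. restrict y J) \<in> density (\<nu> (J \<union> {..<n})) (indicator (C n)) \<rightarrow>\<^sub>M Pi\<^sub>M J (\<lambda>_. borel)"
      using measurable_restrict_borel[of J] s\<nu>[OF fJ] by (simp cong: measurable_cong_sets)
    then have "emeasure (P n J) X = emeasure (density (\<nu> (J \<union> {..<n})) (indicator (C n))) {y. restrict y J \<in> X}"
      unfolding P_def using X sp[OF fJ] by (subst emeasure_distr) (auto simp: vimage_def)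
    also have "\<dots> = emeasure (\<nu> (J \<union> {..<n})) (C n \<inter> {y. restrict y J \<in> X})"
      using Db[OF X] s\<nu>[OF fJ] by (intro emeasure_restricted) auto
    finally show ?thesis .
  qed
  have ex: "\<exists>Q. sets Q = sets borel \<and> (\<forall>J X. finite J \<longrightarrow> X \<in> sets (Pi\<^sub>M J (\<lambda>_. borel)) \<longrightarrow>
        emeasure Q {y. restrict y J \<in> X} = emeasure (P n J) X)" for n
  proof -
    have c: "P n J = distr (P n H) (Pi\<^sub>M J (\<lambda>_. borel)) (\<lambda>f. restrict f J)"
      if JH: "J \<subseteq> H" "finite H" for J H
    proof (rule measure_eqI)
      have fJ: "finite J" using JH finite_subset by blast
      show "sets (P n J) = sets (distr (P n H) (Pi\<^sub>M J (\<lambda>_. borel)) (\<lambda>f. restrict f J))"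
        by (simp add: P_def)
      fix X assume "X \<in> sets (P n J)"
      then have X: "X \<in> sets (Pi\<^sub>M J (\<lambda>_. borel))" by (simp add: P_def)
      have m: "(\<lambda>f. restrict f J) \<in> Pi\<^sub>M H (\<lambda>_. borel :: real measure) \<rightarrow>\<^sub>M Pi\<^sub>M J (\<lambda>_. borel)"
        by (rule measurable_restrict_subset[OF JH(1)])
      let ?Y = "(\<lambda>f. restrict f J) -` X \<inter> space (Pi\<^sub>M H (\<lambda>_. borel :: real measure))"
      have Y: "?Y \<in> sets (Pi\<^sub>M H (\<lambda>_. borel))" by (rule measurable_sets[OF m X])
      have "emeasure (distr (P n H) (Pi\<^sub>M J (\<lambda>_. borel)) (\<lambda>f. restrict f J)) X = emeasure (P n H) ?Y"
        using m X by (subst emeasure_distr) (auto simp: P_def)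
      also have "\<dots> = emeasure (\<nu> (H \<union> {..<n})) (C n \<inter> {y. restrict y H \<in> ?Y})"
        by (rule eP[OF JH(2) Y])
      also have "{y. restrict y H \<in> ?Y} = {y. restrict y J \<in> X}"
        using JH(1) by (auto simp: space_PiM Int_absorb1)
      also have "emeasure (\<nu> (H \<union> {..<n})) (C n \<inter> {y. restrict y J \<in> X}) =
          emeasure (\<nu> (J \<union> {..<n})) (C n \<inter> {y. restrict y J \<in> X})"
      proof (rule consistent)
        show "J \<union> {..<n} \<subseteq> H \<union> {..<n}" "finite (H \<union> {..<n})" using JH by auto
        show "0 < 1 / real (Suc n)" by simp
        show "C n \<inter> {y. restrict y J \<in> X} \<in> sets borel" using Db[OF X] by auto
        show "C n \<inter> {y. restrict y J \<in> X} \<subseteq> exceed (J \<union> {..<n}) (1 / real (Suc n))"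
          using CA[of n] exceed_mono[of "{..<n}" "J \<union> {..<n}"] unfolding A_def by blast
        have "restrict (restr (J \<union> {..<n}) y) J = restrict y J" for y
          by (auto simp: restr_def restrict_def)
        then show "restr (J \<union> {..<n}) y \<in> C n \<inter> {y. restrict y J \<in> X} \<longleftrightarrow> y \<in> C n \<inter> {y. restrict y J \<in> X}" for y
          using C_inv[of n "J \<union> {..<n}" y] by auto
      qed
      also have "\<dots> = emeasure (P n J) X" by (rule eP[OF fJ X, symmetric])
      finally show "emeasure (P n J) X = emeasure (distr (P n H) (Pi\<^sub>M J (\<lambda>_. borel)) (\<lambda>f. restrict f J)) X" by (rule sym)
    qed
    have spP: "space (P n {}) \<in> sets (Pi\<^sub>M {} (\<lambda>_. borel))" by (simp add: P_def)
    have "emeasure (P n {}) (space (P n {})) \<le> emeasure (\<nu> {..<n}) (A n)"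
      using eP[OF _ spP] CA[of n] s\<nu>[of "{..<n}"] by (auto intro!: emeasure_mono simp: A_def)
    also have "\<dots> < \<infinity>" unfolding A_def by (rule fin) auto
    finally have f: "emeasure (P n {}) (space (P n {})) < \<infinity>" .
    show ?thesis
      by (rule ex_projective_limit_finite[of "P n"]) (use c f in auto)
  qed
  then obtain Q where Q: "\<And>n. sets (Q n) = sets borel"
    and eQ: "\<And>n J X. finite J \<Longrightarrow> X \<in> sets (Pi\<^sub>M J (\<lambda>_. borel)) \<Longrightarrow>
        emeasure (Q n) {y. restrict y J \<in> X} = emeasure (P n J) X"
    by metis
  obtain R where R: "sets R = sets (borel :: (nat \<Rightarrow> real) measure)"
    and eR: "\<And>A. A \<in> sets borel \<Longrightarrow> emeasure R A = (\<Sum>n. emeasure (Q n) A)"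
    using ex_countable_sum_measure[of Q borel] Q by metis
  \<comment> \<open>Sets that depend on the coordinates in \<open>K\<close> are cylinders over the finite product, where \<open>eQ\<close> applies.\<close>
  have eQ': "emeasure (Q n) B = emeasure (\<nu> (K \<union> {..<n})) (C n \<inter> B)"
    if K: "finite K" and B: "B \<in> sets borel" and inv: "\<And>y. restr K y \<in> B \<longleftrightarrow> y \<in> B" for n K B
  proof -
    let ?X = "{z \<in> space (Pi\<^sub>M K (\<lambda>_. borel :: real measure)). restr K z \<in> B}"
    have "(\<lambda>z. restr K z) \<in> Pi\<^sub>M K (\<lambda>_. borel) \<rightarrow>\<^sub>M Pi\<^sub>M UNIV (\<lambda>_. borel)"
    proof (rule measurable_PiM_single')
      show "(\<lambda>z. restr K z i) \<in> Pi\<^sub>M K (\<lambda>_. borel) \<rightarrow>\<^sub>M borel" for i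
        by (cases "i \<in> K") (auto simp: restr_def)
    qed (auto simp: space_PiM)
    then have "(\<lambda>z. restr K z) \<in> Pi\<^sub>M K (\<lambda>_. borel) \<rightarrow>\<^sub>M borel"
      using measurable_cong_sets[OF refl sets_PiM_equal_borel] by blast
    from measurable_sets[OF this B] have X: "?X \<in> sets (Pi\<^sub>M K (\<lambda>_. borel))"
      by (simp add: vimage_def Int_def conj_commute)
    have r: "restr K (restrict y K) = restr K y" for y by (auto simp: restr_def)
    have "restr K (restrict y K) \<in> B \<longleftrightarrow> y \<in> B" for y unfolding r by (rule inv)
    then have "{y. restrict y K \<in> ?X} = B" by (simp add: space_PiM)
    then show ?thesis using eQ[OF K X] eP[OF K X] by simp
  qed
  show thesis
  proof (rule that[OF R])
    have "emeasure (Q n) {\<lambda>_. 0} = 0" for n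
    proof -
      let ?B = "- A n :: (nat \<Rightarrow> real) set"
      have "emeasure (Q n) {\<lambda>_. 0} \<le> emeasure (Q n) ?B"
        using Q by (intro emeasure_mono) (auto simp: A_def exceed_def)
      also have "emeasure (Q n) ?B = emeasure (\<nu> ({..<n} \<union> {..<n})) (C n \<inter> ?B)"
        by (rule eQ') (auto simp: A_def restr_in_exceed)
      also have "C n \<inter> ?B = {}" using CA[of n] by auto
      finally show ?thesis by simp
    qed
    moreover have "{\<lambda>_::nat. 0::real} \<in> sets borel" by auto
    ultimately show "emeasure R {\<lambda>_. 0} = 0" using eR by simp
  next
    fix K B and c :: real
    assume K: "finite K" and c: "0 < c" and B: "B \<in> sets borel" "B \<subseteq> exceed K c"
      and inv: "\<And>y. restr K y \<in> B \<longleftrightarrow> y \<in> B"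
    \<comment> \<open>From index \<open>N\<close> on, \<open>A N\<close> contains \<open>B\<close>, so that the later pieces miss \<open>B\<close>.\<close>
    obtain n1 where n1: "K \<subseteq> {..<n1}" using K finite_nat_bounded by blast
    obtain n2 where n2: "1 / real (Suc n2) < c" using c nat_approx_posE by blast
    define N where "N = max n1 n2"
    have KN: "K \<subseteq> {..<N}" using n1 by (auto simp: N_def)
    have "1 / real (Suc N) \<le> 1 / real (Suc n2)" by (simp add: N_def frac_le)
    then have BN: "B \<subseteq> A N" using B(2) exceed_mono[OF KN, of "1 / real (Suc N)" c] n2 by (auto simp: A_def)
    have invN: "restr L y \<in> B \<longleftrightarrow> y \<in> B" if "K \<subseteq> L" for L y
      using inv[of y] inv[of "restr L y"] that by (simp add: restr_restr Int_absorb2)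
    have 1: "emeasure (Q n) B = emeasure (\<nu> {..<N}) (C n \<inter> B)" if "n \<le> N" for n
    proof -
      have "emeasure (\<nu> {..<N}) (C n \<inter> B) = emeasure (\<nu> (K \<union> {..<n})) (C n \<inter> B)"
      proof (rule consistent[OF _ _ c])
        show "C n \<inter> B \<subseteq> exceed (K \<union> {..<n}) c"
          using B(2) exceed_mono[of K "K \<union> {..<n}" c c] by auto
      qed (use KN that B C_inv invN in auto)
      then show ?thesis using eQ'[OF K B(1) inv] by simp
    qed
    have 2: "emeasure (Q n) B = 0" if "N < n" for n
    proof -
      have "C n \<inter> A N = {}" using that by (auto simp: C_def disjointed_def)
      then have "C n \<inter> B = {}" using BN by auto
      then show ?thesis using eQ'[OF K B(1) inv, of n] by simp
    qed
    have "emeasure R B = (\<Sum>n. emeasure (Q n) B)" by (rule eR) fact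
    also have "\<dots> = (\<Sum>n<Suc N. emeasure (Q n) B)" by (rule suminf_finite) (use 2 in auto)
    also have "\<dots> = (\<Sum>n<Suc N. emeasure (\<nu> {..<N}) (C n \<inter> B))" by (rule sum.cong) (use 1 in auto)
    also have "\<dots> = emeasure (\<nu> {..<N}) (\<Union>n<Suc N. C n \<inter> B)"
    proof (rule sum_emeasure)
      show "disjoint_family_on (\<lambda>n. C n \<inter> B) {..<Suc N}"
        using disjoint_family_disjointed[of A] unfolding disjoint_family_on_def C_def by blast
    qed (use B s\<nu> in auto)
    also have "(\<Union>n<Suc N. C n \<inter> B) = (\<Union>n<Suc N. C n) \<inter> B" by auto
    also have "(\<Union>n<Suc N. C n) = (\<Union>n<Suc N. A n)"
      unfolding C_def using finite_UN_disjointed_eq[of A "Suc N"] by (simp add: atLeast0LessThan)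
    also have "(\<Union>n<Suc N. A n) \<inter> B = B" using BN by auto
    also have "emeasure (\<nu> {..<N}) B = emeasure (\<nu> K) B"
      using consistent[OF KN _ c B inv] by simp
    finally show "emeasure R B = emeasure (\<nu> K) B" .
  qed
qed

section \<open>Borel sets, ideals and tail convergence\<close>

lemma space_borel_of [simp]: "space (borel_of X) = topspace X"
  by (simp add: borel_of_def space_measure_of_conv)

lemma sets_borel_of: "sets (borel_of X) = sigma_sets (topspace X) {U. openin X U}"
  unfolding borel_of_def by (rule sets_measure_of) (auto dest: openin_subset)

lemma openin_imp_borel_of: "openin X U \<Longrightarrow> U \<in> sets (borel_of X)"
  by (auto simp: sets_borel_of)

lemma closedin_imp_borel_of:
  assumes "closedin X U" shows "U \<in> sets (borel_of X)"
proof -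
  have "topspace X - (topspace X - U) \<in> sets (borel_of X)"
    using assms sets.compl_sets[of "topspace X - U" "borel_of X"] by (auto intro: openin_imp_borel_of)
  then show ?thesis using closedin_subset[OF assms] by (simp add: double_diff)
qed

lemma measurable_borel_ofI:
  assumes "f \<in> space M \<rightarrow> topspace X" "\<And>U. openin X U \<Longrightarrow> f -` U \<inter> space M \<in> sets M"
  shows "f \<in> M \<rightarrow>\<^sub>M borel_of X"
  unfolding borel_of_def using assms by (intro measurable_measure_of) (auto dest: openin_subset)

lemma continuous_map_measurable:
  assumes "continuous_map X Y f" shows "f \<in> borel_of X \<rightarrow>\<^sub>M borel_of Y"
proof (rule measurable_borel_ofI)
  fix U assume "openin Y U"
  then have "openin X {x \<in> topspace X. f x \<in> U}" using assms openin_continuous_map_preimage by blast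
  then show "f -` U \<inter> space (borel_of X) \<in> sets (borel_of X)"
    by (simp add: openin_imp_borel_of vimage_def Int_def conj_commute)
qed (use assms in \<open>auto simp: continuous_map_def\<close>)

lemma sets_borel_of_euclidean: "sets (borel_of euclidean) = sets borel"
  by (simp add: sets_borel_of borel_def)

lemma continuous_map_borel_measurable:
  fixes f :: "'a \<Rightarrow> 'b::topological_space"
  assumes "continuous_map X euclidean f" shows "f \<in> borel_of X \<rightarrow>\<^sub>M borel"
  using continuous_map_measurable[OF assms] measurable_cong_sets[OF refl sets_borel_of_euclidean] by blast

lemma in_ideal_away_iff:
  "A \<in> ideal_away X \<tau> \<longleftrightarrow> A \<subseteq> topspace X \<and> (\<exists>c>0. \<forall>x\<in>A. c \<le> \<tau> x)"
proof -
  have "(0 < (INF x\<in>A. ereal (\<tau> x))) \<longleftrightarrow> (\<exists>c>0. \<forall>x\<in>A. c \<le> \<tau> x)"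
  proof
    assume "0 < (INF x\<in>A. ereal (\<tau> x))"
    then obtain c where c: "0 < ereal c" "ereal c < (INF x\<in>A. ereal (\<tau> x))" using ereal_dense2 by blast
    then have "c \<le> \<tau> x" if "x \<in> A" for x
      using that less_INF_D[OF c(2) that] by simp
    with c show "\<exists>c>0. \<forall>x\<in>A. c \<le> \<tau> x" by auto
  next
    assume "\<exists>c>0. \<forall>x\<in>A. c \<le> \<tau> x"
    then obtain c where c: "0 < c" "\<forall>x\<in>A. c \<le> \<tau> x" by auto
    then have "ereal c \<le> (INF x\<in>A. ereal (\<tau> x))" by (intro INF_greatest) auto
    with c show "0 < (INF x\<in>A. ereal (\<tau> x))" by (meson ereal_less(2) less_le_trans)
  qed
  then show ?thesis by (simp add: ideal_away_def)
qed

lemma closedin_level: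
  assumes "continuous_map X euclideanreal \<tau>"
  shows "closedin X {x \<in> topspace X. c \<le> \<tau> x}"
  using closedin_continuous_map_preimage[OF assms, of "{c..}"] by simp

lemma borel_of_level:
  assumes "continuous_map X euclideanreal \<tau>"
  shows "{x \<in> topspace X. c \<le> \<tau> x} \<in> sets (borel_of X)"
  by (rule closedin_imp_borel_of[OF closedin_level[OF assms]])

lemma borel_of_strict_level:
  assumes "continuous_map X euclideanreal \<tau>"
  shows "{x \<in> topspace X. c < \<tau> x} \<in> sets (borel_of X)"
  using openin_continuous_map_preimage[OF assms, of "{c<..}"] by (auto intro: openin_imp_borel_of)

lemma support_in_ideal_away_iff:
  fixes f :: "'a \<Rightarrow> real"
  assumes \<tau>: "continuous_map X euclideanreal \<tau>"
  shows "X closure_of {x \<in> topspace X. f x \<noteq> 0} \<in> ideal_away X \<tau> \<longleftrightarrow>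
    (\<exists>c>0. \<forall>x\<in>topspace X. f x \<noteq> 0 \<longrightarrow> c \<le> \<tau> x)" (is "?C \<in> _ \<longleftrightarrow> _")
proof
  assume "?C \<in> ideal_away X \<tau>"
  moreover have "{x \<in> topspace X. f x \<noteq> 0} \<subseteq> ?C" by (rule closure_of_subset) auto
  ultimately show "\<exists>c>0. \<forall>x\<in>topspace X. f x \<noteq> 0 \<longrightarrow> c \<le> \<tau> x"
    by (auto simp: in_ideal_away_iff)
next
  assume "\<exists>c>0. \<forall>x\<in>topspace X. f x \<noteq> 0 \<longrightarrow> c \<le> \<tau> x"
  then obtain c where c: "0 < c" "\<forall>x\<in>topspace X. f x \<noteq> 0 \<longrightarrow> c \<le> \<tau> x" by auto
  then have "?C \<subseteq> {x \<in> topspace X. c \<le> \<tau> x}"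
    by (intro closure_of_minimal closedin_level[OF \<tau>]) auto
  with c(1) show "?C \<in> ideal_away X \<tau>"
    by (auto simp: in_ideal_away_iff)
qed

lemma tail_measure_iff:
  assumes \<tau>: "continuous_map X euclideanreal \<tau>"
  shows "tail_measure X (ideal_away X \<tau>) \<mu> \<longleftrightarrow>
    sets \<mu> = sets (borel_of X) \<and> (\<forall>c>0. emeasure \<mu> {x \<in> topspace X. c \<le> \<tau> x} < \<infinity>) \<and>
    emeasure \<mu> {x \<in> topspace X. \<tau> x \<le> 0} = 0 \<and> (\<exists>c>0. 0 < emeasure \<mu> {x \<in> topspace X. c \<le> \<tau> x})"
proof -
  have U: "topspace X - \<Union>(ideal_away X \<tau>) = {x \<in> topspace X. \<tau> x \<le> 0}"
  proof (intro set_eqI iffI)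
    fix x assume x: "x \<in> topspace X - \<Union>(ideal_away X \<tau>)"
    show "x \<in> {x \<in> topspace X. \<tau> x \<le> 0}"
    proof (rule ccontr)
      assume "\<not> ?thesis"
      then have "{x} \<in> ideal_away X \<tau>" using x by (auto simp: in_ideal_away_iff intro!: exI[of _ "\<tau> x"])
      then show False using x by auto
    qed
  qed (fastforce simp: in_ideal_away_iff)
  have Z: "{x \<in> topspace X. \<tau> x \<le> 0} \<in> sets (borel_of X)"
    using closedin_continuous_map_preimage[OF \<tau>, of "{..0}"] by (auto intro: closedin_imp_borel_of)
  have L: "{x \<in> topspace X. c \<le> \<tau> x} \<in> ideal_away X \<tau>" if "0 < c" for c
    using that by (auto simp: in_ideal_away_iff)
  note Lb = borel_of_level[OF \<tau>]
  have *: "\<exists>c>0. emeasure \<mu> B \<le> emeasure \<mu> {x \<in> topspace X. c \<le> \<tau> x}"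
    if "B \<in> ideal_away X \<tau>" "sets \<mu> = sets (borel_of X)" for B
  proof -
    obtain c where "0 < c" "B \<subseteq> {x \<in> topspace X. c \<le> \<tau> x}"
      using \<open>B \<in> ideal_away X \<tau>\<close> by (auto simp: in_ideal_away_iff subset_iff)
    then show ?thesis using that Lb by (metis emeasure_mono)
  qed
  show ?thesis (is "?l \<longleftrightarrow> ?r")
  proof
    assume l: ?l
    then have s: "sets \<mu> = sets (borel_of X)" by (simp add: tail_measure_def)
    from l obtain B where B: "B \<in> sets \<mu> \<inter> ideal_away X \<tau>" "0 < emeasure \<mu> B"
      by (auto simp: tail_measure_def)
    with * s have "\<exists>c>0. 0 < emeasure \<mu> {x \<in> topspace X. c \<le> \<tau> x}" by (meson IntE less_le_trans)
    then show ?r using l L Lb s unfolding tail_measure_def U by auto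
  next
    assume r: ?r
    then have s: "sets \<mu> = sets (borel_of X)" by simp
    have "emeasure \<mu> B < \<infinity>" if "B \<in> ideal_away X \<tau>" for B
      using *[OF that s] r by (meson le_less_trans)
    then show ?l using r L Lb Z unfolding tail_measure_def U null_sets_def by blast
  qed
qed

text \<open>
  The convergence clause of \<^const>\<open>RV\<close> with the support condition written in terms of \<open>\<tau>\<close>. It is kept separate
  because the limit measure of a path is known to be non-trivial only after its projections have been identified.
\<close>

definition tail_convergence ::
  "'w measure \<Rightarrow> ('w \<Rightarrow> 'a) \<Rightarrow> 'a topology \<Rightarrow> (real \<Rightarrow> 'a \<Rightarrow> 'a) \<Rightarrow> ('a \<Rightarrow> real) \<Rightarrow>
     (real \<Rightarrow> real) \<Rightarrow> 'a measure \<Rightarrow> bool" where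
  "tail_convergence M \<xi> X T \<tau> g \<mu> \<longleftrightarrow>
     (\<forall>f B c. continuous_map X euclideanreal f \<longrightarrow> (\<forall>x\<in>topspace X. \<bar>f x\<bar> \<le> B) \<longrightarrow> 0 < c \<longrightarrow>
        (\<forall>x\<in>topspace X. f x \<noteq> 0 \<longrightarrow> c \<le> \<tau> x) \<longrightarrow>
        ((\<lambda>t. g t * (\<integral>\<omega>. f (T (inverse t) (\<xi> \<omega>)) \<partial>M)) \<longlongrightarrow> (\<integral>x. f x \<partial>\<mu>)) at_top)"

lemma tail_convergenceD:
  assumes "tail_convergence M \<xi> X T \<tau> g \<mu>" "continuous_map X euclideanreal f"
    "\<And>x. x \<in> topspace X \<Longrightarrow> \<bar>f x\<bar> \<le> B" "0 < c"
    "\<And>x. x \<in> topspace X \<Longrightarrow> f x \<noteq> 0 \<Longrightarrow> c \<le> \<tau> x"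
  shows "((\<lambda>t. g t * (\<integral>\<omega>. f (T (inverse t) (\<xi> \<omega>)) \<partial>M)) \<longlongrightarrow> (\<integral>x. f x \<partial>\<mu>)) at_top"
  using assms unfolding tail_convergence_def by blast

lemma RV_iff:
  assumes \<tau>: "continuous_map X euclideanreal \<tau>"
  shows "RV M \<xi> X T (ideal_away X \<tau>) g \<mu> \<longleftrightarrow>
    \<xi> \<in> M \<rightarrow>\<^sub>M borel_of X \<and> normalising g \<and> tail_measure X (ideal_away X \<tau>) \<mu> \<and>
    tail_convergence M \<xi> X T \<tau> g \<mu>"
proof -
  have "bounded (f ` topspace X) \<longleftrightarrow> (\<exists>B. \<forall>x\<in>topspace X. \<bar>f x\<bar> \<le> B)" for f :: "'a \<Rightarrow> real"
    by (simp add: bounded_iff)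
  then have "(\<forall>f :: 'a \<Rightarrow> real. P f \<and> bounded (f ` topspace X) \<and> (\<exists>c>0::real. R f c) \<longrightarrow> Q f) \<longleftrightarrow>
      (\<forall>f B c. P f \<longrightarrow> (\<forall>x\<in>topspace X. \<bar>f x\<bar> \<le> B) \<longrightarrow> 0 < c \<longrightarrow> R f c \<longrightarrow> Q f)" for P Q R
    by auto
  then show ?thesis
    unfolding RV_def tail_convergence_def support_in_ideal_away_iff[OF \<tau>] by (simp only:)
qed

section \<open>Lipschitz approximation in metric spaces\<close>

text \<open>
  The largest \<open>k\<close>-Lipschitz minorant of \<open>F\<close>, also known as its Pasch--Hausdorff envelope.
\<close>

definition inf_convolution :: "'a metric \<Rightarrow> real \<Rightarrow> ('a \<Rightarrow> real) \<Rightarrow> 'a \<Rightarrow> real" where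
  "inf_convolution m k F x = (INF z\<in>mspace m. F z + k * mdist m x z)"

text \<open>
  For the lower bound, points within \<open>d\<close> of \<open>x\<close> contribute at least \<open>a\<close>, and all others pay at least \<open>k d\<close> for
  their distance.
\<close>

lemma
  assumes F: "\<And>z. z \<in> mspace m \<Longrightarrow> 0 \<le> F z" and k: "0 \<le> k" and x: "x \<in> mspace m"
  shows inf_convolution_nonneg: "0 \<le> inf_convolution m k F x"
    and inf_convolution_le: "inf_convolution m k F x \<le> F x"
    and inf_convolution_Lipschitz: "y \<in> mspace m \<Longrightarrow>
      inf_convolution m k F x \<le> inf_convolution m k F y + k * mdist m x y"
    and inf_convolution_lower: "0 < d \<Longrightarrow> (\<And>z. z \<in> mspace m \<Longrightarrow> mdist m x z < d \<Longrightarrow> a \<le> F z) \<Longrightarrow>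
      min a (k * d) \<le> inf_convolution m k F x"
proof -
  have bb: "bdd_below ((\<lambda>z. F z + k * mdist m y z) ` mspace m)" for y
    using F k by (intro bdd_belowI[of _ 0]) auto
  show "0 \<le> inf_convolution m k F x"
    unfolding inf_convolution_def using x F k by (intro cINF_greatest) auto
  have "inf_convolution m k F x \<le> F x + k * mdist m x x"
    unfolding inf_convolution_def by (rule cINF_lower[OF bb x])
  moreover have "mdist m x x = 0" using x by simp
  ultimately show "inf_convolution m k F x \<le> F x" by simp
  show "inf_convolution m k F x \<le> inf_convolution m k F y + k * mdist m x y" if y: "y \<in> mspace m"
  proof -
    have "inf_convolution m k F x - k * mdist m x y \<le> F z + k * mdist m y z" if z: "z \<in> mspace m" for z
    proof -
      have "inf_convolution m k F x \<le> F z + k * mdist m x z"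
        unfolding inf_convolution_def by (rule cINF_lower[OF bb z])
      also have "\<dots> \<le> F z + k * (mdist m x y + mdist m y z)"
        using k mdist_triangle[OF x y z] by (auto intro: mult_left_mono)
      finally show ?thesis by (simp add: algebra_simps)
    qed
    then have "inf_convolution m k F x - k * mdist m x y \<le> inf_convolution m k F y"
      unfolding inf_convolution_def[of m k F y] using x by (intro cINF_greatest) auto
    then show ?thesis by simp
  qed
  show "min a (k * d) \<le> inf_convolution m k F x"
    if d: "0 < d" "\<And>z. z \<in> mspace m \<Longrightarrow> mdist m x z < d \<Longrightarrow> a \<le> F z"
  proof -
    have "min a (k * d) \<le> F z + k * mdist m x z" if z: "z \<in> mspace m" for z
    proof (cases "mdist m x z < d")
      case True
      then have "a \<le> F z" using d z by auto
      moreover have "0 \<le> k * mdist m x z" using k by simp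
      ultimately show ?thesis by linarith
    next
      case False
      then have "k * d \<le> k * mdist m x z" using k by (intro mult_left_mono) auto
      then show ?thesis using F[OF z] by linarith
    qed
    then show ?thesis unfolding inf_convolution_def using x by (intro cINF_greatest) auto
  qed
qed

lemma continuous_map_of_Lipschitz:
  assumes "\<And>x y. x \<in> mspace m \<Longrightarrow> y \<in> mspace m \<Longrightarrow> F x \<le> F y + L * mdist m x y"
  shows "continuous_map (mtopology_of m) euclideanreal F"
proof -
  have "Lipschitz_continuous_map m euclidean_metric F"
    unfolding Lipschitz_continuous_map_def
  proof (intro conjI exI ballI)
    fix x y assume "x \<in> mspace m" "y \<in> mspace m"
    then show "mdist euclidean_metric (F x) (F y) \<le> L * mdist m x y"
      using assms[of x y] assms[of y x] by (simp add: dist_real_def mdist_commute)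
  qed auto
  from Lipschitz_continuous_imp_continuous_map[OF this] show ?thesis by simp
qed

lemma continuous_inf_convolution:
  assumes "\<And>z. z \<in> mspace m \<Longrightarrow> 0 \<le> F z" "0 \<le> k"
  shows "continuous_map (mtopology_of m) euclideanreal (inf_convolution m k F)"
  by (rule continuous_map_of_Lipschitz[where L = k]) (rule inf_convolution_Lipschitz[OF assms])

lemma continuous_map_mtopology_ofD:
  assumes f: "continuous_map (mtopology_of m) euclideanreal f" and x: "x \<in> mspace m" and e: "0 < e"
  obtains d where "0 < d" "\<And>y. y \<in> mspace m \<Longrightarrow> mdist m x y < d \<Longrightarrow> \<bar>f y - f x\<bar> < e"
proof -
  have "Metric_space.mtopology (mspace m) (mdist m) = mtopology_of m"
    by (simp only: mtopology_of_def)
  then have "openin (Metric_space.mtopology (mspace m) (mdist m)) {y \<in> mspace m. f y \<in> ball (f x) e}"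
    using openin_continuous_map_preimage[OF f, of "ball (f x) e"] by simp
  then have "\<exists>r>0. Metric_space.mball (mspace m) (mdist m) x r \<subseteq> {y \<in> mspace m. f y \<in> ball (f x) e}"
    using x e unfolding Metric_space.openin_mtopology[OF Metric_space_mspace_mdist] by simp
  then obtain r where r: "0 < r" "Metric_space.mball (mspace m) (mdist m) x r \<subseteq> {y \<in> mspace m. f y \<in> ball (f x) e}"
    by (elim exE conjE)
  show thesis
  proof (rule that[OF r(1)])
    fix y assume "y \<in> mspace m" "mdist m x y < r"
    then have "y \<in> Metric_space.mball (mspace m) (mdist m) x r"
      using x by (simp add: Metric_space.in_mball[OF Metric_space_mspace_mdist])
    then have "f y \<in> ball (f x) e" using r(2) by (simp only: subset_iff mem_Collect_eq)
    then have "dist (f x) (f y) < e" by (simp only: mem_ball)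
    then show "\<bar>f y - f x\<bar> < e" unfolding dist_real_def by linarith
  qed
qed

lemma inf_convolution_tendsto:
  assumes F: "\<And>z. z \<in> mspace m \<Longrightarrow> 0 \<le> F z" and x: "x \<in> mspace m"
    and c: "continuous_map (mtopology_of m) euclideanreal F"
  shows "(\<lambda>k. inf_convolution m (real k) F x) \<longlonglongrightarrow> F x"
proof (rule LIMSEQ_I)
  fix r :: real assume r: "0 < r"
  obtain d where d: "0 < d" "\<And>y. y \<in> mspace m \<Longrightarrow> mdist m x y < d \<Longrightarrow> \<bar>F y - F x\<bar> < r / 2"
    by (rule continuous_map_mtopology_ofD[OF c x half_gt_zero[OF r]]) blast
  obtain n :: nat where n: "F x < real n * d" using reals_Archimedean3 d(1) by blast
  have "norm (inf_convolution m (real k) F x - F x) < r" if "k \<ge> n" for k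
  proof -
    have "F x - r / 2 \<le> F y" if "y \<in> mspace m" "mdist m x y < d" for y
      using d(2)[OF that] by linarith
    then have "min (F x - r / 2) (real k * d) \<le> inf_convolution m (real k) F x"
      by (intro inf_convolution_lower F x d) auto
    moreover have "real n * d \<le> real k * d" using that d(1) by (intro mult_right_mono) auto
    ultimately have "F x - r / 2 \<le> inf_convolution m (real k) F x" using n r by linarith
    then show ?thesis using inf_convolution_le[of m F "real k" x] F x r by auto
  qed
  then show "\<exists>no. \<forall>n\<ge>no. norm (inf_convolution m (real n) F x - F x) < r" by blast
qed

text \<open>
  For open \<open>U\<close> the inf-convolution of the indicator of \<open>U\<close> is continuous and positive exactly on \<open>U\<close>, which reduces the
  claim to limits of real-valued functions.
\<close>

lemma measurable_limit_metric:
  assumes h: "\<And>n. h n \<in> N \<rightarrow>\<^sub>M borel_of (mtopology_of m)"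
    and l: "\<And>w. w \<in> space N \<Longrightarrow> l w \<in> mspace m"
    and lim: "\<And>w. w \<in> space N \<Longrightarrow> (\<lambda>n. mdist m (l w) (h n w)) \<longlonglongrightarrow> 0"
  shows "l \<in> N \<rightarrow>\<^sub>M borel_of (mtopology_of m)"
proof (rule measurable_borel_ofI)
  show "l \<in> space N \<rightarrow> topspace (mtopology_of m)" using l by simp
  fix U assume U: "openin (mtopology_of m) U"
  define \<rho> where "\<rho> = inf_convolution m 1 (indicator U)"
  have c: "continuous_map (mtopology_of m) euclideanreal \<rho>"
    unfolding \<rho>_def by (rule continuous_inf_convolution) auto
  have pos: "0 < \<rho> x \<longleftrightarrow> x \<in> U" if x: "x \<in> mspace m" for x
  proof
    assume "0 < \<rho> x"
    moreover have "\<rho> x \<le> indicator U x" unfolding \<rho>_def by (rule inf_convolution_le) (use x in auto)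
    ultimately show "x \<in> U" by (cases "x \<in> U") auto
  next
    assume "x \<in> U"
    with U have "\<exists>d>0. Metric_space.mball (mspace m) (mdist m) x d \<subseteq> U"
      unfolding mtopology_of_def Metric_space.openin_mtopology[OF Metric_space_mspace_mdist] by simp
    then obtain d where d: "0 < d" "Metric_space.mball (mspace m) (mdist m) x d \<subseteq> U"
      by (elim exE conjE)
    have "z \<in> U" if "z \<in> mspace m" "mdist m x z < d" for z
      by (rule subsetD[OF d(2)]) (simp add: Metric_space.in_mball[OF Metric_space_mspace_mdist] that x)
    then have "min 1 (1 * d) \<le> \<rho> x"
      unfolding \<rho>_def by (intro inf_convolution_lower x \<open>0 < d\<close>) auto
    then show "0 < \<rho> x" using \<open>0 < d\<close> by linarith
  qed
  have hm: "h n w \<in> mspace m" if "w \<in> space N" for n w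
    using measurable_space[OF h that, of n] by simp
  have "(\<lambda>w. \<rho> (l w)) \<in> borel_measurable N"
  proof (rule borel_measurable_LIMSEQ_real)
    show "(\<lambda>w. \<rho> (h n w)) \<in> borel_measurable N" for n
      using measurable_compose[OF h continuous_map_borel_measurable[OF c]] .
    fix w assume w: "w \<in> space N"
    have L: "\<rho> x \<le> \<rho> y + 1 * mdist m x y" if "x \<in> mspace m" "y \<in> mspace m" for x y
      unfolding \<rho>_def by (rule inf_convolution_Lipschitz) (use that in auto)
    have "\<bar>\<rho> (h n w) - \<rho> (l w)\<bar> \<le> mdist m (l w) (h n w)" for n
      using L[OF l[OF w] hm[OF w, of n]] L[OF hm[OF w, of n] l[OF w]] mdist_commute[of m "l w" "h n w"]
      by linarith
    then have "\<forall>\<^sub>F n in sequentially. norm (\<rho> (h n w) - \<rho> (l w)) \<le> mdist m (l w) (h n w)"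
      unfolding real_norm_def by (rule always_eventually[OF allI])
    from LIM_zero_cancel[OF Lim_null_comparison[OF this lim[OF w]]]
    show "(\<lambda>n. \<rho> (h n w)) \<longlonglongrightarrow> \<rho> (l w)" .
  qed
  then have "{w \<in> space N. 0 < \<rho> (l w)} \<in> sets N" unfolding borel_measurable_iff_greater by (rule spec)
  moreover have "{w \<in> space N. 0 < \<rho> (l w)} = l -` U \<inter> space N" using pos[OF l] by blast
  ultimately show "l -` U \<inter> space N \<in> sets N" by simp
qed

section \<open>Norm and modulus of continuity\<close>

definition C01_metric :: "(real \<Rightarrow> real) metric" where
  "C01_metric = cfunspace (top_of_set {0..1::real}) euclidean_metric"

lemma C01_eq: "C01 = mtopology_of C01_metric"
  by (simp add: C01_def C01_metric_def)

lemma mspace_C01_metric: "mspace C01_metric = topspace C01"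
  by (simp add: C01_eq)

lemma C01_dist_le_iff:
  assumes "x \<in> topspace C01" "y \<in> topspace C01"
  shows "mdist C01_metric x y \<le> a \<longleftrightarrow> (\<forall>u\<in>{0..1}. \<bar>x u - y u\<bar> \<le> a)"
proof -
  have "x \<in> mspace C01_metric" "y \<in> mspace C01_metric" using assms by (simp_all only: mspace_C01_metric)
  then show ?thesis
    unfolding C01_metric_def
    by (subst cfunspace_mdist_le) (simp_all only: topspace_euclidean_subtopology mdist_euclidean_metric dist_real_def, simp)
qed

lemma C01_pointwise_le_dist:
  assumes "x \<in> topspace C01" "y \<in> topspace C01" "u \<in> {0..1}"
  shows "\<bar>x u - y u\<bar> \<le> mdist C01_metric x y"
  using C01_dist_le_iff[OF assms(1,2), of "mdist C01_metric x y"] assms(3) by simp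

lemma C01_continuous: "x \<in> topspace C01 \<Longrightarrow> continuous_on {0..1} x"
  by (simp add: topspace_C01)

lemma restrict_in_C01: "continuous_on {0..1} f \<Longrightarrow> restrict f {0..1} \<in> topspace C01"
  unfolding topspace_C01 by (auto elim: continuous_on_eq)

lemma C01_bdd: 
  assumes "x \<in> topspace C01" obtains K where "\<And>u. u \<in> {0..1} \<Longrightarrow> \<bar>x u\<bar> \<le> K"
proof -
  have "bounded (x ` {0..1})"
    using C01_continuous[OF assms] compact_continuous_image compact_imp_bounded compact_Icc by blast
  then obtain K where "\<forall>v\<in>x ` {0..1}. norm v \<le> K" unfolding bounded_iff by blast
  then show thesis by (intro that[of K]) auto
qed

lemma sup_norm_le_iff:
  assumes "x \<in> topspace C01"
  shows "sup_norm x \<le> a \<longleftrightarrow> (\<forall>u\<in>{0..1}. \<bar>x u\<bar> \<le> a)"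
proof -
  obtain K where "\<And>u. u \<in> {0..1} \<Longrightarrow> \<bar>x u\<bar> \<le> K" by (rule C01_bdd[OF assms]) blast
  then have "bdd_above ((\<lambda>u. \<bar>x u\<bar>) ` {0..1})" by (rule bdd_aboveI2)
  then show ?thesis unfolding sup_norm_def by (subst cSUP_le_iff) auto
qed

lemma abs_le_sup_norm: "x \<in> topspace C01 \<Longrightarrow> u \<in> {0..1} \<Longrightarrow> \<bar>x u\<bar> \<le> sup_norm x"
  using sup_norm_le_iff[of x "sup_norm x"] by blast

lemma sup_norm_nonneg: "x \<in> topspace C01 \<Longrightarrow> 0 \<le> sup_norm x"
  using abs_le_sup_norm[of x 0] by auto

lemma modulus_le_iff:
  assumes "x \<in> topspace C01" "0 \<le> e"
  shows "modulus e x \<le> a \<longleftrightarrow> (\<forall>u\<in>{0..1}. \<forall>v\<in>{0..1}. \<bar>u - v\<bar> \<le> e \<longrightarrow> \<bar>x u - x v\<bar> \<le> a)"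
proof -
  let ?I = "{(u, v). u \<in> {0..1::real} \<and> v \<in> {0..1} \<and> \<bar>u - v\<bar> \<le> e}"
  obtain K where K: "\<And>u. u \<in> {0..1} \<Longrightarrow> \<bar>x u\<bar> \<le> K" by (rule C01_bdd[OF assms(1)]) blast
  have "\<bar>x u - x v\<bar> \<le> 2 * K" if "u \<in> {0..1}" "v \<in> {0..1}" for u v
    using K[OF that(1)] K[OF that(2)] by linarith
  then have "bdd_above ((\<lambda>(u, v). \<bar>x u - x v\<bar>) ` ?I)"
    by (intro bdd_aboveI2[of _ _ "2 * K"]) (auto simp: split_beta)
  moreover have "(0, 0) \<in> ?I" using assms by auto
  then have "?I \<noteq> {}" by blast
  ultimately show ?thesis unfolding modulus_def
    by (subst cSUP_le_iff) auto
qed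

lemma modulus_ge:
  assumes "x \<in> topspace C01" "0 \<le> e" "u \<in> {0..1}" "v \<in> {0..1}" "\<bar>u - v\<bar> \<le> e"
  shows "\<bar>x u - x v\<bar> \<le> modulus e x"
  using modulus_le_iff[OF assms(1,2), of "modulus e x"] assms(3-5) by blast

lemma modulus_mono:
  assumes "x \<in> topspace C01" "0 \<le> d" "d \<le> e" shows "modulus d x \<le> modulus e x"
  using assms by (subst modulus_le_iff) (auto intro: modulus_ge)

lemma modulus_nonneg: "x \<in> topspace C01 \<Longrightarrow> 0 \<le> e \<Longrightarrow> 0 \<le> modulus e x"
  using modulus_ge[of x e 0 0] by auto

lemma modulus_le_sup_norm:
  assumes "x \<in> topspace C01" "0 \<le> e" shows "modulus e x \<le> 2 * sup_norm x"
proof (subst modulus_le_iff[OF assms], intro ballI impI)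
  fix u v :: real assume "u \<in> {0..1}" "v \<in> {0..1}"
  then show "\<bar>x u - x v\<bar> \<le> 2 * sup_norm x"
    using abs_le_sup_norm[OF assms(1), of u] abs_le_sup_norm[OF assms(1), of v] by linarith
qed

lemma sup_norm_Lipschitz:
  assumes "x \<in> topspace C01" "y \<in> topspace C01"
  shows "sup_norm x \<le> sup_norm y + mdist C01_metric x y"
proof (subst sup_norm_le_iff[OF assms(1)], intro ballI)
  fix u :: real assume u: "u \<in> {0..1}"
  show "\<bar>x u\<bar> \<le> sup_norm y + mdist C01_metric x y"
    using C01_pointwise_le_dist[OF assms u] abs_le_sup_norm[OF assms(2) u] by linarith
qed

lemma modulus_Lipschitz:
  assumes "x \<in> topspace C01" "y \<in> topspace C01" "0 \<le> e"
  shows "modulus e x \<le> modulus e y + 2 * mdist C01_metric x y"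
proof (subst modulus_le_iff[OF assms(1,3)], intro ballI impI)
  fix u v :: real assume u: "u \<in> {0..1}" "v \<in> {0..1}" "\<bar>u - v\<bar> \<le> e"
  show "\<bar>x u - x v\<bar> \<le> modulus e y + 2 * mdist C01_metric x y"
    using C01_pointwise_le_dist[OF assms(1,2) u(1)] C01_pointwise_le_dist[OF assms(1,2) u(2)]
      modulus_ge[OF assms(2,3) u] by linarith
qed

lemma C01_continuous_of_Lipschitz:
  assumes "\<And>x y. x \<in> topspace C01 \<Longrightarrow> y \<in> topspace C01 \<Longrightarrow> F x \<le> F y + L * mdist C01_metric x y"
  shows "continuous_map C01 euclideanreal F"
  unfolding C01_eq
  by (rule continuous_map_of_Lipschitz[where L = L]) (rule assms; simp only: mspace_C01_metric)

lemma continuous_sup_norm: "continuous_map C01 euclideanreal sup_norm"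
  by (rule C01_continuous_of_Lipschitz[where L = 1]) (simp add: sup_norm_Lipschitz)

lemma continuous_modulus: "0 \<le> e \<Longrightarrow> continuous_map C01 euclideanreal (modulus e)"
  by (rule C01_continuous_of_Lipschitz[where L = 2]) (simp add: modulus_Lipschitz)

lemma continuous_evaluation: "u \<in> {0..1} \<Longrightarrow> continuous_map C01 euclideanreal (\<lambda>x. x u)"
proof (rule C01_continuous_of_Lipschitz[where L = 1])
  fix x y assume "u \<in> {0..1}" "x \<in> topspace C01" "y \<in> topspace C01"
  then show "x u \<le> y u + 1 * mdist C01_metric x y"
    using C01_pointwise_le_dist[of x y u] by linarith
qed

lemma scale_C01: "x \<in> topspace C01 \<Longrightarrow> scale_on {0..1} t x \<in> topspace C01"
  unfolding scale_on_def by (intro restrict_in_C01 continuous_intros C01_continuous)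

lemma continuous_scale_C01: "continuous_map C01 C01 (scale_on {0..1} t)"
proof -
  have "Lipschitz_continuous_map C01_metric C01_metric (scale_on {0..1} t)"
    unfolding Lipschitz_continuous_map_def mspace_C01_metric
  proof (intro conjI exI ballI)
    fix x y assume xy: "x \<in> topspace C01" "y \<in> topspace C01"
    show "mdist C01_metric (scale_on {0..1} t x) (scale_on {0..1} t y) \<le> \<bar>t\<bar> * mdist C01_metric x y"
      unfolding C01_dist_le_iff[OF scale_C01[OF xy(1)] scale_C01[OF xy(2)]]
    proof
      fix u :: real assume u: "u \<in> {0..1}"
      have "\<bar>t\<bar> * \<bar>x u - y u\<bar> \<le> \<bar>t\<bar> * mdist C01_metric x y"
        by (intro mult_left_mono C01_pointwise_le_dist xy u) auto
      then show "\<bar>scale_on {0..1} t x u - scale_on {0..1} t y u\<bar> \<le> \<bar>t\<bar> * mdist C01_metric x y"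
        using u by (simp add: scale_on_def abs_mult[symmetric] right_diff_distrib)
    qed
  qed (use scale_C01 in blast)
  from Lipschitz_continuous_imp_continuous_map[OF this] show ?thesis unfolding C01_eq .
qed

lemma abs_scale_le_iff: "0 < t \<Longrightarrow> \<bar>t * (a::real)\<bar> \<le> t * b \<longleftrightarrow> \<bar>a\<bar> \<le> b"
  by (simp add: abs_mult)

lemma sup_norm_scale:
  assumes x: "x \<in> topspace C01" and t: "0 < t"
  shows "sup_norm (scale_on {0..1} t x) = t * sup_norm x"
proof -
  have "sup_norm (scale_on {0..1} t x) \<le> t * b \<longleftrightarrow> sup_norm x \<le> b" for b
    using t unfolding sup_norm_le_iff[OF x] sup_norm_le_iff[OF scale_C01[OF x]]
    by (simp add: scale_on_def abs_scale_le_iff)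
  from this[of "sup_norm x"] this[of "sup_norm (scale_on {0..1} t x) / t"] show ?thesis
    using t by (simp add: field_simps)
qed

lemma modulus_scale:
  assumes x: "x \<in> topspace C01" and t: "0 < t" and e: "0 \<le> e"
  shows "modulus e (scale_on {0..1} t x) = t * modulus e x"
proof -
  have "modulus e (scale_on {0..1} t x) \<le> t * b \<longleftrightarrow> modulus e x \<le> b" for b
    using t unfolding modulus_le_iff[OF x e] modulus_le_iff[OF scale_C01[OF x] e]
    by (simp add: scale_on_def abs_scale_le_iff right_diff_distrib[symmetric])
  from this[of "modulus e x"] this[of "modulus e (scale_on {0..1} t x) / t"] show ?thesis
    using t by (simp add: field_simps)
qed

lemma modulus_small:
  assumes x: "x \<in> topspace C01" and d: "0 < d"
  obtains e where "0 < e" "modulus e x \<le> d"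
proof -
  have "uniformly_continuous_on {0..1} x"
    by (intro compact_uniformly_continuous C01_continuous x compact_Icc)
  then obtain e where e: "0 < e" "\<And>u v. u \<in> {0..1} \<Longrightarrow> v \<in> {0..1} \<Longrightarrow> dist v u < e \<Longrightarrow> dist (x v) (x u) < d"
    unfolding uniformly_continuous_on_def using d by metis
  show thesis
  proof (rule that[of "e / 2"])
    show "modulus (e / 2) x \<le> d"
    proof (subst modulus_le_iff[OF x], goal_cases)
      case 2
      have "\<bar>x u - x v\<bar> \<le> d" if "u \<in> {0..1}" "v \<in> {0..1}" "\<bar>u - v\<bar> \<le> e / 2" for u v
      proof -
        have "dist u v < e" using that e(1) by (simp add: dist_real_def)
        from e(2)[OF that(2,1) this] show ?thesis by (simp add: dist_real_def)
      qed
      then show ?case by blast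
    qed (use e in simp)
  qed (use e in simp)
qed

lemma modulus_tendsto:
  assumes x: "x \<in> topspace C01"
  shows "(\<lambda>n. modulus (1 / real (Suc n)) x) \<longlonglongrightarrow> 0"
proof (rule LIMSEQ_I)
  fix r :: real assume "0 < r"
  then obtain e where e: "0 < e" "modulus e x \<le> r / 2" using modulus_small[OF x, of "r / 2"] by auto
  obtain N where N: "1 / real (Suc N) < e" using nat_approx_posE e(1) by blast
  have "norm (modulus (1 / real (Suc n)) x - 0) < r" if "N \<le> n" for n
  proof -
    have "1 / real (Suc n) \<le> 1 / real (Suc N)" using that by (simp add: frac_le)
    then have "modulus (1 / real (Suc n)) x \<le> modulus e x" using N by (intro modulus_mono x) auto
    moreover have "0 \<le> modulus (1 / real (Suc n)) x" by (intro modulus_nonneg x) auto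
    ultimately show ?thesis using e \<open>0 < r\<close> by simp
  qed
  then show "\<exists>no. \<forall>n\<ge>no. norm (modulus (1 / real (Suc n)) x - 0) < r" by blast
qed

section \<open>Sampling and interpolation\<close>

text \<open>
  The number \<^term>\<open>prod_encode (k, n)\<close> codes the grid point \<open>k / (n + 1)\<close>; the minimum only keeps the points of the
  codes with \<open>k > n + 1\<close> inside the unit interval.
\<close>

definition node :: "nat \<Rightarrow> real" where
  "node i = (case prod_decode i of (k, n) \<Rightarrow> min 1 (real k / real (Suc n)))"

definition sample :: "(real \<Rightarrow> real) \<Rightarrow> nat \<Rightarrow> real" where
  "sample x i = x (node i)"

text \<open>
  The codes of \<open>0, 1 / (n + 1), \<dots>, 1\<close>.
\<close>

definition grid :: "nat \<Rightarrow> nat set" where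
  "grid n = (\<lambda>k. prod_encode (k, n)) ` {..Suc n}"

text \<open>
  The tent functions of the grid: piecewise linear, 1 at \<open>k / (n + 1)\<close> and 0 at the other grid points.
\<close>

definition hat :: "nat \<Rightarrow> nat \<Rightarrow> real \<Rightarrow> real" where
  "hat n k u = max 0 (1 - \<bar>real (Suc n) * u - real k\<bar>)"

definition interpolate :: "nat \<Rightarrow> (nat \<Rightarrow> real) \<Rightarrow> real \<Rightarrow> real" where
  "interpolate n y = (\<lambda>u\<in>{0..1}. \<Sum>k\<le>Suc n. hat n k u * y (prod_encode (k, n)))"

lemma node_in: "node i \<in> {0..1}"
  by (auto simp: node_def split: prod.split)

lemma node_grid: "k \<le> Suc n \<Longrightarrow> node (prod_encode (k, n)) = real k / real (Suc n)"
  by (simp add: node_def min_absorb2 del: of_nat_Suc)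

lemma finite_grid: "finite (grid n)" by (simp add: grid_def)

lemma sample_scale: "sample (scale_on {0..1} t x) = (\<lambda>i. t * sample x i)"
  using node_in by (auto simp: sample_def scale_on_def)

text \<open>
  By induction on the number of grid points: on the last cell only the last two tents are non-zero.
\<close>

lemma hat_sum: "u \<in> {0..1} \<Longrightarrow> (\<Sum>k\<le>Suc n. hat n k u) = 1"
proof -
  \<comment> \<open>Stated for the unscaled variable \<open>v\<close> in \<open>[0, N]\<close>, for which the induction goes through.\<close>
  have *: "(\<Sum>k\<le>N. max 0 (1 - \<bar>v - real k\<bar>)) = 1" if "0 \<le> v" "v \<le> real N" for N v
    using that
  proof (induction N)
    case (Suc N)
    show ?case
    proof (cases "v \<le> real N")
      case True
      then show ?thesis using Suc by simp
    next
      case False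
      have "(\<Sum>k<N. max 0 (1 - \<bar>v - real k\<bar>)) = 0"
      proof (rule sum.neutral, rule ballI)
        fix k assume "k \<in> {..<N}"
        then have "real k + 1 \<le> real N" by (simp flip: of_nat_Suc add: Suc_le_eq)
        then show "max 0 (1 - \<bar>v - real k\<bar>) = 0" using False by linarith
      qed
      then show ?thesis using False Suc.prems
        by (simp add: lessThan_Suc_atMost[symmetric])
    qed
  qed simp
  assume u: "u \<in> {0..1}"
  then have "real (Suc n) * u \<le> real (Suc n) * 1" by (intro mult_left_mono) auto
  then show ?thesis unfolding hat_def using u by (intro *) auto
qed

lemma abs_scaled_diff: 
  assumes "0 < (N::real)" shows "\<bar>N * u - k\<bar> = N * \<bar>u - k / N\<bar>"
proof -
  have "N * u - k = N * (u - k / N)" using assms by (simp add: right_diff_distrib)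
  then show ?thesis using assms by (simp add: abs_mult)
qed

lemma hat_nonneg: "0 \<le> hat n k u" by (simp add: hat_def)

lemma weighted_average_le:
  assumes u: "u \<in> {0..1}" and b: "\<And>k. k \<le> Suc n \<Longrightarrow> hat n k u \<noteq> 0 \<Longrightarrow> \<bar>z k\<bar> \<le> a"
  shows "\<bar>\<Sum>k\<le>Suc n. hat n k u * z k\<bar> \<le> a"
proof -
  have "\<bar>\<Sum>k\<le>Suc n. hat n k u * z k\<bar> \<le> (\<Sum>k\<le>Suc n. \<bar>hat n k u * z k\<bar>)" by (rule sum_abs)
  also have "\<dots> \<le> (\<Sum>k\<le>Suc n. hat n k u * a)"
  proof (rule sum_mono)
    fix k assume "k \<in> {..Suc n}"
    then show "\<bar>hat n k u * z k\<bar> \<le> hat n k u * a"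
      using b[of k] hat_nonneg[of n k u] by (cases "hat n k u = 0") (auto simp: abs_mult mult_left_mono)
  qed
  also have "\<dots> = a" using hat_sum[OF u, of n] by (simp only: sum_distrib_right[symmetric] mult_1_left)
  finally show ?thesis .
qed

lemma interpolate_C01: "interpolate n y \<in> topspace C01"
proof -
  have "continuous_on {0..1} (\<lambda>u. \<Sum>k\<le>Suc n. hat n k u * y (prod_encode (k, n)))"
    unfolding hat_def by (intro continuous_intros)
  then show ?thesis unfolding interpolate_def by (rule restrict_in_C01)
qed

lemma interpolate_dist_le:
  assumes "\<And>k. k \<le> Suc n \<Longrightarrow> \<bar>y (prod_encode (k, n)) - z (prod_encode (k, n))\<bar> \<le> a"
  shows "mdist C01_metric (interpolate n y) (interpolate n z) \<le> a"
  unfolding C01_dist_le_iff[OF interpolate_C01 interpolate_C01]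
proof
  fix u :: real assume u: "u \<in> {0..1}"
  have "interpolate n y u - interpolate n z u =
      (\<Sum>k\<le>Suc n. hat n k u * (y (prod_encode (k, n)) - z (prod_encode (k, n))))"
    using u by (simp add: interpolate_def sum_subtractf right_diff_distrib del: sum.atMost_Suc)
  then show "\<bar>interpolate n y u - interpolate n z u\<bar> \<le> a"
    using weighted_average_le[OF u, of n "\<lambda>k. y (prod_encode (k, n)) - z (prod_encode (k, n))" a] assms
    by simp
qed

lemma interpolate_sup_norm_le:
  assumes "\<And>i. i \<in> grid n \<Longrightarrow> \<bar>y i\<bar> \<le> a"
  shows "sup_norm (interpolate n y) \<le> a"
  unfolding sup_norm_le_iff[OF interpolate_C01]
proof
  fix u :: real assume u: "u \<in> {0..1}"
  show "\<bar>interpolate n y u\<bar> \<le> a"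
    using weighted_average_le[OF u, of n "\<lambda>k. y (prod_encode (k, n))" a] assms u
    by (simp add: interpolate_def grid_def del: sum.atMost_Suc)
qed

text \<open>
  Only tents centred within \<open>1 / (n + 1)\<close> of \<open>u\<close> are non-zero at \<open>u\<close>, so the interpolation is an average of values
  of \<open>x\<close> at such points.
\<close>

lemma interpolate_error:
  assumes x: "x \<in> topspace C01"
  shows "mdist C01_metric x (interpolate n (sample x)) \<le> modulus (1 / real (Suc n)) x"
  unfolding C01_dist_le_iff[OF x interpolate_C01]
proof
  fix u :: real assume u: "u \<in> {0..1}"
  have "x u = (\<Sum>k\<le>Suc n. hat n k u) * x u" unfolding hat_sum[OF u] by simp
  then have "x u - interpolate n (sample x) u = (\<Sum>k\<le>Suc n. hat n k u * (x u - sample x (prod_encode (k, n))))"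
    using u by (simp add: interpolate_def sum_subtractf right_diff_distrib sum_distrib_right del: sum.atMost_Suc)
  moreover have "\<bar>\<Sum>k\<le>Suc n. hat n k u * (x u - sample x (prod_encode (k, n)))\<bar> \<le> modulus (1 / real (Suc n)) x"
  proof (rule weighted_average_le[OF u])
    fix k assume k: "k \<le> Suc n" "hat n k u \<noteq> 0"
    let ?N = "real (Suc n)"
    have "\<bar>?N * u - real k\<bar> \<le> 1" using k(2) by (simp add: hat_def max_def split: if_splits)
    then have "\<bar>u - real k / ?N\<bar> \<le> 1 / ?N"
      by (subst (asm) abs_scaled_diff) (simp_all add: pos_le_divide_eq mult.commute del: of_nat_Suc)
    then show "\<bar>x u - sample x (prod_encode (k, n))\<bar> \<le> modulus (1 / ?N) x"
      unfolding sample_def using node_in[of "prod_encode (k, n)"] node_grid[OF k(1)] u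
      by (intro modulus_ge x) (auto simp del: of_nat_Suc)
  qed
  ultimately show "\<bar>x u - interpolate n (sample x) u\<bar> \<le> modulus (1 / real (Suc n)) x" by simp
qed

lemma interpolate_tendsto:
  assumes x: "x \<in> topspace C01"
  shows "(\<lambda>n. mdist C01_metric x (interpolate n (sample x))) \<longlonglongrightarrow> 0"
  by (rule tendsto_sandwich[OF _ _ tendsto_const modulus_tendsto[OF x]])
    (use interpolate_error[OF x] in \<open>auto intro: always_eventually simp del: of_nat_Suc\<close>)

lemma interpolate_restr: "interpolate n (restr (grid n) y) = interpolate n y"
  unfolding interpolate_def by (intro restrict_ext sum.cong) (auto simp: restr_def grid_def)

lemma continuous_interpolate: "continuous_map euclidean C01 (interpolate n)"
proof -
  have "continuous_map euclidean (Metric_space.mtopology (mspace C01_metric) (mdist C01_metric)) (interpolate n)"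
    unfolding Metric_space.continuous_map_to_metric[OF Metric_space_mspace_mdist]
  proof (intro ballI allI impI)
    fix y :: "nat \<Rightarrow> real" and e :: real assume e: "0 < e"
    let ?U = "\<Inter>i\<in>grid n. {z. \<bar>y i - z i\<bar> < e / 2}"
    have "open {z :: nat \<Rightarrow> real. \<bar>y i - z i\<bar> < e / 2}" for i
      by (intro open_Collect_less continuous_intros continuous_on_coord)
    then have "openin euclidean ?U" unfolding open_openin[symmetric] by (intro open_INT finite_grid ballI)
    moreover have "y \<in> ?U" using e by simp
    moreover have "interpolate n z \<in> Metric_space.mball (mspace C01_metric) (mdist C01_metric) (interpolate n y) e"
      if z: "z \<in> ?U" for z
    proof -
      have "mdist C01_metric (interpolate n y) (interpolate n z) \<le> e / 2"
        by (rule interpolate_dist_le) (use z in \<open>force simp: grid_def intro: less_imp_le\<close>)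
      then show ?thesis
        unfolding Metric_space.in_mball[OF Metric_space_mspace_mdist]
        using interpolate_C01[of n y] interpolate_C01[of n z] e by (simp add: mspace_C01_metric)
    qed
    ultimately show "\<exists>U. openin euclidean U \<and> y \<in> U \<and>
        (\<forall>z\<in>U. interpolate n z \<in> Metric_space.mball (mspace C01_metric) (mdist C01_metric) (interpolate n y) e)"
      by blast
  qed
  then show ?thesis unfolding C01_eq mtopology_of_def .
qed

lemma sup_norm_le_grid:
  assumes x: "x \<in> topspace C01" and a: "\<And>i. i \<in> grid n \<Longrightarrow> \<bar>sample x i\<bar> \<le> a"
  shows "sup_norm x \<le> a + modulus (1 / real (Suc n)) x"
  using sup_norm_Lipschitz[OF x interpolate_C01, of n "sample x"] interpolate_error[OF x, of n]
    interpolate_sup_norm_le[of n "sample x" a, OF a] by linarith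

lemma node_dense:
  assumes "u \<in> {0..1}" "0 < e" obtains i where "\<bar>node i - u\<bar> < e"
proof -
  obtain n where n: "1 / real (Suc n) < e" using nat_approx_posE assms(2) by blast
  have "\<exists>k\<le>Suc n. hat n k u \<noteq> 0"
  proof (rule ccontr)
    assume "\<not> ?thesis"
    then have "(\<Sum>k\<le>Suc n. hat n k u) = 0" by (intro sum.neutral) auto
    then show False using hat_sum[OF assms(1), of n] by linarith
  qed
  then obtain k where k: "k \<le> Suc n" "hat n k u \<noteq> 0" by blast
  let ?N = "real (Suc n)"
  have "\<bar>?N * u - real k\<bar> < 1" using k(2) by (simp add: hat_def max_def split: if_splits)
  then have "\<bar>real k / ?N - u\<bar> < 1 / ?N"
    by (subst (asm) abs_scaled_diff) (simp_all add: pos_less_divide_eq mult.commute abs_minus_commute del: of_nat_Suc)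
  then show thesis using that[of "prod_encode (k, n)"] node_grid[OF k(1)] n by (simp del: of_nat_Suc)
qed

lemma sup_norm_le_iff_sample:
  assumes x: "x \<in> topspace C01"
  shows "sup_norm x \<le> a \<longleftrightarrow> (\<forall>i. \<bar>sample x i\<bar> \<le> a)"
proof
  assume "sup_norm x \<le> a" then show "\<forall>i. \<bar>sample x i\<bar> \<le> a"
    using sup_norm_le_iff[OF x] node_in by (auto simp: sample_def)
next
  assume a: "\<forall>i. \<bar>sample x i\<bar> \<le> a"
  have "sup_norm x \<le> a + modulus (1 / real (Suc n)) x" for n
    using a by (intro sup_norm_le_grid x) auto
  moreover have "(\<lambda>n. a + modulus (1 / real (Suc n)) x) \<longlonglongrightarrow> a + 0"
    by (intro tendsto_intros modulus_tendsto x)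
  ultimately show "sup_norm x \<le> a"
    using LIMSEQ_le_const[of "\<lambda>n. a + modulus (1 / real (Suc n)) x" a "sup_norm x"] by auto
qed

text \<open>
  Several codes may denote the same node. The hypothesis, applied to equal nodes, shows that \<open>y\<close> is a
  function of the node, and this function extends from the dense set of nodes by uniform continuity.
\<close>

lemma ex_sample_eq:
  assumes uc: "\<And>d. 0 < d \<Longrightarrow> \<exists>e>0. \<forall>i j. \<bar>node i - node j\<bar> \<le> e \<longrightarrow> \<bar>y i - y j\<bar> \<le> d"
  obtains x where "x \<in> topspace C01" "sample x = y"
proof -
  have eq: "y i = y j" if "node i = node j" for i j
  proof (rule ccontr)
    assume "y i \<noteq> y j"
    then obtain e where "0 < e" "\<forall>k l. \<bar>node k - node l\<bar> \<le> e \<longrightarrow> \<bar>y k - y l\<bar> \<le> \<bar>y i - y j\<bar> / 2"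
      using uc[of "\<bar>y i - y j\<bar> / 2"] by auto
    moreover from this that have "\<bar>node i - node j\<bar> \<le> e" by simp
    ultimately have "\<bar>y i - y j\<bar> \<le> \<bar>y i - y j\<bar> / 2" by blast
    then show False using \<open>y i \<noteq> y j\<close> by simp
  qed
  define F where "F u = y (SOME i. node i = u)" for u
  have F: "F (node i) = y i" for i
    unfolding F_def by (rule eq) (rule someI[of "\<lambda>j. node j = node i" i], simp)
  have "uniformly_continuous_on (range node) F"
    unfolding uniformly_continuous_on_def
  proof (intro allI impI)
    fix d :: real assume "0 < d"
    then obtain e where e: "0 < e" "\<And>i j. \<bar>node i - node j\<bar> \<le> e \<Longrightarrow> \<bar>y i - y j\<bar> \<le> d / 2"
      using uc[of "d / 2"] by auto
    show "\<exists>e>0. \<forall>u\<in>range node. \<forall>v\<in>range node. dist v u < e \<longrightarrow> dist (F v) (F u) < d"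
    proof (intro exI[of _ e] conjI ballI impI)
      fix u v assume "u \<in> range node" "v \<in> range node" and uv: "dist v u < e"
      then obtain i j where ij: "u = node i" "v = node j" by auto
      then have "\<bar>y j - y i\<bar> \<le> d / 2" using uv by (intro e(2)) (simp add: dist_real_def)
      then show "dist (F v) (F u) < d" using ij F \<open>0 < d\<close> by (simp add: dist_real_def)
    qed (rule e(1))
  qed
  then obtain G where G: "uniformly_continuous_on (closure (range node)) G" "\<And>u. u \<in> range node \<Longrightarrow> F u = G u"
    using uniformly_continuous_on_extension_on_closure by metis
  have "{0..1} \<subseteq> closure (range node)"
  proof
    fix u :: real assume u: "u \<in> {0..1}"
    show "u \<in> closure (range node)"
      unfolding closure_approachable
    proof (intro allI impI)
      fix e :: real assume "0 < e"
      then obtain i where "\<bar>node i - u\<bar> < e" using node_dense[OF u] by blast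
      then show "\<exists>v\<in>range node. dist v u < e" by (auto simp: dist_real_def)
    qed
  qed
  then have "continuous_on {0..1} G"
    using G(1) continuous_on_subset uniformly_continuous_imp_continuous by blast
  then have c: "restrict G {0..1} \<in> topspace C01" by (rule restrict_in_C01)
  have "sample (restrict G {0..1}) = y"
    using node_in F G(2) by (force simp: sample_def)
  with c show thesis by (rule that)
qed

lemma continuous_sample: "continuous_map C01 euclidean sample"
proof -
  have "continuous_map C01 (product_topology (\<lambda>_. euclideanreal) UNIV) sample"
    unfolding continuous_map_componentwise_UNIV sample_def
    using continuous_evaluation node_in by blast
  then show ?thesis by (simp add: euclidean_product_topology)
qed

section \<open>From finite-dimensional limits to a measure on sequences\<close>

lemma topspace_Rm: "topspace (Rm m) = extensional {..<m}"
  by (simp add: Rm_def PiE_def)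

lemma max_norm_le_iff: "0 < m \<Longrightarrow> max_norm m y \<le> a \<longleftrightarrow> (\<forall>i<m. \<bar>y i\<bar> \<le> a)"
  unfolding max_norm_def using Max_le_iff[of "(\<lambda>i. \<bar>y i\<bar>) ` {..<m}" a] by (auto simp: lessThan_empty_iff)

lemma less_max_norm_iff: "0 < m \<Longrightarrow> a < max_norm m y \<longleftrightarrow> (\<exists>i<m. a < \<bar>y i\<bar>)"
  using max_norm_le_iff[of m y a] by (metis not_le)

lemma abs_le_max_norm: "i < m \<Longrightarrow> \<bar>y i\<bar> \<le> max_norm m y"
  using max_norm_le_iff[of m y "max_norm m y"] by auto

lemma continuous_Rm_coord: "i < m \<Longrightarrow> continuous_map (Rm m) euclideanreal (\<lambda>y. y i)"
  unfolding Rm_def by (rule continuous_map_product_projection) simp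

lemma continuous_max_norm:
  assumes "0 < m" shows "continuous_map (Rm m) euclideanreal (max_norm m)"
proof -
  have "continuous_map (Rm m) euclideanreal (max_norm (Suc k))" if "Suc k \<le> m" for k
    using that
  proof (induction k)
    case 0
    then show ?case by (simp add: max_norm_def lessThan_Suc continuous_Rm_coord continuous_map_real_abs)
  next
    case (Suc k)
    have "max_norm (Suc (Suc k)) = (\<lambda>y. max \<bar>y (Suc k)\<bar> (max_norm (Suc k) y))"
    proof
      fix y show "max_norm (Suc (Suc k)) y = max \<bar>y (Suc k)\<bar> (max_norm (Suc k) y)"
        unfolding max_norm_def lessThan_Suc[of "Suc k"] image_insert by (rule Max_insert) auto
    qed
    then show ?case using Suc by (simp add: continuous_Rm_coord continuous_map_real_abs continuous_map_real_max)
  qed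
  from this[of "m - 1"] show ?thesis using assms by simp
qed

lemma continuous_proj:
  assumes "set \<gamma> \<subseteq> {0..1}" shows "continuous_map C01 (Rm (length \<gamma>)) (proj \<gamma>)"
  unfolding Rm_def continuous_map_componentwise
proof (intro conjI ballI)
  fix i assume i: "i \<in> {..<length \<gamma>}"
  then have "\<gamma> ! i \<in> {0..1}" using assms nth_mem by blast
  then show "continuous_map C01 euclideanreal (\<lambda>x. proj \<gamma> x i)"
    using i continuous_evaluation by (simp add: proj_def)
qed (auto simp: proj_def)

lemma proj_scale:
  assumes "set \<gamma> \<subseteq> {0..1}"
  shows "proj \<gamma> (scale_on {0..1} t x) = scale_on {..<length \<gamma>} t (proj \<gamma> x)"
proof -
  have "\<gamma> ! i \<in> {0..1}" if "i < length \<gamma>" for i using assms nth_mem that by blast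
  then show ?thesis by (auto simp: proj_def scale_on_def fun_eq_iff)
qed

lemma \<Gamma>_above_subset: "\<gamma> \<in> \<Gamma>_above \<gamma>\<^sub>0 \<Longrightarrow> set \<gamma> \<subseteq> {0..1}" "\<gamma> \<in> \<Gamma>_above \<gamma>\<^sub>0 \<Longrightarrow> 0 < length \<gamma>"
  by (auto simp: \<Gamma>_above_def \<Gamma>_def)

lemma less_max_norm_proj_iff:
  assumes "\<gamma> \<noteq> []" shows "a < max_norm (length \<gamma>) (proj \<gamma> x) \<longleftrightarrow> (\<exists>u\<in>set \<gamma>. a < \<bar>x u\<bar>)"
proof -
  have "a < max_norm (length \<gamma>) (proj \<gamma> x) \<longleftrightarrow> (\<exists>i<length \<gamma>. a < \<bar>x (\<gamma> ! i)\<bar>)"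
    using assms by (simp add: less_max_norm_iff proj_def cong: conj_cong)
  then show ?thesis by (simp add: Bex_def in_set_conv_nth) blast
qed

definition pos :: "real list \<Rightarrow> real \<Rightarrow> nat" where
  "pos \<gamma> u = (SOME i. i < length \<gamma> \<and> \<gamma> ! i = u)"

lemma pos: assumes "u \<in> set \<gamma>" shows "pos \<gamma> u < length \<gamma>" "\<gamma> ! pos \<gamma> u = u"
proof -
  have "\<exists>i. i < length \<gamma> \<and> \<gamma> ! i = u" using assms by (simp add: in_set_conv_nth)
  from someI_ex[OF this] show "pos \<gamma> u < length \<gamma>" "\<gamma> ! pos \<gamma> u = u"
    unfolding pos_def by simp_all
qed

definition refine :: "real list \<Rightarrow> nat set \<Rightarrow> real list" where
  "refine \<gamma>\<^sub>0 K = sorted_list_of_set (set \<gamma>\<^sub>0 \<union> node ` K)"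

lemma
  assumes "\<gamma>\<^sub>0 \<in> \<Gamma>" "finite K"
  shows set_refine: "set (refine \<gamma>\<^sub>0 K) = set \<gamma>\<^sub>0 \<union> node ` K"
    and refine_above: "refine \<gamma>\<^sub>0 K \<in> \<Gamma>_above \<gamma>\<^sub>0"
proof -
  show s: "set (refine \<gamma>\<^sub>0 K) = set \<gamma>\<^sub>0 \<union> node ` K"
    using assms by (simp add: refine_def)
  have "set \<gamma>\<^sub>0 \<noteq> {}" "set \<gamma>\<^sub>0 \<subseteq> {0..1}" using assms by (auto simp: \<Gamma>_def)
  moreover have "node ` K \<subseteq> {0..1}" using node_in by blast
  ultimately have "set (refine \<gamma>\<^sub>0 K) \<noteq> {}" "set (refine \<gamma>\<^sub>0 K) \<subseteq> {0..1}" unfolding s by simp_all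
  moreover have "sorted_wrt (<) (refine \<gamma>\<^sub>0 K)" unfolding refine_def by (rule strict_sorted_list_of_set)
  ultimately show "refine \<gamma>\<^sub>0 K \<in> \<Gamma>_above \<gamma>\<^sub>0"
    unfolding \<Gamma>_above_def \<Gamma>_def using s by auto
qed

text \<open>
  Places the entries of a vector indexed by \<open>\<gamma>\<close> at the codes in \<open>K\<close> of its nodes, so that \<^const>\<open>proj\<close> followed
  by \<open>spread\<close> is sampling restricted to \<open>K\<close>.
\<close>

definition spread :: "real list \<Rightarrow> nat set \<Rightarrow> (nat \<Rightarrow> real) \<Rightarrow> nat \<Rightarrow> real" where
  "spread \<gamma> K y = (\<lambda>i. if i \<in> K then y (pos \<gamma> (node i)) else 0)"

lemma spread_proj:
  assumes "node ` K \<subseteq> set \<gamma>"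
  shows "spread \<gamma> K (scale_on {..<length \<gamma>} t (proj \<gamma> x)) = restr K (\<lambda>i. t * sample x i)"
proof
  fix i
  show "spread \<gamma> K (scale_on {..<length \<gamma>} t (proj \<gamma> x)) i = restr K (\<lambda>i. t * sample x i) i"
  proof (cases "i \<in> K")
    case True
    then have "node i \<in> set \<gamma>" using assms by blast
    from pos[OF this] True show ?thesis
      by (simp add: spread_def restr_def sample_def scale_on_def proj_def)
  qed (simp add: spread_def restr_def)
qed

lemma continuous_spread:
  assumes "node ` K \<subseteq> set \<gamma>" shows "continuous_map (Rm (length \<gamma>)) euclidean (spread \<gamma> K)"
proof -
  have "continuous_map (Rm (length \<gamma>)) euclideanreal (\<lambda>y. spread \<gamma> K y i)" for i
  proof (cases "i \<in> K")
    case True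
    then have "node i \<in> set \<gamma>" using assms by blast
    from continuous_Rm_coord[OF pos(1)[OF this]] True show ?thesis by (simp add: spread_def)
  qed (simp add: spread_def)
  then have "continuous_map (Rm (length \<gamma>)) (product_topology (\<lambda>_. euclideanreal) UNIV) (spread \<gamma> K)"
    unfolding continuous_map_componentwise_UNIV by blast
  then show ?thesis by (simp add: euclidean_product_topology)
qed

lemma RV_RmD:
  assumes "RV_Rm m M X g \<nu>" "0 < m"
  shows "X \<in> M \<rightarrow>\<^sub>M borel_of (Rm m)" "normalising g" "sets \<nu> = sets (borel_of (Rm m))"
    "\<And>c. 0 < c \<Longrightarrow> emeasure \<nu> {y \<in> topspace (Rm m). c \<le> max_norm m y} < \<infinity>"
    "tail_convergence M X (Rm m) (scale_on {..<m}) (max_norm m) g \<nu>"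
    "\<exists>c>0. 0 < emeasure \<nu> {y \<in> topspace (Rm m). c \<le> max_norm m y}"
  using assms unfolding Rm_ideal_def RV_iff[OF continuous_max_norm[OF assms(2)]]
    tail_measure_iff[OF continuous_max_norm[OF assms(2)]] by auto

text \<open>
  Each finite set \<open>K\<close> of codes is covered by the refinement of \<open>\<gamma>\<^sub>0\<close> by its nodes, which yields a limit measure \<open>\<nu> K\<close>
  for the coordinates in \<open>K\<close>. For \<open>K \<subseteq> H\<close> a test function of the coordinates \<open>K\<close> has one and the same limit, whether
  computed with \<open>\<nu> K\<close> or with \<open>\<nu> H\<close>; this is the consistency that \<open>ex_measure_on_sequences\<close> requires.
\<close>

proposition ex_sample_tail_measure:
  assumes \<gamma>\<^sub>0: "\<gamma>\<^sub>0 \<in> \<Gamma>"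
    and RV: "\<And>\<gamma>. \<gamma> \<in> \<Gamma>_above \<gamma>\<^sub>0 \<Longrightarrow> RV_Rm (length \<gamma>) M (\<lambda>\<omega>. proj \<gamma> (\<xi> \<omega>)) g (\<mu>f \<gamma>)"
  obtains Q where "sets Q = sets borel" "emeasure Q {\<lambda>_. 0} = 0"
    "\<And>K c. finite K \<Longrightarrow> 0 < c \<Longrightarrow> emeasure Q (exceed K c) < \<infinity>"
    "\<And>K c F B. finite K \<Longrightarrow> 0 < c \<Longrightarrow> continuous_on UNIV F \<Longrightarrow> (\<And>y. \<bar>F y\<bar> \<le> B) \<Longrightarrow>
       (\<And>y. y \<notin> exceed K c \<Longrightarrow> F y = 0) \<Longrightarrow> (\<And>y. F (restr K y) = F y) \<Longrightarrow>
       ((\<lambda>t. g t * (\<integral>\<omega>. F (\<lambda>i. inverse t * sample (\<xi> \<omega>) i) \<partial>M)) \<longlongrightarrow> (\<integral>y. F y \<partial>Q)) at_top"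
proof -
  define \<nu> where "\<nu> K = distr (\<mu>f (refine \<gamma>\<^sub>0 K)) borel (spread (refine \<gamma>\<^sub>0 K) K)" for K
  note above = refine_above[OF \<gamma>\<^sub>0]
  have nodes: "node ` K \<subseteq> set (refine \<gamma>\<^sub>0 K)" if "finite K" for K
    using set_refine[OF \<gamma>\<^sub>0 that] by auto
  note D = RV_RmD[OF RV[OF above] \<Gamma>_above_subset(2)[OF above]]
  have sm: "spread (refine \<gamma>\<^sub>0 K) K \<in> \<mu>f (refine \<gamma>\<^sub>0 K) \<rightarrow>\<^sub>M borel" if "finite K" for K
    using continuous_map_borel_measurable[OF continuous_spread[OF nodes[OF that]]]
      measurable_cong_sets[OF D(3)[OF that that] refl] by blast
  have s\<nu>: "sets (\<nu> K) = sets borel" for K by (simp add: \<nu>_def)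
  have exceed_spread: "c \<le> max_norm (length (refine \<gamma>\<^sub>0 K)) y"
    if K: "finite K" and sy: "spread (refine \<gamma>\<^sub>0 K) K y \<in> exceed K c" for K y c
  proof -
    obtain i where i: "i \<in> K" "c < \<bar>y (pos (refine \<gamma>\<^sub>0 K) (node i))\<bar>"
      using sy by (auto simp: exceed_def spread_def)
    have "pos (refine \<gamma>\<^sub>0 K) (node i) < length (refine \<gamma>\<^sub>0 K)"
      using pos(1) nodes[OF K] i(1) by blast
    from abs_le_max_norm[OF this, of y] i(2) show ?thesis by linarith
  qed
  have fin: "emeasure (\<nu> K) (exceed K c) < \<infinity>" if K: "finite K" and c: "0 < c" for K c
  proof -
    let ?\<gamma> = "refine \<gamma>\<^sub>0 K"
    have sp: "space (\<mu>f ?\<gamma>) = topspace (Rm (length ?\<gamma>))"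
      using sets_eq_imp_space_eq[OF D(3)[OF K K]] by simp
    have "emeasure (\<nu> K) (exceed K c) = emeasure (\<mu>f ?\<gamma>) (spread ?\<gamma> K -` exceed K c \<inter> space (\<mu>f ?\<gamma>))"
      unfolding \<nu>_def by (rule emeasure_distr[OF sm[OF K]]) simp
    also have "\<dots> \<le> emeasure (\<mu>f ?\<gamma>) {y \<in> topspace (Rm (length ?\<gamma>)). c \<le> max_norm (length ?\<gamma>) y}"
    proof (rule emeasure_mono)
      show "{y \<in> topspace (Rm (length ?\<gamma>)). c \<le> max_norm (length ?\<gamma>) y} \<in> sets (\<mu>f ?\<gamma>)"
        unfolding D(3)[OF K K]
        by (rule borel_of_level[OF continuous_max_norm[OF \<Gamma>_above_subset(2)[OF above[OF K]]]])
    qed (use exceed_spread[OF K] sp in auto)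
    also have "\<dots> < \<infinity>" by (rule D(4)[OF K K c])
    finally show ?thesis .
  qed
  have conv: "((\<lambda>t. g t * (\<integral>\<omega>. F (restr K (\<lambda>i. inverse t * sample (\<xi> \<omega>) i)) \<partial>M)) \<longlongrightarrow> (\<integral>y. F y \<partial>\<nu> K)) at_top"
    if K: "finite K" and c: "0 < c" and F: "continuous_on UNIV F" "\<And>y. \<bar>F y\<bar> \<le> B"
      and z: "\<And>y. y \<notin> exceed K c \<Longrightarrow> F y = 0" for K c B and F :: "(nat \<Rightarrow> real) \<Rightarrow> real"
  proof -
    let ?\<gamma> = "refine \<gamma>\<^sub>0 K"
    have cm: "continuous_map (Rm (length ?\<gamma>)) euclideanreal (F \<circ> spread ?\<gamma> K)"
      using F(1) by (intro continuous_map_compose[OF continuous_spread[OF nodes[OF K]]]) simp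
    have "((\<lambda>t. g t * (\<integral>\<omega>. (F \<circ> spread ?\<gamma> K) (scale_on {..<length ?\<gamma>} (inverse t) (proj ?\<gamma> (\<xi> \<omega>))) \<partial>M))
        \<longlongrightarrow> (\<integral>y. (F \<circ> spread ?\<gamma> K) y \<partial>\<mu>f ?\<gamma>)) at_top"
    proof (rule tail_convergenceD[OF D(5)[OF K K] cm _ c])
      show "c \<le> max_norm (length ?\<gamma>) y" if "(F \<circ> spread ?\<gamma> K) y \<noteq> 0" for y
        using that z exceed_spread[OF K] by (metis comp_apply)
    qed (use F(2) in simp)
    moreover have "(\<integral>y. F y \<partial>\<nu> K) = (\<integral>y. (F \<circ> spread ?\<gamma> K) y \<partial>\<mu>f ?\<gamma>)"
      unfolding \<nu>_def using integral_distr[OF sm[OF K] borel_measurable_continuous_onI[OF F(1)]] by simp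
    ultimately show ?thesis by (simp only: comp_apply spread_proj[OF nodes[OF K]])
  qed
  have con: "(\<integral>y. F (restr K y) \<partial>\<nu> K) = (\<integral>y. F (restr K y) \<partial>\<nu> H)"
    if KH: "K \<subseteq> H" "finite H" and c: "0 < c" and F: "continuous_on UNIV F"
      "\<And>y. 0 \<le> F y \<and> F y \<le> 1" "\<And>y. y \<notin> exceed K c \<Longrightarrow> F y = 0"
    for K H c and F :: "(nat \<Rightarrow> real) \<Rightarrow> real"
  proof -
    have K: "finite K" using KH finite_subset by blast
    have cF: "continuous_on UNIV (\<lambda>y. F (restr K y))"
      by (rule continuous_on_compose2[OF F(1) continuous_restr]) simp
    have b: "\<bar>F (restr K y)\<bar> \<le> 1" for y using F(2)[of "restr K y"] by linarith
    have zK: "F (restr K y) = 0" if "y \<notin> exceed L c" "K \<subseteq> L" for L y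
      using F(3) that exceed_mono[OF that(2) order_refl, of c] by (metis order_refl restr_in_exceed subsetD)
    have "restr K (restr H y) = restr K (restr K y)" for y using KH(1) by (simp add: restr_restr Int_absorb2)
    with conv[OF K c cF b zK[OF _ order_refl]]
    have "((\<lambda>t. g t * (\<integral>\<omega>. F (restr K (restr H (\<lambda>i. inverse t * sample (\<xi> \<omega>) i))) \<partial>M))
        \<longlongrightarrow> (\<integral>y. F (restr K y) \<partial>\<nu> K)) at_top" by simp
    from tendsto_unique[OF trivial_limit_at_top_linorder this conv[OF KH(2) c cF b zK[OF _ KH(1)]]]
    show ?thesis .
  qed
  obtain Q where Q: "sets Q = sets borel" "emeasure Q {\<lambda>_. 0} = 0"
    and eQ: "\<And>K A c. finite K \<Longrightarrow> 0 < c \<Longrightarrow> A \<in> sets borel \<Longrightarrow> A \<subseteq> exceed K c \<Longrightarrow>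
      (\<And>y. restr K y \<in> A \<longleftrightarrow> y \<in> A) \<Longrightarrow> emeasure Q A = emeasure (\<nu> K) A"
  proof (rule ex_measure_on_sequences[of \<nu>], goal_cases)
    case (1 K) show ?case by (rule s\<nu>)
  next
    case (2 K c) from 2(2-) show ?case by (rule fin)
  next
    case (3 K H c F) from 3(2-) show ?case by (rule con)
  next
    case (4 Q) from 4(2-) show ?case by (rule 4(1))
  qed
  have spQ: "space Q = UNIV" using sets_eq_imp_space_eq[OF Q(1)] by simp
  show thesis
  proof (rule that[OF Q])
    show "emeasure Q (exceed K c) < \<infinity>" if "finite K" "0 < c" for K c
      using fin[OF that] eQ[OF that, of "exceed K c"] by (simp add: restr_in_exceed)
    fix K c B and F :: "(nat \<Rightarrow> real) \<Rightarrow> real"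
    assume K: "finite K" and c: "0 < c" and F: "continuous_on UNIV F" "\<And>y. \<bar>F y\<bar> \<le> B"
      and z: "\<And>y. y \<notin> exceed K c \<Longrightarrow> F y = 0" and inv: "\<And>y. F (restr K y) = F y"
    have mr: "restr K \<in> Q \<rightarrow>\<^sub>M borel" "restr K \<in> \<nu> K \<rightarrow>\<^sub>M borel"
      using measurable_restr measurable_cong_sets[OF Q(1) refl] measurable_cong_sets[OF s\<nu> refl] by blast+
    have Fb: "F \<in> borel_measurable borel" by (rule borel_measurable_continuous_onI[OF F(1)])
    have "(\<integral>y. F y \<partial>distr Q borel (restr K)) = (\<integral>y. F y \<partial>distr (\<nu> K) borel (restr K))"
    proof (rule integral_cong_on_set[where G = "exceed K c"])
      fix A assume A: "A \<in> sets (distr Q borel (restr K))" "A \<subseteq> exceed K c"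
      let ?A = "restr K -` A"
      have "?A \<in> sets borel" using measurable_sets[OF measurable_restr, of A K] A by simp
      moreover have "?A \<subseteq> exceed K c"
        using A(2) restr_in_exceed[OF order_refl, of K _ c] by auto
      ultimately have "emeasure Q ?A = emeasure (\<nu> K) ?A"
        by (intro eQ[OF K c]) (auto simp: restr_restr)
      then show "emeasure (distr Q borel (restr K)) A = emeasure (distr (\<nu> K) borel (restr K)) A"
        using A mr spQ sets_eq_imp_space_eq[OF s\<nu>] by (simp add: emeasure_distr)
    qed (use Fb z in auto)
    then have "(\<integral>y. F y \<partial>Q) = (\<integral>y. F y \<partial>\<nu> K)"
      using mr Fb by (simp add: integral_distr inv)
    moreover have "((\<lambda>t. g t * (\<integral>\<omega>. F (restr K (\<lambda>i. inverse t * sample (\<xi> \<omega>) i)) \<partial>M)) \<longlongrightarrow> (\<integral>y. F y \<partial>\<nu> K)) at_top"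
      by (rule conv[OF K c F]) (rule z)
    ultimately show "((\<lambda>t. g t * (\<integral>\<omega>. F (\<lambda>i. inverse t * sample (\<xi> \<omega>) i) \<partial>M)) \<longlongrightarrow> (\<integral>y. F y \<partial>Q)) at_top"
      by (simp only: inv)
  qed
qed

section \<open>Tail bounds\<close>

text \<open>
  A continuous substitute for the event that some \<open>\<bar>L w\<bar>\<close> is large: it is 0 if none exceeds \<open>a\<close>, and 1 as soon
  as one reaches \<open>2 a\<close>. With coordinates as \<open>L w\<close> it measures the norm, with differences of coordinates the
  oscillation.
\<close>

definition soft_exceed :: "'w set \<Rightarrow> ('w \<Rightarrow> (nat \<Rightarrow> real) \<Rightarrow> real) \<Rightarrow> real \<Rightarrow> (nat \<Rightarrow> real) \<Rightarrow> real" where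
  "soft_exceed W L a y = min 1 (\<Sum>w\<in>W. max 0 (\<bar>L w y\<bar> / a - 1))"

lemma soft_exceed_bounds: "0 \<le> soft_exceed W L a y" "soft_exceed W L a y \<le> 1"
  by (auto simp: soft_exceed_def intro: sum_nonneg)

lemma soft_exceed_eq_0:
  assumes "0 < a" "\<And>w. w \<in> W \<Longrightarrow> \<bar>L w y\<bar> \<le> a" shows "soft_exceed W L a y = 0"
proof -
  have "(\<Sum>w\<in>W. max 0 (\<bar>L w y\<bar> / a - 1)) = 0"
  proof (intro sum.neutral ballI)
    fix w assume "w \<in> W"
    then have "\<bar>L w y\<bar> / a \<le> 1" using assms by simp
    then show "max 0 (\<bar>L w y\<bar> / a - 1) = 0" by simp
  qed
  then show ?thesis by (simp add: soft_exceed_def)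
qed

lemma soft_exceed_eq_1:
  assumes "0 < a" "finite W" "w \<in> W" "2 * a \<le> \<bar>L w y\<bar>" shows "soft_exceed W L a y = 1"
proof -
  have "1 \<le> max 0 (\<bar>L w y\<bar> / a - 1)" using assms by (simp add: field_simps)
  also have "\<dots> \<le> (\<Sum>w\<in>W. max 0 (\<bar>L w y\<bar> / a - 1))"
    using assms by (intro member_le_sum) auto
  finally show ?thesis by (simp add: soft_exceed_def)
qed

lemma continuous_soft_exceed:
  assumes "0 < a" "\<And>w. w \<in> W \<Longrightarrow> continuous_on UNIV (L w)" shows "continuous_on UNIV (soft_exceed W L a)"
  unfolding soft_exceed_def using assms by (intro continuous_intros) auto

lemma normalising_nonneg: "normalising g \<Longrightarrow> 0 \<le> t \<Longrightarrow> 0 \<le> g t"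
  using measurable_space[of g "restrict_space borel {0..}" "restrict_space borel {0..}" t]
  by (simp add: normalising_def space_restrict_space)

text \<open>
  The iterated limit in \<open>\<epsilon>\<close> and \<open>t\<close>, restated with one bound for all small \<open>\<epsilon>\<close> and eventually all \<open>t\<close>.
\<close>

lemma modulus_conditionD:
  assumes "modulus_condition M \<xi> g" "0 < d" "0 < e"
  obtains b where "0 < b" "\<And>r. 0 < r \<Longrightarrow> r < b \<Longrightarrow>
    eventually (\<lambda>t. g t * measure M {\<omega> \<in> space M. t * d < modulus r (\<xi> \<omega>)} < e) at_top"
proof -
  have "((\<lambda>r. Limsup at_top (\<lambda>t. ereal (g t * measure M {\<omega> \<in> space M. t * d < modulus r (\<xi> \<omega>)}))) \<longlongrightarrow> 0)
       (at_right 0)"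
    using assms by (simp add: modulus_condition_def)
  then have "eventually (\<lambda>r. Limsup at_top (\<lambda>t. ereal (g t * measure M {\<omega> \<in> space M. t * d < modulus r (\<xi> \<omega>)})) < ereal e)
      (at_right 0)"
    by (rule order_tendstoD(2)) (use assms in simp)
  then obtain b where b: "0 < b" "\<And>r. 0 < r \<Longrightarrow> r < b \<Longrightarrow>
      Limsup at_top (\<lambda>t. ereal (g t * measure M {\<omega> \<in> space M. t * d < modulus r (\<xi> \<omega>)})) < ereal e"
    unfolding eventually_at_right_field by blast
  show thesis
  proof (rule that[OF b(1)])
    fix r :: real assume "0 < r" "r < b"
    from Limsup_lessD[OF b(2)[OF this]]
    show "eventually (\<lambda>t. g t * measure M {\<omega> \<in> space M. t * d < modulus r (\<xi> \<omega>)} < e) at_top" by simp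
  qed
qed

text \<open>
  The situation after the limit \<open>Q\<close> of the sampled paths has been constructed.
\<close>

locale path_limit = prob_space M for M :: "'w measure" +
  fixes \<xi> :: "'w \<Rightarrow> real \<Rightarrow> real" and g :: "real \<Rightarrow> real" and Q :: "(nat \<Rightarrow> real) measure"
  assumes path: "\<xi> \<in> M \<rightarrow>\<^sub>M borel_of C01"
    and norming: "normalising g"
    and modulus: "modulus_condition M \<xi> g"
    and sets_Q: "sets Q = sets borel"
    and Q_zero: "emeasure Q {\<lambda>_. 0} = 0"
    and Q_finite: "\<And>K c. finite K \<Longrightarrow> 0 < c \<Longrightarrow> emeasure Q (exceed K c) < \<infinity>"
    and Q_limit: "\<And>K c F B. finite K \<Longrightarrow> 0 < c \<Longrightarrow> continuous_on UNIV F \<Longrightarrow> (\<And>y. \<bar>F y\<bar> \<le> B) \<Longrightarrow>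
       (\<And>y. y \<notin> exceed K c \<Longrightarrow> F y = 0) \<Longrightarrow> (\<And>y. F (restr K y) = F y) \<Longrightarrow>
       ((\<lambda>t. g t * (\<integral>\<omega>. F (\<lambda>i. inverse t * sample (\<xi> \<omega>) i) \<partial>M)) \<longlongrightarrow> (\<integral>y. F y \<partial>Q)) at_top"
begin

definition X :: "real \<Rightarrow> 'w \<Rightarrow> nat \<Rightarrow> real" where
  "X t \<omega> = (\<lambda>i. inverse t * sample (\<xi> \<omega>) i)"

lemma path_space: "\<omega> \<in> space M \<Longrightarrow> \<xi> \<omega> \<in> topspace C01"
  using measurable_space[OF path] by simp

lemma space_Q: "space Q = UNIV" using sets_eq_imp_space_eq[OF sets_Q] by simp

lemma X_eq_sample: "X t \<omega> = sample (scale_on {0..1} (inverse t) (\<xi> \<omega>))"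
  unfolding X_def sample_scale ..

lemma measurable_X: "X t \<in> M \<rightarrow>\<^sub>M borel"
proof -
  have "(\<lambda>x. sample (scale_on {0..1} (inverse t) x)) \<in> borel_of C01 \<rightarrow>\<^sub>M borel"
    using measurable_compose[OF continuous_map_measurable[OF continuous_scale_C01]
        continuous_map_borel_measurable[OF continuous_sample]] .
  from measurable_compose[OF path this] show ?thesis unfolding X_eq_sample .
qed

lemma measurable_sup_norm_path: "(\<lambda>\<omega>. sup_norm (\<xi> \<omega>)) \<in> borel_measurable M"
  by (rule measurable_compose[OF path continuous_map_borel_measurable[OF continuous_sup_norm]])

lemma measurable_modulus_path: "0 \<le> e \<Longrightarrow> (\<lambda>\<omega>. modulus e (\<xi> \<omega>)) \<in> borel_measurable M"
  by (rule measurable_compose[OF path continuous_map_borel_measurable[OF continuous_modulus]])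

lemma scaled_expectation_mono:
  assumes b: "eventually (\<lambda>t. g t * (\<integral>\<omega>. f t \<omega> \<partial>M) \<le> b) at_top"
    and m: "\<And>t. h t \<in> borel_measurable M" "\<And>t. f t \<in> borel_measurable M"
    and le: "\<And>t \<omega>. \<omega> \<in> space M \<Longrightarrow> 0 \<le> h t \<omega> \<and> h t \<omega> \<le> f t \<omega> \<and> f t \<omega> \<le> 1"
  shows "eventually (\<lambda>t. g t * (\<integral>\<omega>. h t \<omega> \<partial>M) \<le> b) at_top"
  using b eventually_gt_at_top[of 0]
proof eventually_elim
  case (elim t)
  have bound: "0 \<le> h t \<omega> \<and> h t \<omega> \<le> 1 \<and> 0 \<le> f t \<omega> \<and> f t \<omega> \<le> 1" if "\<omega> \<in> space M" for \<omega>
    using le[OF that, of t] by linarith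
  have "(\<integral>\<omega>. h t \<omega> \<partial>M) \<le> (\<integral>\<omega>. f t \<omega> \<partial>M)"
  proof (rule integral_mono)
    show "integrable M (h t)" "integrable M (f t)"
      by (rule integrable_const_bound[where B = 1]; use m bound in \<open>auto intro!: AE_I2\<close>)+
  qed (use le in blast)
  then have "g t * (\<integral>\<omega>. h t \<omega> \<partial>M) \<le> g t * (\<integral>\<omega>. f t \<omega> \<partial>M)"
    using normalising_nonneg[OF norming, of t] elim(2) by (intro mult_left_mono) auto
  with elim(1) show ?case by linarith
qed

text \<open>
  \<^const>\<open>soft_exceed\<close> lies between the indicators at the levels \<open>2 a\<close> and \<open>a\<close>. The convergence of its integrals
  therefore carries bounds from probabilities to \<open>Q\<close>, and from \<open>Q\<close> to probabilities, at the price of a factor 2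
  in the level.
\<close>

context
  fixes W :: "'v set" and L :: "'v \<Rightarrow> (nat \<Rightarrow> real) \<Rightarrow> real" and K :: "nat set" and a c :: real
  assumes fin: "finite W" "finite K" and pos: "0 < a" "0 < c"
    and cont: "\<And>w. w \<in> W \<Longrightarrow> continuous_on UNIV (L w)"
    and dep: "\<And>w y. w \<in> W \<Longrightarrow> L w (restr K y) = L w y"
    and supp: "\<And>w y. w \<in> W \<Longrightarrow> a < \<bar>L w y\<bar> \<Longrightarrow> y \<in> exceed K c"
begin

lemma soft_limit:
  "((\<lambda>t. g t * (\<integral>\<omega>. soft_exceed W L a (X t \<omega>) \<partial>M)) \<longlongrightarrow> (\<integral>y. soft_exceed W L a y \<partial>Q)) at_top"
  unfolding X_def
proof (rule Q_limit[OF fin(2) pos(2) continuous_soft_exceed[OF pos(1) cont], where B = 1])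
  show "\<bar>soft_exceed W L a y\<bar> \<le> 1" for y using soft_exceed_bounds[of W L a y] by simp
  show "soft_exceed W L a y = 0" if "y \<notin> exceed K c" for y
    by (rule soft_exceed_eq_0[OF pos(1)]) (use that supp in force)
  show "soft_exceed W L a (restr K y) = soft_exceed W L a y" for y
    unfolding soft_exceed_def using dep by (simp cong: sum.cong)
qed

lemma borel_soft: "soft_exceed W L a \<in> borel_measurable borel"
  by (rule borel_measurable_continuous_onI[OF continuous_soft_exceed[OF pos(1) cont]])

lemma borel_exceeding_set: "{y. \<exists>w\<in>W. b < \<bar>L w y\<bar>} \<in> sets borel"
proof -
  have "open (\<Union>w\<in>W. {y. b < \<bar>L w y\<bar>})"
    using cont by (intro open_UN ballI open_Collect_less continuous_intros) auto
  moreover have "(\<Union>w\<in>W. {y. b < \<bar>L w y\<bar>}) = {y. \<exists>w\<in>W. b < \<bar>L w y\<bar>}" by auto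
  ultimately show ?thesis by simp
qed

lemma borel_exceeding_set': "{y. \<exists>w\<in>W. b \<le> \<bar>L w y\<bar>} \<in> sets borel"
proof -
  have "closed (\<Union>w\<in>W. {y. b \<le> \<bar>L w y\<bar>})"
    using cont fin by (intro closed_UN ballI closed_Collect_le continuous_intros) auto
  moreover have "(\<Union>w\<in>W. {y. b \<le> \<bar>L w y\<bar>}) = {y. \<exists>w\<in>W. b \<le> \<bar>L w y\<bar>}" by auto
  ultimately show ?thesis by (metis borel_closed)
qed

lemma Q_exceeding_le:
  assumes b: "eventually (\<lambda>t. g t * prob {\<omega> \<in> space M. \<exists>w\<in>W. a < \<bar>L w (X t \<omega>)\<bar>} \<le> b) at_top"
  shows "emeasure Q {y. \<exists>w\<in>W. 2 * a \<le> \<bar>L w y\<bar>} \<le> ennreal b"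
proof -
  let ?A = "{y. \<exists>w\<in>W. 2 * a \<le> \<bar>L w y\<bar>}" and ?E = "\<lambda>t. {\<omega> \<in> space M. \<exists>w\<in>W. a < \<bar>L w (X t \<omega>)\<bar>}"
  have E: "?E t \<in> events" for t
    using measurable_sets[OF measurable_X borel_exceeding_set, of t a] by (simp add: vimage_def Int_def conj_commute)
  have "eventually (\<lambda>t. g t * (\<integral>\<omega>. indicator (?E t) \<omega> \<partial>M) \<le> b) at_top"
    using b E by simp
  then have "eventually (\<lambda>t. g t * (\<integral>\<omega>. soft_exceed W L a (X t \<omega>) \<partial>M) \<le> b) at_top"
  proof (rule scaled_expectation_mono)
    show "(\<lambda>\<omega>. soft_exceed W L a (X t \<omega>)) \<in> borel_measurable M" for t
      by (rule measurable_compose[OF measurable_X borel_soft])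
    show "indicator (?E t) \<in> borel_measurable M" for t using E by simp
    fix t :: real and \<omega> assume "\<omega> \<in> space M"
    show "0 \<le> soft_exceed W L a (X t \<omega>) \<and> soft_exceed W L a (X t \<omega>) \<le> indicator (?E t) \<omega> \<and> indicator (?E t) \<omega> \<le> (1::real)"
    proof (cases "\<omega> \<in> ?E t")
      case False
      then have "soft_exceed W L a (X t \<omega>) = 0"
        using \<open>\<omega> \<in> space M\<close> by (intro soft_exceed_eq_0 pos(1)) force
      then show ?thesis using False by simp
    qed (use soft_exceed_bounds[of W L a "X t \<omega>"] in simp)
  qed
  from tendsto_upperbound[OF soft_limit this] have i: "(\<integral>y. soft_exceed W L a y \<partial>Q) \<le> b" by simp
  have int: "integrable Q (soft_exceed W L a)"
  proof (rule integrable_bounded_support[where B = 1 and G = "exceed K c"])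
    show "\<bar>soft_exceed W L a y\<bar> \<le> 1" for y using soft_exceed_bounds[of W L a y] by simp
    show "soft_exceed W L a y = 0" if "y \<notin> exceed K c" for y
      by (rule soft_exceed_eq_0[OF pos(1)]) (use that supp in force)
    show "soft_exceed W L a \<in> borel_measurable Q"
      using borel_soft measurable_cong_sets[OF sets_Q refl] by blast
  qed (use Q_finite[OF fin(2) pos(2)] sets_Q in auto)
  have "emeasure Q ?A = (\<integral>\<^sup>+y. indicator ?A y \<partial>Q)"
    using borel_exceeding_set'[of "2 * a"] sets_Q by simp
  also have "\<dots> \<le> (\<integral>\<^sup>+y. ennreal (soft_exceed W L a y) \<partial>Q)"
  proof (rule nn_integral_mono)
    fix y show "indicator ?A y \<le> ennreal (soft_exceed W L a y)"
      using soft_exceed_eq_1[of a W _ L y] pos fin by (cases "y \<in> ?A") auto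
  qed
  also have "\<dots> = ennreal (\<integral>y. soft_exceed W L a y \<partial>Q)"
    by (rule nn_integral_eq_integral[OF int AE_I2[OF soft_exceed_bounds(1)]])
  also have "\<dots> \<le> ennreal b" using i by (rule ennreal_leI)
  finally show ?thesis .
qed

lemma prob_exceeding_bounded:
  "\<exists>b. eventually (\<lambda>t. g t * prob {\<omega> \<in> space M. \<exists>w\<in>W. 2 * a \<le> \<bar>L w (X t \<omega>)\<bar>} \<le> b) at_top"
proof -
  let ?E = "\<lambda>t. {\<omega> \<in> space M. \<exists>w\<in>W. 2 * a \<le> \<bar>L w (X t \<omega>)\<bar>}"
  let ?b = "(\<integral>y. soft_exceed W L a y \<partial>Q) + 1"
  have E: "?E t \<in> events" for t
    using measurable_sets[OF measurable_X borel_exceeding_set', of t "2 * a"] by (simp add: vimage_def Int_def conj_commute)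
  have "eventually (\<lambda>t. g t * (\<integral>\<omega>. soft_exceed W L a (X t \<omega>) \<partial>M) < ?b) at_top"
    by (rule order_tendstoD(2)[OF soft_limit]) simp
  then have "eventually (\<lambda>t. g t * (\<integral>\<omega>. soft_exceed W L a (X t \<omega>) \<partial>M) \<le> ?b) at_top"
    by eventually_elim simp
  then have "eventually (\<lambda>t. g t * (\<integral>\<omega>. indicator (?E t) \<omega> \<partial>M) \<le> ?b) at_top"
  proof (rule scaled_expectation_mono)
    show "(\<lambda>\<omega>. soft_exceed W L a (X t \<omega>)) \<in> borel_measurable M" for t
      by (rule measurable_compose[OF measurable_X borel_soft])
    show "indicator (?E t) \<in> borel_measurable M" for t using E by simp
    fix t :: real and \<omega> assume "\<omega> \<in> space M"
    show "0 \<le> (indicator (?E t) \<omega> :: real) \<and> indicator (?E t) \<omega> \<le> soft_exceed W L a (X t \<omega>) \<and> soft_exceed W L a (X t \<omega>) \<le> 1"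
    proof (cases "\<omega> \<in> ?E t")
      case True
      then obtain w where "w \<in> W" "2 * a \<le> \<bar>L w (X t \<omega>)\<bar>" by blast
      from soft_exceed_eq_1[of a W w L "X t \<omega>", OF pos(1) fin(1) this] show ?thesis using True by simp
    qed (use soft_exceed_bounds[of W L a "X t \<omega>"] in simp)
  qed
  then show ?thesis using E by auto
qed

end

lemma abs_X: "0 < t \<Longrightarrow> c \<le> \<bar>X t \<omega> i\<bar> \<longleftrightarrow> t * c \<le> \<bar>sample (\<xi> \<omega>) i\<bar>"
  "0 < t \<Longrightarrow> c < \<bar>X t \<omega> i\<bar> \<longleftrightarrow> t * c < \<bar>sample (\<xi> \<omega>) i\<bar>"
  "0 < t \<Longrightarrow> c < \<bar>X t \<omega> i - X t \<omega> j\<bar> \<longleftrightarrow> t * c < \<bar>sample (\<xi> \<omega>) i - sample (\<xi> \<omega>) j\<bar>"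
proof -
  assume t: "0 < t"
  have "\<bar>X t \<omega> i - X t \<omega> j\<bar> = \<bar>sample (\<xi> \<omega>) i - sample (\<xi> \<omega>) j\<bar> / t"
    unfolding X_def right_diff_distrib[symmetric] using t by (simp add: abs_mult divide_inverse)
  moreover have "\<bar>X t \<omega> i\<bar> = \<bar>sample (\<xi> \<omega>) i\<bar> / t"
    unfolding X_def using t by (simp add: abs_mult divide_inverse)
  ultimately show "c \<le> \<bar>X t \<omega> i\<bar> \<longleftrightarrow> t * c \<le> \<bar>sample (\<xi> \<omega>) i\<bar>"
    "c < \<bar>X t \<omega> i\<bar> \<longleftrightarrow> t * c < \<bar>sample (\<xi> \<omega>) i\<bar>"
    "c < \<bar>X t \<omega> i - X t \<omega> j\<bar> \<longleftrightarrow> t * c < \<bar>sample (\<xi> \<omega>) i - sample (\<xi> \<omega>) j\<bar>"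
    using t by (simp_all add: pos_le_divide_eq pos_less_divide_eq mult.commute)
qed

text \<open>
  If \<open>\<parallel>\<xi>\<parallel> \<ge> c t\<close>, then \<open>\<bar>\<xi>\<bar> \<ge> c t / 2\<close> at a point of a fixed fine grid, or the oscillation of \<open>\<xi>\<close> over one cell
  of this grid exceeds \<open>c t / 4\<close>. The first event has bounded rescaled probability by the limit on that grid, the second
  by the modulus condition.
\<close>

lemma norm_tail_bounded:
  assumes c: "0 < c"
  obtains b where "0 \<le> b" "eventually (\<lambda>t. g t * prob {\<omega> \<in> space M. t * c \<le> sup_norm (\<xi> \<omega>)} \<le> b) at_top"
proof -
  obtain r where r: "0 < r" "\<And>e. 0 < e \<Longrightarrow> e < r \<Longrightarrow>
      eventually (\<lambda>t. g t * prob {\<omega> \<in> space M. t * (c / 4) < modulus e (\<xi> \<omega>)} < 1) at_top"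
    by (rule modulus_conditionD[OF modulus, of "c / 4" 1]) (use c in auto)
  obtain n where n: "1 / real (Suc n) < r" using nat_approx_posE r(1) by blast
  let ?m = "\<lambda>t. {\<omega> \<in> space M. t * (c / 4) < modulus (1 / real (Suc n)) (\<xi> \<omega>)}"
  let ?E = "\<lambda>t. {\<omega> \<in> space M. \<exists>i\<in>grid n. 2 * (c / 4) \<le> \<bar>X t \<omega> i\<bar>}"
  have m: "eventually (\<lambda>t. g t * prob (?m t) < 1) at_top" by (rule r(2)) (use n in auto)
  have "\<exists>b. eventually (\<lambda>t. g t * prob (?E t) \<le> b) at_top"
  proof (rule prob_exceeding_bounded[where L = "\<lambda>i y. y i" and K = "grid n" and c = "c / 4"])
    show "restr (grid n) y i = y i" if "i \<in> grid n" for i y using that by (simp add: restr_def)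
    show "y \<in> exceed (grid n) (c / 4)" if "i \<in> grid n" "c / 4 < \<bar>y i\<bar>" for i y
      using that by (auto simp: exceed_def)
  qed (use finite_grid c continuous_on_coord in auto)
  then obtain b where b: "eventually (\<lambda>t. g t * prob (?E t) \<le> b) at_top" by blast
  have "eventually (\<lambda>t. g t * prob {\<omega> \<in> space M. t * c \<le> sup_norm (\<xi> \<omega>)} \<le> max 0 (b + 1)) at_top"
    using m b eventually_gt_at_top[of 0]
  proof eventually_elim
    case (elim t)
    have Em: "?E t \<in> events"
    proof -
      have "{y. \<exists>i\<in>grid n. 2 * (c / 4) \<le> \<bar>y i\<bar>} \<in> sets (borel :: (nat \<Rightarrow> real) measure)"
        by (rule borel_exceeding_set'[where L = "\<lambda>i y. y i" and K = "grid n" and a = 1 and c = 1])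
           (use finite_grid continuous_on_coord in \<open>auto simp: restr_def exceed_def\<close>)
      from measurable_sets[OF measurable_X this, of t] show ?thesis
        by (simp add: vimage_def Int_def conj_commute)
    qed
    have mm: "?m t \<in> events"
      using measurable_modulus_path[of "1 / real (Suc n)"] by measurable
    have "{\<omega> \<in> space M. t * c \<le> sup_norm (\<xi> \<omega>)} \<subseteq> ?E t \<union> ?m t"
    proof
      fix \<omega> assume w: "\<omega> \<in> {\<omega> \<in> space M. t * c \<le> sup_norm (\<xi> \<omega>)}"
      show "\<omega> \<in> ?E t \<union> ?m t"
      proof (rule ccontr)
        assume n: "\<omega> \<notin> ?E t \<union> ?m t"
        have "\<bar>sample (\<xi> \<omega>) i\<bar> \<le> t * (c / 2)" if "i \<in> grid n" for i
          using n w that abs_X(1)[OF elim(3), of "2 * (c / 4)" \<omega> i] by (force simp: not_le)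
        then have "sup_norm (\<xi> \<omega>) \<le> t * (c / 2) + modulus (1 / real (Suc n)) (\<xi> \<omega>)"
          using w by (intro sup_norm_le_grid path_space) auto
        moreover have "modulus (1 / real (Suc n)) (\<xi> \<omega>) \<le> t * (c / 4)" using n w by auto
        ultimately have "sup_norm (\<xi> \<omega>) \<le> t * (c / 2) + t * (c / 4)" by linarith
        moreover have "t * (c / 2) + t * (c / 4) < t * c" using elim(3) c by (simp add: field_simps)
        ultimately show False using w by (auto simp: mult.commute)
      qed
    qed
    then have "prob {\<omega> \<in> space M. t * c \<le> sup_norm (\<xi> \<omega>)} \<le> prob (?E t \<union> ?m t)"
      by (rule finite_measure_mono) (use Em mm in auto)
    also have "\<dots> \<le> prob (?E t) + prob (?m t)" by (rule measure_Un_le[OF Em mm])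
    finally have "g t * prob {\<omega> \<in> space M. t * c \<le> sup_norm (\<xi> \<omega>)} \<le> g t * (prob (?E t) + prob (?m t))"
      using normalising_nonneg[OF norming, of t] elim(3) by (intro mult_left_mono) auto
    then show ?case using elim(1,2) by (simp add: distrib_left)
  qed
  then show thesis by (rule that[rotated]) simp
qed

text \<open>
  The bound on the norm of the path holds for the maxima over finitely many coordinates, uniformly in their number.
\<close>

lemma Q_sup_finite:
  assumes c: "0 < c" shows "{y :: nat \<Rightarrow> real. \<exists>i. c \<le> \<bar>y i\<bar>} \<in> sets borel" "emeasure Q {y. \<exists>i. c \<le> \<bar>y i\<bar>} < \<infinity>"
proof -
  obtain b where b: "0 \<le> b" "eventually (\<lambda>t. g t * prob {\<omega> \<in> space M. t * (c / 2) \<le> sup_norm (\<xi> \<omega>)} \<le> b) at_top"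
    using norm_tail_bounded[of "c / 2"] c by auto
  let ?A = "\<lambda>m. {y :: nat \<Rightarrow> real. \<exists>i\<in>{..<m}. 2 * (c / 2) \<le> \<bar>y i\<bar>}"
  have A: "?A m \<in> sets borel" for m
    by (rule borel_exceeding_set'[where L = "\<lambda>i y. y i" and K = "{..<m}" and a = 1 and c = 1])
       (use continuous_on_coord in \<open>auto simp: restr_def exceed_def\<close>)
  have U: "(\<Union>m. ?A m) = {y. \<exists>i. c \<le> \<bar>y i\<bar>}" by auto
  show "{y :: nat \<Rightarrow> real. \<exists>i. c \<le> \<bar>y i\<bar>} \<in> sets borel"
    unfolding U[symmetric] by (rule sets.countable_UN) (use A in auto)
  have "emeasure Q (?A m) \<le> ennreal b" for m
  proof (rule Q_exceeding_le[where L = "\<lambda>i y. y i" and K = "{..<m}" and c = "c / 2"])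
    show "eventually (\<lambda>t. g t * prob {\<omega> \<in> space M. \<exists>i\<in>{..<m}. c / 2 < \<bar>X t \<omega> i\<bar>} \<le> b) at_top"
      using b(2) eventually_gt_at_top[of 0]
    proof eventually_elim
      case (elim t)
      have "{\<omega> \<in> space M. \<exists>i\<in>{..<m}. c / 2 < \<bar>X t \<omega> i\<bar>} \<subseteq> {\<omega> \<in> space M. t * (c / 2) \<le> sup_norm (\<xi> \<omega>)}"
      proof clarify
        fix \<omega> i assume w: "\<omega> \<in> space M" "c / 2 < \<bar>X t \<omega> i\<bar>"
        have "\<bar>sample (\<xi> \<omega>) i\<bar> \<le> sup_norm (\<xi> \<omega>)"
          using sup_norm_le_iff_sample[OF path_space[OF w(1)], of "sup_norm (\<xi> \<omega>)"] by simp
        then show "t * (c / 2) \<le> sup_norm (\<xi> \<omega>)" using w(2) abs_X(2)[OF elim(2), of "c / 2" \<omega> i] by linarith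
      qed
      then have "prob {\<omega> \<in> space M. \<exists>i\<in>{..<m}. c / 2 < \<bar>X t \<omega> i\<bar>} \<le> prob {\<omega> \<in> space M. t * (c / 2) \<le> sup_norm (\<xi> \<omega>)}"
        using measurable_sup_norm_path by (intro finite_measure_mono) auto
      then have "g t * prob {\<omega> \<in> space M. \<exists>i\<in>{..<m}. c / 2 < \<bar>X t \<omega> i\<bar>} \<le>
          g t * prob {\<omega> \<in> space M. t * (c / 2) \<le> sup_norm (\<xi> \<omega>)}"
        using normalising_nonneg[OF norming, of t] elim(2) by (intro mult_left_mono) auto
      with elim(1) show ?case by linarith
    qed
  qed (use c continuous_on_coord in \<open>auto simp: restr_def exceed_def\<close>)
  then have "(SUP m. emeasure Q (?A m)) \<le> ennreal b" by (intro SUP_least)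
  moreover have "(SUP m. emeasure Q (?A m)) = emeasure Q (\<Union>m. ?A m)"
  proof (rule SUP_emeasure_incseq)
    show "range ?A \<subseteq> sets Q" using A sets_Q by blast
    show "incseq ?A"
    proof (rule incseq_SucI)
      fix m show "?A m \<subseteq> ?A (Suc m)" by (rule Collect_mono) (simp add: lessThan_Suc)
    qed
  qed
  ultimately have "emeasure Q {y. \<exists>i. c \<le> \<bar>y i\<bar>} \<le> ennreal b" unfolding U by simp
  then show "emeasure Q {y. \<exists>i. c \<le> \<bar>y i\<bar>} < \<infinity>"
    using ennreal_less_top[of b] unfolding infinity_ennreal_def by (rule le_less_trans)
qed

section \<open>Almost every sequence is the sample of a path\<close>

text \<open>
  An oscillation of at least \<open>1 / (k + 1)\<close> occurs between nodes at distance at most \<open>1 / (n + 1)\<close>. Sequences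
  that avoid this for each \<open>k\<close> and suitable \<open>n\<close> are the ones that are uniformly continuous on the nodes.
\<close>

definition rough :: "nat \<Rightarrow> nat \<Rightarrow> (nat \<Rightarrow> real) set" where
  "rough k n = {y. \<exists>i j. \<bar>node i - node j\<bar> \<le> 1 / real (Suc n) \<and> 1 / real (Suc k) \<le> \<bar>y i - y j\<bar>}"

definition regular :: "(nat \<Rightarrow> real) set" where
  "regular = - (\<Union>k. \<Inter>n. rough k n)"

lemma borel_rough: "rough k n \<in> sets borel"
proof -
  let ?I = "{p :: nat \<times> nat. \<bar>node (fst p) - node (snd p)\<bar> \<le> 1 / real (Suc n)}"
  have e: "rough k n = (\<Union>p\<in>?I. {y. 1 / real (Suc k) \<le> \<bar>y (fst p) - y (snd p)\<bar>})"
    unfolding rough_def by (simp add: set_eq_iff split_paired_Ex Bex_def del: of_nat_Suc)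
  have "closed {y :: nat \<Rightarrow> real. 1 / real (Suc k) \<le> \<bar>y i - y j\<bar>}" for i j
    by (intro closed_Collect_le continuous_intros continuous_on_coord)
  then show ?thesis unfolding e by (intro sets.countable_UN' borel_closed) auto
qed

lemma borel_regular: "regular \<in> sets borel"
  unfolding regular_def using borel_rough by (intro borel_comp sets.countable_UN sets.countable_INT) auto

text \<open>
  Oscillations between finitely many nodes are bounded by the modulus of continuity of the path, so the modulus
  condition applies; the pairs of nodes are then exhausted by finite sets.
\<close>

lemma Q_rough_small:
  assumes e: "0 < e"
  obtains n where "emeasure Q (rough k n) \<le> ennreal e"
proof -
  define a where "a = 1 / real (Suc k) / 2"
  have a: "0 < a" "2 * a = 1 / real (Suc k)" unfolding a_def by (simp_all del: of_nat_Suc)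
  obtain b where b: "0 < b" "\<And>r. 0 < r \<Longrightarrow> r < b \<Longrightarrow>
      eventually (\<lambda>t. g t * prob {\<omega> \<in> space M. t * a < modulus r (\<xi> \<omega>)} < e) at_top"
    by (rule modulus_conditionD[OF modulus a(1) e]) blast
  obtain n where n: "1 / real (Suc n) < b" using nat_approx_posE b(1) by blast
  let ?r = "1 / real (Suc n)"
  have r0: "0 < ?r" by simp
  let ?W = "\<lambda>m. {p \<in> {..<m} \<times> {..<m}. \<bar>node (fst p) - node (snd p)\<bar> \<le> ?r}"
  let ?L = "\<lambda>p (y :: nat \<Rightarrow> real). y (fst p) - y (snd p)"
  let ?A = "\<lambda>m. {y. \<exists>w\<in>?W m. 2 * a \<le> \<bar>?L w y\<bar>}"
  have finW: "finite (?W m)" for m by (rule finite_Collect_conjI) simp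
  have contL: "continuous_on UNIV (?L w)" for w by (intro continuous_intros continuous_on_coord)
  have depL: "?L w (restr {..<m} y) = ?L w y" if "w \<in> ?W m" for w m y
    using that by (auto simp: restr_def)
  have suppL: "y \<in> exceed {..<m} (a / 2)" if w: "w \<in> ?W m" "a < \<bar>?L w y\<bar>" for w m y
  proof -
    have "a / 2 < \<bar>y (fst w)\<bar> \<or> a / 2 < \<bar>y (snd w)\<bar>" using w(2) by linarith
    then show ?thesis using w(1) by (auto simp: exceed_def)
  qed
  have a2: "0 < a / 2" using a by simp
  have A: "?A m \<in> sets borel" for m
    by (rule borel_exceeding_set'[OF finW finite_lessThan a(1) a2 contL depL suppL])
  have le: "emeasure Q (?A m) \<le> ennreal e" for m
  proof (rule Q_exceeding_le[OF finW finite_lessThan a(1) a2 contL depL suppL])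
    show "eventually (\<lambda>t. g t * prob {\<omega> \<in> space M. \<exists>w\<in>?W m. a < \<bar>?L w (X t \<omega>)\<bar>} \<le> e) at_top"
      using b(2)[OF r0 n] eventually_gt_at_top[of 0]
    proof eventually_elim
      case (elim t)
      have "{\<omega> \<in> space M. \<exists>w\<in>?W m. a < \<bar>?L w (X t \<omega>)\<bar>} \<subseteq> {\<omega> \<in> space M. t * a < modulus ?r (\<xi> \<omega>)}"
      proof
        fix \<omega> assume "\<omega> \<in> {\<omega> \<in> space M. \<exists>w\<in>?W m. a < \<bar>?L w (X t \<omega>)\<bar>}"
        then obtain w where w: "\<omega> \<in> space M" "w \<in> ?W m" "a < \<bar>?L w (X t \<omega>)\<bar>" by blast
        then have "t * a < \<bar>sample (\<xi> \<omega>) (fst w) - sample (\<xi> \<omega>) (snd w)\<bar>"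
          using abs_X(3)[OF elim(2)] by blast
        also have "\<dots> \<le> modulus ?r (\<xi> \<omega>)"
          unfolding sample_def using w(2) r0 by (intro modulus_ge path_space[OF w(1)] node_in) auto
        finally show "\<omega> \<in> {\<omega> \<in> space M. t * a < modulus ?r (\<xi> \<omega>)}" using w(1) by blast
      qed
      then have "prob {\<omega> \<in> space M. \<exists>w\<in>?W m. a < \<bar>?L w (X t \<omega>)\<bar>} \<le>
          prob {\<omega> \<in> space M. t * a < modulus ?r (\<xi> \<omega>)}"
        using measurable_modulus_path[of ?r] r0 by (intro finite_measure_mono) auto
      then have "g t * prob {\<omega> \<in> space M. \<exists>w\<in>?W m. a < \<bar>?L w (X t \<omega>)\<bar>} \<le>
          g t * prob {\<omega> \<in> space M. t * a < modulus ?r (\<xi> \<omega>)}"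
        using normalising_nonneg[OF norming, of t] elim(2) by (intro mult_left_mono) auto
      with elim(1) show ?case by linarith
    qed
  qed
  have U: "(\<Union>m. ?A m) = rough k n"
  proof (intro equalityI subsetI)
    fix y assume "y \<in> rough k n"
    then obtain i j where "\<bar>node i - node j\<bar> \<le> ?r" "2 * a \<le> \<bar>y i - y j\<bar>"
      unfolding rough_def a(2) by blast
    moreover from this have "(i, j) \<in> ?W (Suc (max i j))" by (simp add: less_Suc_eq_le)
    ultimately have "y \<in> ?A (Suc (max i j))" by force
    then show "y \<in> (\<Union>m. ?A m)" by blast
  next
    fix y assume "y \<in> (\<Union>m. ?A m)"
    then show "y \<in> rough k n" unfolding rough_def a(2) by blast
  qed
  have "(SUP m. emeasure Q (?A m)) = emeasure Q (\<Union>m. ?A m)"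
  proof (rule SUP_emeasure_incseq)
    show "range ?A \<subseteq> sets Q" using A sets_Q by blast
    show "incseq ?A"
    proof (rule incseq_SucI)
      fix m show "?A m \<subseteq> ?A (Suc m)"
      proof
        fix y assume "y \<in> ?A m"
        then obtain w where "w \<in> ?W m" "2 * a \<le> \<bar>?L w y\<bar>" by blast
        moreover from this have "w \<in> ?W (Suc m)" by auto
        ultimately show "y \<in> ?A (Suc m)" by blast
      qed
    qed
  qed
  moreover have "(SUP m. emeasure Q (?A m)) \<le> ennreal e" using le by (intro SUP_least)
  ultimately have "emeasure Q (rough k n) \<le> ennreal e" unfolding U by simp
  then show thesis by (rule that)
qed

lemma Q_regular: "emeasure Q (- regular) = 0"
proof -
  have "emeasure Q (\<Inter>n. rough k n) = 0" for k
  proof -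
    have "emeasure Q (\<Inter>n. rough k n) \<le> 0 + ennreal e" if e: "0 < e" for e
    proof -
      obtain n where n: "emeasure Q (rough k n) \<le> ennreal e" by (rule Q_rough_small[OF e])
      have "emeasure Q (\<Inter>n. rough k n) \<le> emeasure Q (rough k n)"
        using borel_rough sets_Q by (intro emeasure_mono) auto
      with n show ?thesis by simp
    qed
    then have "emeasure Q (\<Inter>n. rough k n) \<le> 0" by (rule ennreal_le_epsilon)
    then show ?thesis by simp
  qed
  then have "(\<Inter>n. rough k n) \<in> null_sets Q" for k
    using borel_rough sets_Q by (intro null_setsI sets.countable_INT) auto
  then have "(\<Union>k. \<Inter>n. rough k n) \<in> null_sets Q" by (intro null_sets_UN)
  then show ?thesis unfolding regular_def double_compl by (rule null_setsD1)
qed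

lemma AE_regular: "AE y in Q. y \<in> regular"
  using Q_regular borel_regular sets_Q space_Q
  by (intro AE_I[of _ _ "- regular"]) auto

lemma regular_is_sample:
  assumes "y \<in> regular" shows "\<exists>x\<in>topspace C01. sample x = y"
proof -
  obtain x where "x \<in> topspace C01" "sample x = y"
  proof (rule ex_sample_eq)
    fix d :: real assume "0 < d"
    then obtain k where k: "1 / real (Suc k) < d" using nat_approx_posE by blast
    obtain n where n: "y \<notin> rough k n" using assms unfolding regular_def by blast
    have "\<bar>y i - y j\<bar> \<le> d" if "\<bar>node i - node j\<bar> \<le> 1 / real (Suc n)" for i j
      using n that k unfolding rough_def by force
    then show "\<exists>e>0. \<forall>i j. \<bar>node i - node j\<bar> \<le> e \<longrightarrow> \<bar>y i - y j\<bar> \<le> d"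
      by (intro exI[of _ "1 / real (Suc n)"]) auto
  qed
  then show ?thesis by blast
qed

text \<open>
  Irregular sequences are replaced by the zero sequence to make \<open>path_of\<close> total.
\<close>

definition trimmed :: "(nat \<Rightarrow> real) \<Rightarrow> nat \<Rightarrow> real" where
  "trimmed y = (if y \<in> regular then y else (\<lambda>_. 0))"

definition path_of :: "(nat \<Rightarrow> real) \<Rightarrow> real \<Rightarrow> real" where
  "path_of y = (SOME x. x \<in> topspace C01 \<and> sample x = trimmed y)"

lemma path_of: "path_of y \<in> topspace C01" "sample (path_of y) = trimmed y"
proof -
  have "(\<lambda>u\<in>{0..1}. 0) \<in> topspace C01" by (rule restrict_in_C01) simp
  moreover have "sample (\<lambda>u\<in>{0..1}. 0) = (\<lambda>_. 0)" using node_in by (simp add: sample_def fun_eq_iff)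
  ultimately have "\<exists>x. x \<in> topspace C01 \<and> sample x = trimmed y"
    using regular_is_sample[of y] unfolding trimmed_def by (cases "y \<in> regular") auto
  from someI_ex[OF this] show "path_of y \<in> topspace C01" "sample (path_of y) = trimmed y"
    unfolding path_of_def by auto
qed

lemma measurable_trimmed: "trimmed \<in> Q \<rightarrow>\<^sub>M borel"
proof -
  have "(\<lambda>y. if y \<in> regular then y else (\<lambda>_. 0)) \<in> borel \<rightarrow>\<^sub>M borel"
    using borel_regular by (intro measurable_If_set) auto
  then show ?thesis unfolding trimmed_def using measurable_cong_sets[OF sets_Q refl] by blast
qed

text \<open>
  The path is the uniform limit of its interpolations, each a continuous function of finitely many coordinates.
\<close>

lemma measurable_path_of: "path_of \<in> Q \<rightarrow>\<^sub>M borel_of C01"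
  unfolding C01_eq
proof (rule measurable_limit_metric[where h = "\<lambda>n y. interpolate n (trimmed y)"])
  have "interpolate n \<in> borel \<rightarrow>\<^sub>M borel_of C01" for n
    using continuous_map_measurable[OF continuous_interpolate] measurable_cong_sets[OF sets_borel_of_euclidean refl]
    by blast
  then show "(\<lambda>y. interpolate n (trimmed y)) \<in> Q \<rightarrow>\<^sub>M borel_of (mtopology_of C01_metric)" for n
    unfolding C01_eq[symmetric] by (rule measurable_compose[OF measurable_trimmed])
  show "path_of y \<in> mspace C01_metric" for y by (simp only: mspace_C01_metric path_of)
  show "(\<lambda>n. mdist C01_metric (path_of y) (interpolate n (trimmed y))) \<longlonglongrightarrow> 0" for y
    using interpolate_tendsto[OF path_of(1), of y] by (simp only: path_of(2))
qed

definition \<mu> :: "(real \<Rightarrow> real) measure" where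
  "\<mu> = distr Q (borel_of C01) path_of"

lemma sets_\<mu>: "sets \<mu> = sets (borel_of C01)" by (simp add: \<mu>_def)

lemma \<mu>_level_finite:
  assumes c: "0 < c" shows "emeasure \<mu> {x \<in> topspace C01. c \<le> sup_norm x} < \<infinity>"
proof -
  have "emeasure \<mu> {x \<in> topspace C01. c \<le> sup_norm x} =
      emeasure Q (path_of -` {x \<in> topspace C01. c \<le> sup_norm x} \<inter> space Q)"
    unfolding \<mu>_def by (rule emeasure_distr[OF measurable_path_of borel_of_level[OF continuous_sup_norm]])
  also have "\<dots> \<le> emeasure Q {y. \<exists>i. c / 2 \<le> \<bar>y i\<bar>}"
  proof (rule emeasure_mono)
    show "path_of -` {x \<in> topspace C01. c \<le> sup_norm x} \<inter> space Q \<subseteq> {y. \<exists>i. c / 2 \<le> \<bar>y i\<bar>}"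
    proof
      fix y assume "y \<in> path_of -` {x \<in> topspace C01. c \<le> sup_norm x} \<inter> space Q"
      then have "\<not> sup_norm (path_of y) \<le> c / 2" using c by auto
      then obtain i where "c / 2 < \<bar>trimmed y i\<bar>"
        unfolding sup_norm_le_iff_sample[OF path_of(1)] path_of(2) by (auto simp: not_le)
      then have "c / 2 \<le> \<bar>y i\<bar>" using c by (cases "y \<in> regular") (simp_all add: trimmed_def)
      then show "y \<in> {y. \<exists>i. c / 2 \<le> \<bar>y i\<bar>}" by blast
    qed
    show "{y. \<exists>i. c / 2 \<le> \<bar>y i\<bar>} \<in> sets Q" using Q_sup_finite(1)[of "c / 2"] c sets_Q by simp
  qed
  also have "\<dots> < \<infinity>" using Q_sup_finite(2)[of "c / 2"] c by simp
  finally show ?thesis .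
qed

lemma \<mu>_null: "emeasure \<mu> {x \<in> topspace C01. sup_norm x \<le> 0} = 0"
proof -
  have Z: "{x \<in> topspace C01. sup_norm x \<le> 0} \<in> sets (borel_of C01)"
    using closedin_continuous_map_preimage[OF continuous_sup_norm, of "{..0}"] by (auto intro: closedin_imp_borel_of)
  have z: "{\<lambda>_. 0} \<in> null_sets Q" using Q_zero sets_Q by (intro null_setsI) auto
  have r: "- regular \<in> null_sets Q" using Q_regular sets_Q borel_regular by (intro null_setsI) auto
  have "emeasure \<mu> {x \<in> topspace C01. sup_norm x \<le> 0} =
      emeasure Q (path_of -` {x \<in> topspace C01. sup_norm x \<le> 0} \<inter> space Q)"
    unfolding \<mu>_def by (rule emeasure_distr[OF measurable_path_of Z])
  also have "\<dots> \<le> emeasure Q ({\<lambda>_. 0} \<union> - regular)"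
  proof (rule emeasure_mono)
    show "path_of -` {x \<in> topspace C01. sup_norm x \<le> 0} \<inter> space Q \<subseteq> {\<lambda>_. 0} \<union> - regular"
    proof
      fix y assume "y \<in> path_of -` {x \<in> topspace C01. sup_norm x \<le> 0} \<inter> space Q"
      then have "sup_norm (path_of y) \<le> 0" by auto
      then have "\<bar>trimmed y i\<bar> \<le> 0" for i
        unfolding sup_norm_le_iff_sample[OF path_of(1)] path_of(2) by blast
      then have "trimmed y = (\<lambda>_. 0)" by auto
      then show "y \<in> {\<lambda>_. 0} \<union> - regular" by (auto simp: trimmed_def split: if_splits)
    qed
    show "{\<lambda>_. 0} \<union> - regular \<in> sets Q" using z r by blast
  qed
  also have "\<dots> = 0" using null_sets.Un[OF z r] by (rule null_setsD1)
  finally show ?thesis by simp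
qed

section \<open>Convergence for continuous test functions\<close>

abbreviation rescaled :: "real \<Rightarrow> 'w \<Rightarrow> real \<Rightarrow> real" where
  "rescaled t \<omega> \<equiv> scale_on {0..1} (inverse t) (\<xi> \<omega>)"

lemma measurable_rescaled:
  assumes "continuous_map C01 euclideanreal f" shows "(\<lambda>\<omega>. f (rescaled t \<omega>)) \<in> borel_measurable M"
  by (rule measurable_compose[OF path measurable_compose[OF continuous_map_measurable[OF continuous_scale_C01]
        continuous_map_borel_measurable[OF assms]]])

lemma integrable_rescaled:
  assumes "continuous_map C01 euclideanreal f" "\<And>x. x \<in> topspace C01 \<Longrightarrow> \<bar>f x\<bar> \<le> B"
  shows "integrable M (\<lambda>\<omega>. f (rescaled t \<omega>))"
proof (rule integrable_const_bound[where B = B])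
  show "AE \<omega> in M. norm (f (rescaled t \<omega>)) \<le> B"
    using assms(2) scale_C01 path_space by (intro AE_I2) simp
qed (rule measurable_rescaled[OF assms(1)])

lemma integrable_\<mu>:
  assumes "continuous_map C01 euclideanreal f" "\<And>x. x \<in> topspace C01 \<Longrightarrow> \<bar>f x\<bar> \<le> B" "0 < c"
    "\<And>x. x \<in> topspace C01 \<Longrightarrow> f x \<noteq> 0 \<Longrightarrow> c \<le> sup_norm x"
  shows "integrable \<mu> f"
proof (rule integrable_bounded_support)
  have sp: "space \<mu> = topspace C01" by (simp add: \<mu>_def)
  show "f \<in> borel_measurable \<mu>"
    using continuous_map_borel_measurable[OF assms(1)] measurable_cong_sets[OF sets_\<mu> refl] by blast
  show "{x \<in> topspace C01. c \<le> sup_norm x} \<in> sets \<mu>"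
    unfolding sets_\<mu> by (rule borel_of_level[OF continuous_sup_norm])
  show "emeasure \<mu> {x \<in> topspace C01. c \<le> sup_norm x} < \<infinity>" by (rule \<mu>_level_finite[OF assms(3)])
  show "\<bar>f x\<bar> \<le> B" if "x \<in> space \<mu>" for x using that assms(2) sp by simp
  show "f x = 0" if "x \<in> space \<mu>" "x \<notin> {x \<in> topspace C01. c \<le> sup_norm x}" for x
    using that assms(4)[of x] sp by auto
qed

text \<open>
  \<open>f\<close> of the interpolation depends on the coordinates in one grid only and vanishes if these are small, so the
  defining limits of \<open>Q\<close> apply. Refining the grid is dominated convergence, with \<open>{y. \<exists>i. c / 2 \<le> \<bar>y i\<bar>}\<close> as
  the set of finite mass that carries all integrands.
\<close>

lemma interpolated_limit:
  assumes f: "continuous_map C01 euclideanreal f" and B: "\<And>x. x \<in> topspace C01 \<Longrightarrow> \<bar>f x\<bar> \<le> B"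
    and c: "0 < c" and z: "\<And>x. x \<in> topspace C01 \<Longrightarrow> f x \<noteq> 0 \<Longrightarrow> c \<le> sup_norm x"
  shows "((\<lambda>t. g t * (\<integral>\<omega>. f (interpolate n (X t \<omega>)) \<partial>M)) \<longlongrightarrow> (\<integral>y. f (interpolate n y) \<partial>Q)) at_top"
    and "(\<lambda>n. \<integral>y. f (interpolate n y) \<partial>Q) \<longlonglongrightarrow> (\<integral>x. f x \<partial>\<mu>)"
proof -
  have cont: "continuous_on UNIV (\<lambda>y. f (interpolate n y))" for n
    using continuous_map_compose[OF continuous_interpolate f] by (simp add: comp_def)
  have supp: "\<exists>i\<in>grid n. c / 2 < \<bar>y i\<bar>" if ny: "f (interpolate n y) \<noteq> 0" for n y
  proof (rule ccontr)
    assume "\<not> ?thesis"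
    then have "sup_norm (interpolate n y) \<le> c / 2" by (intro interpolate_sup_norm_le) (auto simp: not_less)
    with z[OF interpolate_C01 ny] c show False by linarith
  qed
  show "((\<lambda>t. g t * (\<integral>\<omega>. f (interpolate n (X t \<omega>)) \<partial>M)) \<longlongrightarrow> (\<integral>y. f (interpolate n y) \<partial>Q)) at_top"
    unfolding X_def
  proof (rule Q_limit[OF finite_grid _ cont, where c = "c / 2" and B = B])
    show "f (interpolate n y) = 0" if "y \<notin> exceed (grid n) (c / 2)" for y
      using supp[of n y] that by (auto simp: exceed_def)
    show "f (interpolate n (restr (grid n) y)) = f (interpolate n y)" for y by (simp only: interpolate_restr)
  qed (use c B interpolate_C01 in auto)
  let ?G = "{y :: nat \<Rightarrow> real. \<exists>i. c / 2 \<le> \<bar>y i\<bar>}"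
  have G: "?G \<in> sets Q" "emeasure Q ?G < \<infinity>" using Q_sup_finite[of "c / 2"] c sets_Q by auto
  have "(\<lambda>n. \<integral>y. f (interpolate n y) \<partial>Q) \<longlonglongrightarrow> (\<integral>y. f (path_of y) \<partial>Q)"
  proof (rule integral_dominated_convergence[where w = "\<lambda>y. B * indicator ?G y"])
    show "(\<lambda>y. f (path_of y)) \<in> borel_measurable Q"
      by (rule measurable_compose[OF measurable_path_of continuous_map_borel_measurable[OF f]])
    show "(\<lambda>y. f (interpolate n y)) \<in> borel_measurable Q" for n
      using borel_measurable_continuous_onI[OF cont] measurable_cong_sets[OF sets_Q refl] by blast
    show "integrable Q (\<lambda>y. B * indicator ?G y)" using G by (simp add: integrable_indicator_iff)
    show "AE y in Q. norm (f (interpolate n y)) \<le> B * indicator ?G y" for n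
    proof (rule AE_I2)
      fix y
      show "norm (f (interpolate n y)) \<le> B * indicator ?G y"
      proof (cases "f (interpolate n y) = 0")
        case True
        have "0 \<le> B" using B[OF interpolate_C01[of n y]] by linarith
        then show ?thesis using True by (simp add: indicator_def)
      next
        case False
        from supp[OF this] obtain i where "c / 2 < \<bar>y i\<bar>" by blast
        then have "y \<in> ?G" by (auto intro: less_imp_le)
        then show ?thesis using B[OF interpolate_C01[of n y]] by simp
      qed
    qed
    show "AE y in Q. (\<lambda>n. f (interpolate n y)) \<longlonglongrightarrow> f (path_of y)"
      using AE_regular
    proof eventually_elim
      case (elim y)
      have s: "sample (path_of y) = y" using elim by (simp add: path_of(2) trimmed_def)
      have p: "path_of y \<in> mspace C01_metric" by (simp only: mspace_C01_metric path_of(1))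
      have lim: "(\<lambda>n. mdist C01_metric (path_of y) (interpolate n y)) \<longlonglongrightarrow> 0"
        using interpolate_tendsto[OF path_of(1), of y] by (simp only: s)
      show ?case
      proof (rule LIMSEQ_I)
        fix r :: real assume r: "0 < r"
        obtain d where d: "0 < d"
          "\<And>x. x \<in> mspace C01_metric \<Longrightarrow> mdist C01_metric (path_of y) x < d \<Longrightarrow> \<bar>f x - f (path_of y)\<bar> < r"
          by (rule continuous_map_mtopology_ofD[OF f[unfolded C01_eq] p r]) blast
        have "eventually (\<lambda>n. mdist C01_metric (path_of y) (interpolate n y) < d) sequentially"
          by (rule order_tendstoD(2)[OF lim d(1)])
        then have "eventually (\<lambda>n. norm (f (interpolate n y) - f (path_of y)) < r) sequentially"
        proof eventually_elim
          case (elim n)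
          have "interpolate n y \<in> mspace C01_metric" by (simp only: mspace_C01_metric interpolate_C01)
          from d(2)[OF this elim] show ?case by simp
        qed
        then show "\<exists>no. \<forall>n\<ge>no. norm (f (interpolate n y) - f (path_of y)) < r"
          by (simp only: eventually_sequentially)
      qed
    qed
  qed
  also have "(\<integral>y. f (path_of y) \<partial>Q) = (\<integral>x. f x \<partial>\<mu>)"
    unfolding \<mu>_def by (rule integral_distr[OF measurable_path_of continuous_map_borel_measurable[OF f], symmetric])
  finally show "(\<lambda>n. \<integral>y. f (interpolate n y) \<partial>Q) \<longlonglongrightarrow> (\<integral>x. f x \<partial>\<mu>)" .
qed

text \<open>
  If the oscillation is at most \<open>d\<close>, interpolation moves \<open>x\<close> by at most \<open>d\<close>, and it does not enlarge the norm, so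
  neither value of \<open>f\<close> can be non-zero unless \<open>\<parallel>x\<parallel> \<ge> c\<close>.
\<close>

lemma interpolation_error_pointwise:
  assumes L: "\<And>x y. x \<in> topspace C01 \<Longrightarrow> y \<in> topspace C01 \<Longrightarrow> \<bar>f x - f y\<bar> \<le> L * mdist C01_metric x y"
    and L0: "0 \<le> L" and B: "\<And>x. x \<in> topspace C01 \<Longrightarrow> \<bar>f x\<bar> \<le> B"
    and z: "\<And>x. x \<in> topspace C01 \<Longrightarrow> f x \<noteq> 0 \<Longrightarrow> c \<le> sup_norm x"
    and x: "x \<in> topspace C01" and d: "0 \<le> d"
  shows "\<bar>f x - f (interpolate n (sample x))\<bar> \<le>
    L * d * of_bool (c \<le> sup_norm x) + 2 * B * of_bool (d < modulus (1 / real (Suc n)) x)"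
proof -
  let ?y = "interpolate n (sample x)"
  have B0: "0 \<le> B" using B[OF x] by linarith
  show ?thesis
  proof (cases "d < modulus (1 / real (Suc n)) x")
    case True
    have "\<bar>f x - f ?y\<bar> \<le> 2 * B" using B[OF x] B[OF interpolate_C01[of n "sample x"]] by linarith
    moreover have "0 \<le> L * d * of_bool (c \<le> sup_norm x)" using L0 d by simp
    ultimately show ?thesis using True by simp
  next
    case False
    show ?thesis
    proof (cases "f x = 0 \<and> f ?y = 0")
      case True
      then show ?thesis using B0 L0 d by simp
    next
      case nz: False
      have "sup_norm ?y \<le> sup_norm x"
        using sup_norm_le_iff_sample[OF x, of "sup_norm x"] by (intro interpolate_sup_norm_le) simp
      then have "c \<le> sup_norm x" using nz z[OF x] z[OF interpolate_C01[of n "sample x"]] by linarith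
      moreover have "\<bar>f x - f ?y\<bar> \<le> L * d"
      proof -
        have "\<bar>f x - f ?y\<bar> \<le> L * mdist C01_metric x ?y" by (rule L[OF x interpolate_C01])
        also have "\<dots> \<le> L * d"
          using L0 interpolate_error[OF x, of n] False by (intro mult_left_mono) linarith+
        finally show ?thesis .
      qed
      ultimately show ?thesis using B0 by simp
    qed
  qed
qed

text \<open>
  The classical three-term comparison: path and interpolated path, convergence for the interpolated path, and
  refinement of the grid under \<open>Q\<close>. The first term is at most \<open>L d b + 2 B e'\<close>, where \<open>b\<close> bounds the rescaled tail of the norm and
  \<open>e'\<close> that of the modulus.
\<close>

lemma Lipschitz_limit:
  assumes L: "\<And>x y. x \<in> topspace C01 \<Longrightarrow> y \<in> topspace C01 \<Longrightarrow> \<bar>f x - f y\<bar> \<le> L * mdist C01_metric x y"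
    and L0: "0 \<le> L" and B: "\<And>x. x \<in> topspace C01 \<Longrightarrow> \<bar>f x\<bar> \<le> B"
    and c: "0 < c" and z: "\<And>x. x \<in> topspace C01 \<Longrightarrow> f x \<noteq> 0 \<Longrightarrow> c \<le> sup_norm x"
  shows "((\<lambda>t. g t * (\<integral>\<omega>. f (rescaled t \<omega>) \<partial>M)) \<longlongrightarrow> (\<integral>x. f x \<partial>\<mu>)) at_top"
proof (rule tendstoI)
  fix e :: real assume e: "0 < e"
  have f: "continuous_map C01 euclideanreal f"
  proof (rule C01_continuous_of_Lipschitz[where L = L])
    fix x y assume "x \<in> topspace C01" "y \<in> topspace C01"
    from L[OF this] show "f x \<le> f y + L * mdist C01_metric x y" by linarith
  qed
  note lims = interpolated_limit[OF f B c z]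
  have B0: "0 \<le> B" using B[OF interpolate_C01] by (meson abs_ge_zero order_trans)
  obtain b where b: "0 \<le> b" "eventually (\<lambda>t. g t * prob {\<omega> \<in> space M. t * c \<le> sup_norm (\<xi> \<omega>)} \<le> b) at_top"
    by (rule norm_tail_bounded[OF c])
  \<comment> \<open>The added 1 keeps the denominators positive when \<open>L b\<close> or \<open>B\<close> is 0.\<close>
  define d where "d = e / (4 * (L * b + 1))"
  have Lb: "0 < L * b + 1" using L0 b(1) by (simp add: add_nonneg_pos)
  have d: "0 < d" "L * d * b \<le> e / 4"
  proof -
    show "0 < d" using e Lb by (simp add: d_def)
    have "L * d * b = e / 4 * (L * b / (L * b + 1))" by (simp add: d_def)
    also have "\<dots> \<le> e / 4 * 1" using e Lb L0 b(1) by (intro mult_left_mono) auto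
    finally show "L * d * b \<le> e / 4" by simp
  qed
  define e' where "e' = e / (8 * (B + 1))"
  have e': "0 < e'" "2 * B * e' \<le> e / 4"
  proof -
    show "0 < e'" using e B0 by (simp add: e'_def)
    have "2 * B * e' = e / 4 * (B / (B + 1))" using B0 by (simp add: e'_def field_simps)
    also have "\<dots> \<le> e / 4 * 1" using e B0 by (intro mult_left_mono) auto
    finally show "2 * B * e' \<le> e / 4" by simp
  qed
  obtain r where r: "0 < r" "\<And>s. 0 < s \<Longrightarrow> s < r \<Longrightarrow>
      eventually (\<lambda>t. g t * prob {\<omega> \<in> space M. t * d < modulus s (\<xi> \<omega>)} < e') at_top"
    by (rule modulus_conditionD[OF modulus d(1) e'(1)]) blast
  have "eventually (\<lambda>n. dist (\<integral>y. f (interpolate n y) \<partial>Q) (\<integral>x. f x \<partial>\<mu>) < e / 4) sequentially"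
    by (rule tendstoD[OF lims(2)]) (use e in simp_all)
  moreover have "eventually (\<lambda>n. 1 / real (Suc n) < r) sequentially"
    by (rule order_tendstoD(2)[OF LIMSEQ_inverse_real_of_nat[unfolded inverse_eq_divide] r(1)])
  ultimately have "eventually (\<lambda>n. dist (\<integral>y. f (interpolate n y) \<partial>Q) (\<integral>x. f x \<partial>\<mu>) < e / 4 \<and> 1 / real (Suc n) < r) sequentially"
    by (rule eventually_conj)
  then obtain n where n: "dist (\<integral>y. f (interpolate n y) \<partial>Q) (\<integral>x. f x \<partial>\<mu>) < e / 4" "1 / real (Suc n) < r"
    by (auto dest: eventually_happens)
  have m: "eventually (\<lambda>t. g t * prob {\<omega> \<in> space M. t * d < modulus (1 / real (Suc n)) (\<xi> \<omega>)} < e') at_top"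
    by (rule r(2)[OF _ n(2)]) simp
  have i: "eventually (\<lambda>t. dist (g t * (\<integral>\<omega>. f (interpolate n (X t \<omega>)) \<partial>M)) (\<integral>y. f (interpolate n y) \<partial>Q) < e / 4) at_top"
    by (rule tendstoD[OF lims(1)]) (use e in simp_all)
  show "eventually (\<lambda>t. dist (g t * (\<integral>\<omega>. f (rescaled t \<omega>) \<partial>M)) (\<integral>x. f x \<partial>\<mu>) < e) at_top"
    using m i b(2) eventually_gt_at_top[of 0]
  proof eventually_elim
    case (elim t)
    have t: "0 < inverse t" using elim(4) by simp
    have g0: "0 \<le> g t" using normalising_nonneg[OF norming, of t] elim(4) by simp
    let ?P = "{\<omega> \<in> space M. t * c \<le> sup_norm (\<xi> \<omega>)}"
    let ?m = "{\<omega> \<in> space M. t * d < modulus (1 / real (Suc n)) (\<xi> \<omega>)}"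
    have P: "?P \<in> events" using measurable_sup_norm_path by measurable
    have mm: "?m \<in> events" using measurable_modulus_path[of "1 / real (Suc n)"] by measurable
    have iP: "integrable M (\<lambda>\<omega>. L * d * indicator ?P \<omega> + 2 * B * indicator ?m \<omega> :: real)"
      using P mm by (intro Bochner_Integration.integrable_add integrable_mult_right)
        (simp_all add: integrable_indicator_iff emeasure_eq_measure)
    have if1: "integrable M (\<lambda>\<omega>. f (rescaled t \<omega>))" by (rule integrable_rescaled[OF f B])
    have if2: "integrable M (\<lambda>\<omega>. f (interpolate n (X t \<omega>)))"
    proof (rule integrable_const_bound[where B = B])
      have "(\<lambda>y. f (interpolate n y)) \<in> borel_measurable borel"
        using continuous_map_compose[OF continuous_interpolate f]
        by (intro borel_measurable_continuous_onI) (simp add: comp_def)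
      from measurable_compose[OF measurable_X this]
      show "(\<lambda>\<omega>. f (interpolate n (X t \<omega>))) \<in> borel_measurable M" .
    qed (use B interpolate_C01 in auto)
    have pw: "\<bar>f (rescaled t \<omega>) - f (interpolate n (X t \<omega>))\<bar> \<le> L * d * indicator ?P \<omega> + 2 * B * indicator ?m \<omega>"
      if w: "\<omega> \<in> space M" for \<omega>
    proof -
      have x: "\<xi> \<omega> \<in> topspace C01" by (rule path_space[OF w])
      have 1: "c \<le> sup_norm (rescaled t \<omega>) \<longleftrightarrow> \<omega> \<in> ?P"
        unfolding sup_norm_scale[OF x t] using w elim(4) by (simp add: field_simps)
      have 2: "d < modulus (1 / real (Suc n)) (rescaled t \<omega>) \<longleftrightarrow> \<omega> \<in> ?m"
        unfolding modulus_scale[OF x t order_less_imp_le[OF zero_less_divide_1_iff[THEN iffD2, OF of_nat_0_less_iff[THEN iffD2, OF zero_less_Suc]]]]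
        using w elim(4) by (simp add: field_simps del: of_nat_Suc)
      have "\<bar>f (rescaled t \<omega>) - f (interpolate n (X t \<omega>))\<bar> \<le>
          L * d * of_bool (c \<le> sup_norm (rescaled t \<omega>)) +
          2 * B * of_bool (d < modulus (1 / real (Suc n)) (rescaled t \<omega>))"
        unfolding X_eq_sample
        by (rule interpolation_error_pointwise[OF L L0 B z scale_C01[OF x] less_imp_le[OF d(1)]])
      then show ?thesis unfolding 1 2 by (simp only: indicator_def)
    qed
    have "\<bar>g t * (\<integral>\<omega>. f (rescaled t \<omega>) \<partial>M) - g t * (\<integral>\<omega>. f (interpolate n (X t \<omega>)) \<partial>M)\<bar> =
        g t * \<bar>\<integral>\<omega>. f (rescaled t \<omega>) - f (interpolate n (X t \<omega>)) \<partial>M\<bar>"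
      using g0 by (simp add: Bochner_Integration.integral_diff[OF if1 if2] right_diff_distrib[symmetric] abs_mult)
    also have "\<dots> \<le> g t * (\<integral>\<omega>. L * d * indicator ?P \<omega> + 2 * B * indicator ?m \<omega> \<partial>M)"
    proof (rule mult_left_mono[OF _ g0])
      have "\<bar>\<integral>\<omega>. f (rescaled t \<omega>) - f (interpolate n (X t \<omega>)) \<partial>M\<bar> \<le>
          (\<integral>\<omega>. \<bar>f (rescaled t \<omega>) - f (interpolate n (X t \<omega>))\<bar> \<partial>M)" by (rule integral_abs_bound)
      also have "\<dots> \<le> (\<integral>\<omega>. L * d * indicator ?P \<omega> + 2 * B * indicator ?m \<omega> \<partial>M)"
        by (rule integral_mono[OF _ iP pw])
          (rule integrable_abs[OF Bochner_Integration.integrable_diff[OF if1 if2]])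
      finally show "\<bar>\<integral>\<omega>. f (rescaled t \<omega>) - f (interpolate n (X t \<omega>)) \<partial>M\<bar> \<le> \<dots>" .
    qed
    also have "(\<integral>\<omega>. L * d * indicator ?P \<omega> + 2 * B * indicator ?m \<omega> \<partial>M) = L * d * prob ?P + 2 * B * prob ?m"
      using P mm by (subst Bochner_Integration.integral_add) (simp_all add: integrable_indicator_iff emeasure_eq_measure)
    also have "g t * (L * d * prob ?P + 2 * B * prob ?m) = L * d * (g t * prob ?P) + 2 * B * (g t * prob ?m)"
      by (simp add: algebra_simps)
    also have "\<dots> \<le> L * d * b + 2 * B * e'"
      using elim(1,3) L0 B0 d(1) by (intro add_mono mult_left_mono) auto
    finally have "\<bar>g t * (\<integral>\<omega>. f (rescaled t \<omega>) \<partial>M) - g t * (\<integral>\<omega>. f (interpolate n (X t \<omega>)) \<partial>M)\<bar> \<le> e / 4 + e / 4"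
      using d(2) e'(2) by linarith
    then show ?case using elim(2) n(1) unfolding dist_real_def by linarith
  qed
qed

text \<open>
  The inf-convolutions of \<open>f\<close> are Lipschitz and increase to \<open>f\<close>. Lying between 0 and \<open>f\<close>, they inherit its support,
  so they are test functions to which \<open>Lipschitz_limit\<close> applies.
\<close>

lemma lower_limit:
  assumes f: "continuous_map C01 euclideanreal f" and f0: "\<And>x. x \<in> topspace C01 \<Longrightarrow> 0 \<le> f x"
    and B: "\<And>x. x \<in> topspace C01 \<Longrightarrow> f x \<le> B"
    and c: "0 < c" and z: "\<And>x. x \<in> topspace C01 \<Longrightarrow> f x \<noteq> 0 \<Longrightarrow> c \<le> sup_norm x" and e: "0 < e"
  shows "eventually (\<lambda>t. (\<integral>x. f x \<partial>\<mu>) - e < g t * (\<integral>\<omega>. f (rescaled t \<omega>) \<partial>M)) at_top"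
proof -
  have ms: "mspace C01_metric = topspace C01" by (rule mspace_C01_metric)
  have f0': "\<And>x. x \<in> mspace C01_metric \<Longrightarrow> 0 \<le> f x" unfolding ms by (rule f0)
  define h where "h k = inf_convolution C01_metric (real k) f" for k
  have h0: "0 \<le> h k x" and hf: "h k x \<le> f x" if "x \<in> topspace C01" for k x
    unfolding h_def using that
    by (auto simp only: ms intro!: inf_convolution_nonneg[OF f0'] inf_convolution_le[OF f0'] of_nat_0_le_iff)
  have hL: "\<bar>h k x - h k y\<bar> \<le> real k * mdist C01_metric x y" if xy: "x \<in> topspace C01" "y \<in> topspace C01" for k x y
  proof -
    have "h k x \<le> h k y + real k * mdist C01_metric x y" "h k y \<le> h k x + real k * mdist C01_metric y x"
      unfolding h_def using xy
      by (auto simp only: ms intro!: inf_convolution_Lipschitz[OF f0'] of_nat_0_le_iff)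
    then show ?thesis unfolding mdist_commute[of C01_metric y x] by linarith
  qed
  have hc: "continuous_map C01 euclideanreal (h k)" for k
    unfolding C01_eq h_def by (rule continuous_inf_convolution[OF f0']) simp_all
  have hB: "\<bar>h k x\<bar> \<le> B" if "x \<in> topspace C01" for k x using h0[OF that, of k] hf[OF that, of k] B[OF that] by linarith
  have hz: "c \<le> sup_norm x" if "x \<in> topspace C01" "h k x \<noteq> 0" for k x
    using h0[OF that(1), of k] hf[OF that(1), of k] that by (intro z) auto
  have fB: "\<bar>f x\<bar> \<le> B" if "x \<in> topspace C01" for x using f0[OF that] B[OF that] by linarith
  have "(\<lambda>k. \<integral>x. h k x \<partial>\<mu>) \<longlonglongrightarrow> (\<integral>x. f x \<partial>\<mu>)"
  proof (rule integral_dominated_convergence[where w = f])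
    show "integrable \<mu> f" by (rule integrable_\<mu>[OF f fB c z])
    then show "f \<in> borel_measurable \<mu>" by (rule borel_measurable_integrable)
    show "h k \<in> borel_measurable \<mu>" for k
      by (rule borel_measurable_integrable[OF integrable_\<mu>[OF hc hB c hz]])
    show "AE x in \<mu>. norm (h k x) \<le> f x" for k
    proof (rule AE_I2)
      fix x assume "x \<in> space \<mu>"
      then have "x \<in> topspace C01" by (simp add: \<mu>_def)
      from h0[OF this, of k] hf[OF this, of k] show "norm (h k x) \<le> f x" by simp
    qed
    show "AE x in \<mu>. (\<lambda>k. h k x) \<longlonglongrightarrow> f x"
    proof (rule AE_I2)
      fix x assume "x \<in> space \<mu>"
      then have x: "x \<in> mspace C01_metric" unfolding ms by (simp add: \<mu>_def)
      show "(\<lambda>k. h k x) \<longlonglongrightarrow> f x"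
        unfolding h_def by (rule inf_convolution_tendsto[OF f0' x f[unfolded C01_eq]])
    qed
  qed
  then have "eventually (\<lambda>k. dist (\<integral>x. h k x \<partial>\<mu>) (\<integral>x. f x \<partial>\<mu>) < e / 2) sequentially"
    by (rule tendstoD) (use e in simp)
  then obtain k where k: "dist (\<integral>x. h k x \<partial>\<mu>) (\<integral>x. f x \<partial>\<mu>) < e / 2"
    by (auto dest: eventually_happens)
  have "((\<lambda>t. g t * (\<integral>\<omega>. h k (rescaled t \<omega>) \<partial>M)) \<longlongrightarrow> (\<integral>x. h k x \<partial>\<mu>)) at_top"
    by (rule Lipschitz_limit[OF hL of_nat_0_le_iff hB c hz])
  then have "eventually (\<lambda>t. dist (g t * (\<integral>\<omega>. h k (rescaled t \<omega>) \<partial>M)) (\<integral>x. h k x \<partial>\<mu>) < e / 2) at_top"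
    by (rule tendstoD) (use e in simp)
  then show ?thesis using eventually_gt_at_top[of 0]
  proof eventually_elim
    case (elim t)
    have "(\<integral>\<omega>. h k (rescaled t \<omega>) \<partial>M) \<le> (\<integral>\<omega>. f (rescaled t \<omega>) \<partial>M)"
    proof (rule integral_mono)
      show "integrable M (\<lambda>\<omega>. h k (rescaled t \<omega>))" by (rule integrable_rescaled[OF hc hB])
      show "integrable M (\<lambda>\<omega>. f (rescaled t \<omega>))" by (rule integrable_rescaled[OF f fB])
    qed (rule hf[OF scale_C01[OF path_space]])
    then have "g t * (\<integral>\<omega>. h k (rescaled t \<omega>) \<partial>M) \<le> g t * (\<integral>\<omega>. f (rescaled t \<omega>) \<partial>M)"
      using normalising_nonneg[OF norming, of t] elim(2) by (intro mult_left_mono) auto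
    then show ?case using elim(1) k unfolding dist_real_def by linarith
  qed
qed

text \<open>
  \<open>H\<close> is a Lipschitz test function that dominates \<open>\<bar>f\<bar>\<close>. Since its integrals converge, the lower bound for
  \<open>F + H \<ge> 0\<close> yields a lower bound for \<open>F\<close>; with \<open>F = f\<close> and \<open>F = - f\<close> it gives both halves of the limit.
\<close>

theorem convergence: "tail_convergence M \<xi> C01 (scale_on {0..1}) sup_norm g \<mu>"
  unfolding tail_convergence_def
proof (intro allI impI)
  fix f :: "(real \<Rightarrow> real) \<Rightarrow> real" and B c :: real
  assume f: "continuous_map C01 euclideanreal f" and "\<forall>x\<in>topspace C01. \<bar>f x\<bar> \<le> B" and c: "0 < c"
    and "\<forall>x\<in>topspace C01. f x \<noteq> 0 \<longrightarrow> c \<le> sup_norm x"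
  then have B: "\<And>x. x \<in> topspace C01 \<Longrightarrow> \<bar>f x\<bar> \<le> B"
    and z: "\<And>x. x \<in> topspace C01 \<Longrightarrow> f x \<noteq> 0 \<Longrightarrow> c \<le> sup_norm x" by auto
  have B0: "0 \<le> B" using B[OF interpolate_C01] by (meson abs_ge_zero order_trans)
  define H where "H x = B * min 1 (max 0 (2 / c * sup_norm x - 1))" for x
  have H: "continuous_map C01 euclideanreal H"
    unfolding H_def by (intro continuous_intros continuous_sup_norm continuous_map_real_min continuous_map_real_max) auto
  have HB: "0 \<le> H x" "H x \<le> B" for x
    using B0 mult_left_mono[of "min 1 (max 0 (2 / c * sup_norm x - 1))" 1 B] by (auto simp: H_def)
  have Hz: "c / 2 \<le> sup_norm x" if "H x \<noteq> 0" for x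
  proof (rule ccontr)
    assume "\<not> ?thesis"
    then have "2 / c * sup_norm x \<le> 1" using c by (simp add: field_simps)
    then show False using that by (simp add: H_def)
  qed
  have H1: "\<bar>f x\<bar> \<le> H x" if "x \<in> topspace C01" for x
  proof (cases "f x = 0")
    case False
    from z[OF that this] have "1 \<le> 2 / c * sup_norm x - 1" using c by (simp add: field_simps)
    then have "H x = B" by (simp add: H_def)
    then show ?thesis using B[OF that] by simp
  qed (use HB in simp)
  have HL: "\<bar>H x - H y\<bar> \<le> (B * (2 / c)) * mdist C01_metric x y" if xy: "x \<in> topspace C01" "y \<in> topspace C01" for x y
  proof -
    let ?r = "\<lambda>v. min 1 (max 0 (v - 1)) :: real"
    have "\<bar>sup_norm x - sup_norm y\<bar> \<le> mdist C01_metric x y"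
      using sup_norm_Lipschitz[OF xy] sup_norm_Lipschitz[OF xy(2,1)] mdist_commute[of C01_metric x y] by linarith
    then have "2 / c * \<bar>sup_norm x - sup_norm y\<bar> \<le> 2 / c * mdist C01_metric x y" using c by (intro mult_left_mono) auto
    moreover have "2 / c * \<bar>sup_norm x - sup_norm y\<bar> = \<bar>2 / c * sup_norm x - 2 / c * sup_norm y\<bar>"
      using c unfolding right_diff_distrib[symmetric] abs_mult by simp
    moreover have "\<bar>?r a - ?r b\<bar> \<le> \<bar>a - b\<bar>" for a b by linarith
    note this[of "2 / c * sup_norm x" "2 / c * sup_norm y"]
    ultimately have "\<bar>?r (2 / c * sup_norm x) - ?r (2 / c * sup_norm y)\<bar> \<le> 2 / c * mdist C01_metric x y"
      by (simp only:)
    then have "B * \<bar>?r (2 / c * sup_norm x) - ?r (2 / c * sup_norm y)\<bar> \<le> B * (2 / c * mdist C01_metric x y)"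
      by (rule mult_left_mono[OF _ B0])
    moreover have "\<bar>H x - H y\<bar> = B * \<bar>?r (2 / c * sup_norm x) - ?r (2 / c * sup_norm y)\<bar>"
      unfolding H_def right_diff_distrib[symmetric] using B0 by (simp add: abs_mult)
    ultimately show ?thesis by (simp add: mult.assoc)
  qed
  have HB': "\<bar>H x\<bar> \<le> B" for x using HB[of x] by linarith
  have c2: "0 < c / 2" using c by simp
  have limH: "((\<lambda>t. g t * (\<integral>\<omega>. H (rescaled t \<omega>) \<partial>M)) \<longlongrightarrow> (\<integral>x. H x \<partial>\<mu>)) at_top"
    by (rule Lipschitz_limit[OF HL _ HB' c2 Hz]) (use B0 c in auto)
  have iH: "integrable \<mu> H" by (rule integrable_\<mu>[OF H HB' c2 Hz])
  have lower: "eventually (\<lambda>t. (\<integral>x. F x \<partial>\<mu>) - e < g t * (\<integral>\<omega>. F (rescaled t \<omega>) \<partial>M)) at_top"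
    if F: "continuous_map C01 euclideanreal F" and FH: "\<And>x. x \<in> topspace C01 \<Longrightarrow> \<bar>F x\<bar> \<le> H x" and e: "0 < e"
    for F and e :: real
  proof -
    have FB: "\<bar>F x\<bar> \<le> B" if "x \<in> topspace C01" for x using FH[OF that] HB[of x] by linarith
    have Fz: "c / 2 \<le> sup_norm x" if "x \<in> topspace C01" "F x \<noteq> 0" for x
      using FH[OF that(1)] that(2) by (intro Hz) auto
    have iF: "integrable \<mu> F" by (rule integrable_\<mu>[OF F FB c2 Fz])
    have "eventually (\<lambda>t. (\<integral>x. F x + H x \<partial>\<mu>) - e / 2 < g t * (\<integral>\<omega>. F (rescaled t \<omega>) + H (rescaled t \<omega>) \<partial>M)) at_top"
    proof (rule lower_limit[OF _ _ _ c2])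
      show "continuous_map C01 euclideanreal (\<lambda>x. F x + H x)" by (intro continuous_intros F H)
      fix x assume x: "x \<in> topspace C01"
      show "0 \<le> F x + H x" "F x + H x \<le> 2 * B" using FH[OF x] FB[OF x] HB[of x] by linarith+
      show "c / 2 \<le> sup_norm x" if "F x + H x \<noteq> 0"
        using that FH[OF x] by (intro Hz) auto
    qed (use e in simp)
    moreover have "eventually (\<lambda>t. dist (g t * (\<integral>\<omega>. H (rescaled t \<omega>) \<partial>M)) (\<integral>x. H x \<partial>\<mu>) < e / 2) at_top"
      by (rule tendstoD[OF limH]) (use e in simp)
    ultimately show ?thesis
    proof eventually_elim
      case (elim t)
      have "(\<integral>x. F x + H x \<partial>\<mu>) = (\<integral>x. F x \<partial>\<mu>) + (\<integral>x. H x \<partial>\<mu>)"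
        by (rule Bochner_Integration.integral_add[OF iF iH])
      moreover have "(\<integral>\<omega>. F (rescaled t \<omega>) + H (rescaled t \<omega>) \<partial>M) =
          (\<integral>\<omega>. F (rescaled t \<omega>) \<partial>M) + (\<integral>\<omega>. H (rescaled t \<omega>) \<partial>M)"
        by (rule Bochner_Integration.integral_add[OF integrable_rescaled[OF F FB] integrable_rescaled[OF H HB']])
      ultimately show ?case using elim unfolding dist_real_def by (simp only: distrib_left)
    qed
  qed
  show "((\<lambda>t. g t * (\<integral>\<omega>. f (rescaled t \<omega>) \<partial>M)) \<longlongrightarrow> (\<integral>x. f x \<partial>\<mu>)) at_top"
  proof (rule tendstoI)
    fix e :: real assume e: "0 < e"
    have "continuous_map C01 euclideanreal (\<lambda>x. - f x)" by (intro continuous_intros f)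
    from lower[OF this _ e] H1
    have "eventually (\<lambda>t. - (\<integral>x. f x \<partial>\<mu>) - e < - (g t * (\<integral>\<omega>. f (rescaled t \<omega>) \<partial>M))) at_top" by simp
    moreover have "eventually (\<lambda>t. (\<integral>x. f x \<partial>\<mu>) - e < g t * (\<integral>\<omega>. f (rescaled t \<omega>) \<partial>M)) at_top"
      by (rule lower[OF f H1 e])
    ultimately show "eventually (\<lambda>t. dist (g t * (\<integral>\<omega>. f (rescaled t \<omega>) \<partial>M)) (\<integral>x. f x \<partial>\<mu>) < e) at_top"
      by eventually_elim (simp add: dist_real_def abs_less_iff)
  qed
qed

end

section \<open>Projections of the limit measure\<close>

text \<open>
  On \<^term>\<open>topspace (Rm m)\<close> the coordinates outside \<open>{..<m}\<close> are constant, equal to \<^const>\<open>undefined\<close>. The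
  embedding into all real sequences gives access to the metric of that type.
\<close>

lemma continuous_Rm_inclusion: "continuous_map (Rm m) euclidean (\<lambda>y. y)"
proof -
  have "continuous_map (Rm m) euclideanreal (\<lambda>y. y i)" for i
  proof (cases "i < m")
    case False
    have "continuous_map (Rm m) euclideanreal (\<lambda>y. undefined)" by simp
    then show ?thesis
      by (rule continuous_map_eq) (use False in \<open>auto simp: topspace_Rm extensional_def\<close>)
  qed (rule continuous_Rm_coord)
  then have "continuous_map (Rm m) (product_topology (\<lambda>_. euclideanreal) UNIV) (\<lambda>y. y)"
    unfolding continuous_map_componentwise_UNIV by blast
  then show ?thesis by (simp add: euclidean_product_topology)
qed

lemma continuous_restrict_Rm: "continuous_map euclidean (Rm m) (\<lambda>y. restrict y {..<m})"
  unfolding Rm_def continuous_map_componentwise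
proof (intro conjI ballI)
  fix i assume "i \<in> {..<m}"
  then show "continuous_map euclidean euclideanreal (\<lambda>y :: nat \<Rightarrow> real. restrict y {..<m} i)"
    using continuous_on_coord[of UNIV i] by simp
qed auto

lemma Rm_measures_agree:
  assumes m: "0 < m" and s: "sets N1 = sets (borel_of (Rm m))" "sets N2 = sets (borel_of (Rm m))"
    and f1: "\<And>c. 0 < c \<Longrightarrow> emeasure N1 {y \<in> topspace (Rm m). c \<le> max_norm m y} < \<infinity>"
    and f2: "\<And>c. 0 < c \<Longrightarrow> emeasure N2 {y \<in> topspace (Rm m). c \<le> max_norm m y} < \<infinity>"
    and eq: "\<And>f c. continuous_map (Rm m) euclideanreal f \<Longrightarrow> (\<And>y. \<bar>f y\<bar> \<le> 1) \<Longrightarrow> 0 < c \<Longrightarrow>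
      (\<And>y. f y \<noteq> 0 \<Longrightarrow> c \<le> max_norm m y) \<Longrightarrow> (\<integral>y. f y \<partial>N1) = (\<integral>y. f y \<partial>N2)"
    and A: "A \<in> sets (borel_of (Rm m))" "A \<in> Rm_ideal m"
  shows "emeasure N1 A = emeasure N2 A"
proof -
  obtain c where c: "0 < c" "\<And>y. y \<in> A \<Longrightarrow> c \<le> max_norm m y"
    using A(2) unfolding Rm_ideal_def in_ideal_away_iff by blast
  have At: "A \<subseteq> topspace (Rm m)" using A(1) sets.sets_into_space by fastforce
  let ?G = "exceed {..<m} (c / 2)"
  let ?D = "\<lambda>N. distr N borel (\<lambda>y. y) :: (nat \<Rightarrow> real) measure"
  have im: "(\<lambda>y. y) \<in> N \<rightarrow>\<^sub>M (borel :: (nat \<Rightarrow> real) measure)" if "sets N = sets (borel_of (Rm m))" for N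
    using continuous_map_borel_measurable[OF continuous_Rm_inclusion] measurable_cong_sets[OF that refl] by blast
  have G: "c / 2 < max_norm m y \<longleftrightarrow> y \<in> ?G" for y
    using less_max_norm_iff[OF m] by (auto simp: exceed_def)
  have finG: "emeasure (?D N) ?G < \<infinity>"
    if s: "sets N = sets (borel_of (Rm m))" and f: "emeasure N {y \<in> topspace (Rm m). c / 2 \<le> max_norm m y} < \<infinity>" for N
  proof -
    have sp: "space N = topspace (Rm m)" using sets_eq_imp_space_eq[OF s] by simp
    have "emeasure (?D N) ?G = emeasure N ((\<lambda>y. y) -` ?G \<inter> space N)" by (rule emeasure_distr[OF im[OF s]]) simp
    also have "\<dots> \<le> emeasure N {y \<in> topspace (Rm m). c / 2 \<le> max_norm m y}"
    proof (rule emeasure_mono)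
      show "(\<lambda>y. y) -` ?G \<inter> space N \<subseteq> {y \<in> topspace (Rm m). c / 2 \<le> max_norm m y}"
        using G sp by (auto intro: less_imp_le)
      show "{y \<in> topspace (Rm m). c / 2 \<le> max_norm m y} \<in> sets N"
        unfolding s by (rule borel_of_level[OF continuous_max_norm[OF m]])
    qed
    finally show ?thesis using f by (rule le_less_trans)
  qed
  have c2: "0 < c / 2" using c by simp
  have "density (?D N1) (indicator ?G) = density (?D N2) (indicator ?G)"
  proof (rule density_indicator_eqI_open)
    show "emeasure (?D N1) ?G < \<infinity>" by (rule finG[OF s(1) f1[OF c2]])
    show "emeasure (?D N2) ?G < \<infinity>" by (rule finG[OF s(2) f2[OF c2]])
    fix F :: "(nat \<Rightarrow> real) \<Rightarrow> real"
    assume F: "continuous_on UNIV F" "\<And>y. 0 \<le> F y \<and> F y \<le> 1" "\<And>y. y \<notin> ?G \<Longrightarrow> F y = 0"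
    have Fb: "F \<in> borel_measurable borel" by (rule borel_measurable_continuous_onI[OF F(1)])
    have "(\<integral>y. F y \<partial>N1) = (\<integral>y. F y \<partial>N2)"
    proof (rule eq[OF _ _ c2])
      show "continuous_map (Rm m) euclideanreal F"
        using continuous_map_compose[OF continuous_Rm_inclusion, of euclideanreal F m] F(1) by (simp add: comp_def)
      show "\<bar>F y\<bar> \<le> 1" for y using F(2)[of y] by linarith
      show "c / 2 \<le> max_norm m y" if "F y \<noteq> 0" for y
        using F(3)[of y] that G[of y] by linarith
    qed
    then show "(\<integral>y. F y \<partial>?D N1) = (\<integral>y. F y \<partial>?D N2)"
      using integral_distr[OF im[OF s(1)] Fb] integral_distr[OF im[OF s(2)] Fb] by simp
  qed (use open_exceed in auto)
  then have eqG: "\<And>B. B \<in> sets borel \<Longrightarrow> B \<subseteq> ?G \<Longrightarrow> emeasure (?D N1) B = emeasure (?D N2) B"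
    by (subst (asm) density_indicator_eq_iff) auto
  let ?B = "(\<lambda>y. restrict y {..<m}) -` A"
  have "(\<lambda>y. restrict y {..<m}) \<in> borel \<rightarrow>\<^sub>M borel_of (Rm m)"
    using continuous_map_measurable[OF continuous_restrict_Rm] measurable_cong_sets[OF sets_borel_of_euclidean refl] by blast
  from measurable_sets[OF this A(1)] have B: "?B \<in> sets borel" by simp
  have BG: "?B \<subseteq> ?G"
  proof
    fix y assume "y \<in> ?B"
    then have "c / 2 < max_norm m (restrict y {..<m})" using c(1) c(2)[of "restrict y {..<m}"] by simp
    then show "y \<in> ?G" unfolding less_max_norm_iff[OF m] by (auto simp: exceed_def)
  qed
  have DB: "emeasure (?D N) ?B = emeasure N A" if s: "sets N = sets (borel_of (Rm m))" for N
  proof -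
    have sp: "space N = topspace (Rm m)" using sets_eq_imp_space_eq[OF s] by simp
    have "emeasure (?D N) ?B = emeasure N ((\<lambda>y. y) -` ?B \<inter> space N)" by (rule emeasure_distr[OF im[OF s] B])
    also have "(\<lambda>y. y) -` ?B \<inter> space N = A"
    proof -
      have "restrict y {..<m} = y" if "y \<in> topspace (Rm m)" for y
        using that unfolding topspace_Rm by (rule extensional_restrict)
      then show ?thesis using At sp by auto
    qed
    finally show ?thesis .
  qed
  show ?thesis using eqG[OF B BG] unfolding DB[OF s(1)] DB[OF s(2)] .
qed

lemma max_norm_proj_le:
  assumes "set \<gamma> \<subseteq> {0..1}" "0 < length \<gamma>" "x \<in> topspace C01"
  shows "max_norm (length \<gamma>) (proj \<gamma> x) \<le> sup_norm x"
  unfolding max_norm_le_iff[OF assms(2)]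
proof (intro allI impI)
  fix i assume i: "i < length \<gamma>"
  then have "\<gamma> ! i \<in> {0..1}" using assms(1) nth_mem by blast
  from abs_le_sup_norm[OF assms(3) this] i show "\<bar>proj \<gamma> x i\<bar> \<le> sup_norm x" by (simp add: proj_def)
qed

text \<open>
  A test function on \<open>\<real>\<^sup>m\<close> composed with a projection is a test function of the path, since projections do not
  increase the norm.
\<close>

lemma proj_limit:
  assumes conv: "tail_convergence M \<xi> C01 (scale_on {0..1}) sup_norm g \<mu>"
    and \<gamma>: "set \<gamma> \<subseteq> {0..1}" "0 < length \<gamma>"
    and f: "continuous_map (Rm (length \<gamma>)) euclideanreal f"
    and B: "\<And>y. y \<in> topspace (Rm (length \<gamma>)) \<Longrightarrow> \<bar>f y\<bar> \<le> B"
    and c: "0 < c" and z: "\<And>y. y \<in> topspace (Rm (length \<gamma>)) \<Longrightarrow> f y \<noteq> 0 \<Longrightarrow> c \<le> max_norm (length \<gamma>) y"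
  shows "((\<lambda>t. g t * (\<integral>\<omega>. f (scale_on {..<length \<gamma>} (inverse t) (proj \<gamma> (\<xi> \<omega>))) \<partial>M))
    \<longlongrightarrow> (\<integral>x. f (proj \<gamma> x) \<partial>\<mu>)) at_top"
proof -
  have p: "proj \<gamma> x \<in> topspace (Rm (length \<gamma>))" for x by (simp add: topspace_Rm proj_def)
  have "((\<lambda>t. g t * (\<integral>\<omega>. (f \<circ> proj \<gamma>) (scale_on {0..1} (inverse t) (\<xi> \<omega>)) \<partial>M)) \<longlongrightarrow> (\<integral>x. (f \<circ> proj \<gamma>) x \<partial>\<mu>)) at_top"
  proof (rule tail_convergenceD[OF conv _ _ c, where B = B])
    show "continuous_map C01 euclideanreal (f \<circ> proj \<gamma>)"
      by (rule continuous_map_compose[OF continuous_proj[OF \<gamma>(1)] f])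
    show "c \<le> sup_norm x" if "x \<in> topspace C01" "(f \<circ> proj \<gamma>) x \<noteq> 0" for x
      using z[OF p, of x] that max_norm_proj_le[OF \<gamma> that(1)] by simp
  qed (use B p in simp)
  then show ?thesis by (simp only: comp_apply proj_scale[OF \<gamma>(1)])
qed

lemma emeasure_proj_level_le:
  assumes s: "sets \<mu> = sets (borel_of C01)" and \<gamma>: "set \<gamma> \<subseteq> {0..1}" "0 < length \<gamma>"
  shows "emeasure (distr \<mu> (borel_of (Rm (length \<gamma>))) (proj \<gamma>)) {y \<in> topspace (Rm (length \<gamma>)). c \<le> max_norm (length \<gamma>) y}
    \<le> emeasure \<mu> {x \<in> topspace C01. c \<le> sup_norm x}" (is "?l \<le> ?r")
proof -
  have pm: "proj \<gamma> \<in> \<mu> \<rightarrow>\<^sub>M borel_of (Rm (length \<gamma>))"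
    using continuous_map_measurable[OF continuous_proj[OF \<gamma>(1)]] measurable_cong_sets[OF s refl] by blast
  have sp: "space \<mu> = topspace C01" using sets_eq_imp_space_eq[OF s] by simp
  have "?l = emeasure \<mu> (proj \<gamma> -` {y \<in> topspace (Rm (length \<gamma>)). c \<le> max_norm (length \<gamma>) y} \<inter> space \<mu>)"
    by (rule emeasure_distr[OF pm borel_of_level[OF continuous_max_norm[OF \<gamma>(2)]]])
  also have "\<dots> \<le> ?r"
  proof (rule emeasure_mono)
    show "proj \<gamma> -` {y \<in> topspace (Rm (length \<gamma>)). c \<le> max_norm (length \<gamma>) y} \<inter> space \<mu> \<subseteq> {x \<in> topspace C01. c \<le> sup_norm x}"
      unfolding sp using max_norm_proj_le[OF \<gamma>] by (auto intro: order_trans)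
    show "{x \<in> topspace C01. c \<le> sup_norm x} \<in> sets \<mu>" unfolding s by (rule borel_of_level[OF continuous_sup_norm])
  qed
  finally show ?thesis .
qed

proposition projection_of_limit:
  assumes conv: "tail_convergence M \<xi> C01 (scale_on {0..1}) sup_norm g \<mu>"
    and s: "sets \<mu> = sets (borel_of C01)"
    and fin: "\<And>c. 0 < c \<Longrightarrow> emeasure \<mu> {x \<in> topspace C01. c \<le> sup_norm x} < \<infinity>"
    and \<gamma>: "\<gamma> \<in> \<Gamma>_above \<gamma>\<^sub>0" and RV: "RV_Rm (length \<gamma>) M (\<lambda>\<omega>. proj \<gamma> (\<xi> \<omega>)) g \<nu>"
  shows "is_projection \<gamma> \<mu> \<nu>"
  unfolding is_projection_def
proof
  note \<gamma>' = \<Gamma>_above_subset[OF \<gamma>]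
  note D = RV_RmD[OF RV \<gamma>'(2)]
  have pm: "proj \<gamma> \<in> \<mu> \<rightarrow>\<^sub>M borel_of (Rm (length \<gamma>))"
    using continuous_map_measurable[OF continuous_proj[OF \<gamma>'(1)]] measurable_cong_sets[OF s refl] by blast
  fix A assume A: "A \<in> sets (borel_of (Rm (length \<gamma>))) \<inter> Rm_ideal (length \<gamma>)"
  show "emeasure \<nu> A = emeasure (distr \<mu> (borel_of (Rm (length \<gamma>))) (proj \<gamma>)) A"
  proof (rule Rm_measures_agree[OF \<gamma>'(2) D(3)])
    show "emeasure (distr \<mu> (borel_of (Rm (length \<gamma>))) (proj \<gamma>)) {y \<in> topspace (Rm (length \<gamma>)). c \<le> max_norm (length \<gamma>) y} < \<infinity>"
      if "0 < c" for c
      using emeasure_proj_level_le[OF s \<gamma>'] fin[OF that] by (rule le_less_trans)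
    fix f :: "(nat \<Rightarrow> real) \<Rightarrow> real" and c :: real
    assume f: "continuous_map (Rm (length \<gamma>)) euclideanreal f" and B: "\<And>y. \<bar>f y\<bar> \<le> 1" and c: "0 < c"
      and z: "\<And>y. f y \<noteq> 0 \<Longrightarrow> c \<le> max_norm (length \<gamma>) y"
    have "(\<integral>y. f y \<partial>\<nu>) = (\<integral>x. f (proj \<gamma> x) \<partial>\<mu>)"
      by (rule tendsto_unique[OF trivial_limit_at_top_linorder tail_convergenceD[OF D(5) f B c z]
            proj_limit[OF conv \<gamma>' f B c z]])
    then show "(\<integral>y. f y \<partial>\<nu>) = (\<integral>y. f y \<partial>distr \<mu> (borel_of (Rm (length \<gamma>))) (proj \<gamma>))"
      using integral_distr[OF pm continuous_map_borel_measurable[OF f]] by simp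
  qed (use A D(4) in auto)
qed

section \<open>Regular variation on the half-line\<close>

text \<open>
  Additivity gives \<open>L (i v) = i L v\<close> for integers \<open>i\<close>; monotonicity squeezes \<open>k L v\<close> between the values at the
  two integers next to \<open>k v\<close>.
\<close>

lemma additive_nonneg_linear:
  fixes L :: "real \<Rightarrow> real"
  assumes add: "\<And>v w. L (v + w) = L v + L w" and mono: "\<And>v. 0 \<le> v \<Longrightarrow> 0 \<le> L v"
  shows "L v = v * L 1"
proof -
  have L0: "L 0 = 0" using add[of 0 0] by simp
  have neg: "L (- v) = - L v" for v using add[of v "- v"] L0 by simp
  have nat: "L (real n * v) = real n * L v" for n v
    by (induction n) (simp_all add: L0 add distrib_right)
  have int: "L (of_int i * v) = of_int i * L v" for i v
  proof (cases "0 \<le> i")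
    case True
    then show ?thesis using nat[of "nat i" v] by simp
  next
    case False
    then show ?thesis using nat[of "nat (- i)" v] neg[of "real (nat (- i)) * v"] by simp
  qed
  have L_mono: "L v \<le> L w" if "v \<le> w" for v w
    using mono[of "w - v"] add[of v "w - v"] that by simp
  have "\<bar>L v - v * L 1\<bar> \<le> L 1 / real (Suc k)" for k
  proof -
    let ?k = "real (Suc k)"
    let ?n = "\<lfloor>?k * v\<rfloor>"
    have b: "of_int ?n \<le> ?k * v" "?k * v \<le> of_int (?n + 1)" by linarith+
    have "of_int ?n * L 1 \<le> ?k * L v"
      using L_mono[OF b(1)] int[of ?n 1] nat[of "Suc k" v] by simp
    moreover have "?k * L v \<le> of_int (?n + 1) * L 1"
      using L_mono[OF b(2)] int[of "?n + 1" 1] nat[of "Suc k" v] by simp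
    moreover have "of_int ?n * L 1 \<le> ?k * v * L 1" "?k * v * L 1 \<le> of_int (?n + 1) * L 1"
      using b mono[of 1] by (intro mult_right_mono; simp)+
    ultimately have "\<bar>?k * L v - ?k * v * L 1\<bar> \<le> L 1"
      by (simp add: distrib_right abs_le_iff del: of_nat_Suc)
    moreover have "?k * L v - ?k * v * L 1 = ?k * (L v - v * L 1)" by (simp add: right_diff_distrib)
    ultimately have "?k * \<bar>L v - v * L 1\<bar> \<le> L 1" by (simp add: abs_mult del: of_nat_Suc)
    then show ?thesis by (simp add: pos_le_divide_eq mult.commute del: of_nat_Suc)
  qed
  moreover have "(\<lambda>k. L 1 / real (Suc k)) \<longlonglongrightarrow> 0"
    by (rule LIMSEQ_Suc[OF lim_const_over_n])
  ultimately have "\<bar>L v - v * L 1\<bar> \<le> 0"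
    using LIMSEQ_le_const by blast
  then show ?thesis by simp
qed

lemma multiplicative_powr:
  fixes \<psi> :: "real \<Rightarrow> real"
  assumes pos: "\<And>s. 0 < s \<Longrightarrow> 0 < \<psi> s" and mult: "\<And>s t. 0 < s \<Longrightarrow> 0 < t \<Longrightarrow> \<psi> (s * t) = \<psi> s * \<psi> t"
    and ge: "\<And>s. 1 \<le> s \<Longrightarrow> 1 \<le> \<psi> s"
  obtains \<alpha> where "0 \<le> \<alpha>" "\<And>s. 0 < s \<Longrightarrow> \<psi> s = s powr \<alpha>"
proof -
  define L where "L v = ln (\<psi> (exp v))" for v
  have lin: "L v = v * L 1" for v
  proof (rule additive_nonneg_linear)
    show "L (v + w) = L v + L w" for v w
      using pos[of "exp v"] pos[of "exp w"] by (simp add: L_def exp_add mult ln_mult_pos)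
    show "0 \<le> L v" if "0 \<le> v" for v using ge[of "exp v"] that by (simp add: L_def)
  qed
  show thesis
  proof (rule that[of "L 1"])
    show "0 \<le> L 1" using ge[of "exp 1"] by (simp add: L_def)
    fix s :: real assume s: "0 < s"
    have "ln (\<psi> s) = ln s * L 1" using lin[of "ln s"] s by (simp add: L_def)
    then have "exp (ln (\<psi> s)) = exp (ln s * L 1)" by simp
    then show "\<psi> s = s powr L 1" using pos[OF s] s by (simp add: powr_def mult.commute)
  qed
qed

text \<open>
  A continuous monotone substitute for the indicator of \<open>{a<..}\<close>, equal to 1 from \<open>2 a\<close> on.
\<close>

definition ramp :: "real \<Rightarrow> real \<Rightarrow> real" where
  "ramp a r = max 0 (min 1 (r / a - 1))"

lemma ramp_bounds: "0 \<le> ramp a r" "ramp a r \<le> 1" "\<bar>ramp a r\<bar> \<le> 1"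
  by (auto simp: ramp_def)

lemma continuous_ramp: "continuous_on UNIV (ramp a)"
  unfolding ramp_def divide_inverse by (intro continuous_intros)

lemma ramp_support: "0 < a \<Longrightarrow> ramp a r \<noteq> 0 \<Longrightarrow> a \<le> r"
  by (auto simp: ramp_def max_def min_def field_simps split: if_splits)

lemma ramp_eq_1: "0 < a \<Longrightarrow> 2 * a \<le> r \<Longrightarrow> ramp a r = 1"
  by (simp add: ramp_def field_simps)

lemma ramp_scale: "0 < s \<Longrightarrow> ramp a (inverse s * r) = ramp (a * s) r"
  by (simp add: ramp_def field_simps)

lemma ramp_antimono:
  assumes "0 < a" "a \<le> b" shows "ramp b r \<le> ramp a r"
proof (cases "0 \<le> r")
  case True
  then have "r / b \<le> r / a" using assms by (intro divide_left_mono) auto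
  then show ?thesis unfolding ramp_def by linarith
next
  case False
  then have "ramp b r = 0" using ramp_support[of b r] assms by fastforce
  then show ?thesis using ramp_bounds by simp
qed

text \<open>
  \<open>E t f\<close> stands for the expectation of \<open>f (R / t)\<close> for a random variable \<open>R\<close>; the arguments
  below know \<open>R\<close> through the scaling law and the limits only.
\<close>

locale real_tail =
  fixes E :: "real \<Rightarrow> (real \<Rightarrow> real) \<Rightarrow> real" and g :: "real \<Rightarrow> real" and N :: "real measure"
  assumes g_top: "filterlim g at_top at_top"
    and sets_N: "sets N = sets borel"
    and N_finite: "\<And>c. 0 < c \<Longrightarrow> emeasure N {c..} < \<infinity>"
    and N_nontrivial: "\<exists>c>0. 0 < emeasure N {c..}"
    and E_scale: "\<And>t s f. 0 < t \<Longrightarrow> 0 < s \<Longrightarrow> E (s * t) f = E t (\<lambda>r. f (inverse s * r))"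
    and E_limit: "\<And>f B c. continuous_on UNIV f \<Longrightarrow> (\<And>r. \<bar>f r\<bar> \<le> B) \<Longrightarrow> 0 < c \<Longrightarrow> (\<And>r. f r \<noteq> 0 \<Longrightarrow> c \<le> r) \<Longrightarrow>
      ((\<lambda>t. g t * E t f) \<longlongrightarrow> (\<integral>r. f r \<partial>N)) at_top"
begin

lemma integrable_test:
  fixes f :: "real \<Rightarrow> real"
  assumes "f \<in> borel_measurable borel" "\<And>r. \<bar>f r\<bar> \<le> B" "0 < c" "\<And>r. f r \<noteq> 0 \<Longrightarrow> c \<le> r"
  shows "integrable N f"
proof (rule integrable_bounded_support[where B = B and G = "{c..}"])
  show "f \<in> borel_measurable N" using assms(1) measurable_cong_sets[OF sets_N refl] by blast
  show "f r = 0" if "r \<notin> {c..}" for r using assms(4)[of r] that by auto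
qed (use assms N_finite sets_N in auto)

lemma integrable_ramp: "0 < a \<Longrightarrow> integrable N (ramp a)"
  using ramp_bounds(3) ramp_support
  by (intro integrable_test[where c = a and B = 1] borel_measurable_continuous_onI continuous_ramp) auto

abbreviation J :: "real \<Rightarrow> real" where "J a \<equiv> \<integral>r. ramp a r \<partial>N"

lemma ramp_limit: "0 < a \<Longrightarrow> ((\<lambda>t. g t * E t (ramp a)) \<longlongrightarrow> J a) at_top"
  by (rule E_limit[OF continuous_ramp ramp_bounds(3) _ ramp_support])

lemma J_antimono: "0 < a \<Longrightarrow> a \<le> b \<Longrightarrow> J b \<le> J a"
  by (intro integral_mono integrable_ramp ramp_antimono) auto

lemma J_pos: obtains a where "0 < a" "0 < J a"
proof -
  obtain c where c: "0 < c" "0 < emeasure N {c..}" using N_nontrivial by blast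
  have fin: "emeasure N {c..} < \<infinity>" by (rule N_finite[OF c(1)])
  have "0 < measure N {c..}"
    using c(2) fin by (simp add: measure_def enn2real_positive_iff)
  also have "measure N {c..} = (\<integral>r. indicator {c..} r \<partial>N)" using sets_N by simp
  also have "\<dots> \<le> J (c / 2)"
  proof (rule integral_mono)
    show "integrable N (indicator {c..} :: real \<Rightarrow> real)" using sets_N fin by (simp add: integrable_indicator_iff)
    show "integrable N (ramp (c / 2))" by (rule integrable_ramp) (use c in simp)
    show "indicator {c..} r \<le> ramp (c / 2) r" for r
      using ramp_eq_1[of "c / 2" r] ramp_bounds(1)[of "c / 2" r] c(1) by (auto simp: indicator_def)
  qed
  finally show thesis using c(1) by (intro that[of "c / 2"]) auto
qed

lemma scaling_at_top: "0 < s \<Longrightarrow> filterlim (\<lambda>t. s * t :: real) at_top at_top"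
  by (rule filterlim_tendsto_pos_mult_at_top[OF tendsto_const _ filterlim_ident])

lemma g_pos: "eventually (\<lambda>t. 0 < g t) at_top"
  using g_top by (simp add: filterlim_at_top_dense)

text \<open>
  The expectation at time \<open>s t\<close> can be normalised by \<open>g (s t)\<close> as well as by \<open>g t\<close>, as it is also the expectation of
  a rescaled ramp at time \<open>t\<close>. The quotient of the two limits is the limit of \<open>g (s t) / g t\<close>. For \<open>s \<le> 1\<close> the
  denominator is positive by monotonicity of the ramps.
\<close>

lemma ratio_limit_small:
  assumes a: "0 < a" "0 < J a" and s: "0 < s" "s \<le> 1"
  shows "((\<lambda>t. g (s * t) / g t) \<longlongrightarrow> J a / J (a * s)) at_top"
proof -
  have as: "0 < a * s" using a s by simp
  have Jas: "0 < J (a * s)" using J_antimono[OF as, of a] a s by (simp add: mult_left_le)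
  have 1: "((\<lambda>t. g (s * t) * E (s * t) (ramp a)) \<longlongrightarrow> J a) at_top"
    using filterlim_compose[OF ramp_limit[OF a(1)] scaling_at_top[OF s(1)]] .
  have 2: "((\<lambda>t. g t * E t (ramp (a * s))) \<longlongrightarrow> J (a * s)) at_top" by (rule ramp_limit[OF as])
  have "eventually (\<lambda>t. 0 < g t * E t (ramp (a * s))) at_top" by (rule order_tendstoD(1)[OF 2 Jas])
  then have "eventually (\<lambda>t. (g (s * t) * E (s * t) (ramp a)) / (g t * E t (ramp (a * s))) = g (s * t) / g t) at_top"
    using eventually_gt_at_top[of 0]
  proof eventually_elim
    case (elim t)
    have "E (s * t) (ramp a) = E t (ramp (a * s))"
      using E_scale[OF elim(2) s(1), of "ramp a"] by (simp add: ramp_scale[OF s(1)])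
    then show ?case using elim(1) by auto
  qed
  moreover have "((\<lambda>t. (g (s * t) * E (s * t) (ramp a)) / (g t * E t (ramp (a * s)))) \<longlongrightarrow> J a / J (a * s)) at_top"
    by (rule tendsto_divide[OF 1 2]) (use Jas in simp)
  ultimately show ?thesis using tendsto_cong by fast
qed

text \<open>
  Values \<open>s > 1\<close> reduce to \<open>1 / s\<close> by taking reciprocals.
\<close>

lemma ratio_limit:
  assumes s: "0 < s" shows "\<exists>l>0. ((\<lambda>t. g (s * t) / g t) \<longlongrightarrow> l) at_top \<and> (1 \<le> s \<longrightarrow> 1 \<le> l)"
proof -
  obtain a where a: "0 < a" "0 < J a" by (rule J_pos)
  have small: "0 < J a / J (a * s)" "J a / J (a * s) \<le> 1" if "0 < s" "s \<le> 1" for s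
  proof -
    have "J a \<le> J (a * s)" using J_antimono[of "a * s" a] a that by (simp add: mult_left_le)
    then show "0 < J a / J (a * s)" "J a / J (a * s) \<le> 1" using a by simp_all
  qed
  show ?thesis
  proof (cases "s \<le> 1")
    case True
    have "s = 1 \<Longrightarrow> 1 \<le> J a / J (a * s)" using a by simp
    then show ?thesis using ratio_limit_small[OF a s True] small[OF s True] True
      by (intro exI[of _ "J a / J (a * s)"]) auto
  next
    case False
    define q where "q = 1 / s"
    have q: "0 < q" "q \<le> 1" using False s by (auto simp: q_def)
    let ?l = "J a / J (a * q)"
    have "((\<lambda>t. g (q * (s * t)) / g (s * t)) \<longlongrightarrow> ?l) at_top"
      using filterlim_compose[OF ratio_limit_small[OF a q] scaling_at_top[OF s]] .
    then have "((\<lambda>t. g t / g (s * t)) \<longlongrightarrow> ?l) at_top" using s by (simp add: q_def)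
    then have "((\<lambda>t. inverse (g t / g (s * t))) \<longlongrightarrow> inverse ?l) at_top"
      by (rule tendsto_inverse) (use small(1)[OF q] in auto)
    then have "((\<lambda>t. g (s * t) / g t) \<longlongrightarrow> inverse ?l) at_top" by simp
    moreover have "0 < inverse ?l" "1 \<le> inverse ?l"
      using small[OF q] by (simp_all only: positive_imp_inverse_positive one_le_inverse)
    ultimately show ?thesis by blast
  qed
qed

lemma regular_variation_exponent:
  obtains \<alpha> where "0 \<le> \<alpha>" "regularly_varying g \<alpha>"
proof -
  obtain \<psi> where \<psi>: "\<And>s. 0 < s \<Longrightarrow> 0 < \<psi> s \<and> ((\<lambda>t. g (s * t) / g t) \<longlongrightarrow> \<psi> s) at_top \<and> (1 \<le> s \<longrightarrow> 1 \<le> \<psi> s)"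
    using ratio_limit by metis
  obtain \<alpha> where \<alpha>: "0 \<le> \<alpha>" "\<And>s. 0 < s \<Longrightarrow> \<psi> s = s powr \<alpha>"
  proof (rule multiplicative_powr[of \<psi>])
    fix s u :: real assume su: "0 < s" "0 < u"
    have "((\<lambda>t. g (s * (u * t)) / g (u * t)) \<longlongrightarrow> \<psi> s) at_top"
      using filterlim_compose[OF conjunct1[OF conjunct2[OF \<psi>[OF su(1)]]] scaling_at_top[OF su(2)]] .
    from tendsto_mult[OF this conjunct1[OF conjunct2[OF \<psi>[OF su(2)]]]]
    have l: "((\<lambda>t. g (s * (u * t)) / g (u * t) * (g (u * t) / g t)) \<longlongrightarrow> \<psi> s * \<psi> u) at_top" .
    have "eventually (\<lambda>t. 0 < g (u * t)) at_top"
      using scaling_at_top[OF su(2)] g_pos unfolding filterlim_iff by blast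
    then have "eventually (\<lambda>t. g (s * (u * t)) / g (u * t) * (g (u * t) / g t) = g (s * u * t) / g t) at_top"
      by eventually_elim (simp add: mult.assoc)
    with l have "((\<lambda>t. g (s * u * t) / g t) \<longlongrightarrow> \<psi> s * \<psi> u) at_top" using tendsto_cong by fast
    moreover have "((\<lambda>t. g (s * u * t) / g t) \<longlongrightarrow> \<psi> (s * u)) at_top" using \<psi>[of "s * u"] su by simp
    ultimately show "\<psi> (s * u) = \<psi> s * \<psi> u"
      using tendsto_unique[OF trivial_limit_at_top_linorder] by blast
  qed (use \<psi> in auto)
  show thesis
    by (rule that[OF \<alpha>(1)]) (use \<psi> \<alpha>(2) g_pos in \<open>auto simp: regularly_varying_def\<close>)
qed

lemma homogeneous:
  assumes rv: "regularly_varying g \<alpha>" and s: "0 < s"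
    and f: "continuous_on UNIV f" "\<And>r. \<bar>f r\<bar> \<le> B" "0 < c" "\<And>r. f r \<noteq> 0 \<Longrightarrow> c \<le> r"
  shows "(\<integral>r. f (inverse s * r) \<partial>N) = s powr (- \<alpha>) * (\<integral>r. f r \<partial>N)"
proof -
  let ?f = "\<lambda>r. f (inverse s * r)"
  have cf: "continuous_on UNIV ?f"
    by (rule continuous_on_compose2[OF f(1)]) (auto intro!: continuous_intros)
  have zf: "s * c \<le> r" if "?f r \<noteq> 0" for r
    using f(4)[OF that] s by (simp add: field_simps)
  have 1: "((\<lambda>t. g t * E t ?f) \<longlongrightarrow> (\<integral>r. ?f r \<partial>N)) at_top"
    by (rule E_limit[OF cf f(2) _ zf]) (use s f(3) in simp)
  have r: "((\<lambda>t. g (s * t) / g t) \<longlongrightarrow> s powr \<alpha>) at_top"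
    using rv s by (simp add: regularly_varying_def)
  have 2: "((\<lambda>t. g (s * t) * E (s * t) f) \<longlongrightarrow> (\<integral>r. f r \<partial>N)) at_top"
    using filterlim_compose[OF E_limit[OF f] scaling_at_top[OF s]] .
  have "((\<lambda>t. (g (s * t) / g t) * (g t * E t ?f)) \<longlongrightarrow> s powr \<alpha> * (\<integral>r. ?f r \<partial>N)) at_top"
    by (rule tendsto_mult[OF r 1])
  moreover have "eventually (\<lambda>t. (g (s * t) / g t) * (g t * E t ?f) = g (s * t) * E (s * t) f) at_top"
    using g_pos eventually_gt_at_top[of 0]
  proof eventually_elim
    case (elim t)
    then show ?case using E_scale[OF elim(2) s, of f] by simp
  qed
  ultimately have "((\<lambda>t. g (s * t) * E (s * t) f) \<longlongrightarrow> s powr \<alpha> * (\<integral>r. ?f r \<partial>N)) at_top"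
    using tendsto_cong by fast
  from tendsto_unique[OF trivial_limit_at_top_linorder this 2]
  have "s powr \<alpha> * (\<integral>r. ?f r \<partial>N) = (\<integral>r. f r \<partial>N)" .
  then have "s powr (- \<alpha>) * (\<integral>r. f r \<partial>N) = (s powr (- \<alpha>) * s powr \<alpha>) * (\<integral>r. ?f r \<partial>N)"
    by (simp only: mult.assoc)
  also have "s powr (- \<alpha>) * s powr \<alpha> = 1" using s by (simp add: powr_add[symmetric])
  finally show ?thesis by simp
qed

text \<open>
  With exponent 0 homogeneity would make the integrals of the ramps \<open>ramp (a n)\<close> equal for all \<open>n\<close>, but they tend
  to 0 by dominated convergence.
\<close>

lemma exponent_pos:
  assumes rv: "regularly_varying g \<alpha>" and a0: "0 \<le> \<alpha>" shows "0 < \<alpha>"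
proof (rule ccontr)
  assume "\<not> 0 < \<alpha>"
  then have \<alpha>: "\<alpha> = 0" using a0 by simp
  obtain a where a: "0 < a" "0 < J a" by (rule J_pos)
  have eq: "J (a * real (Suc n)) = J a" for n
  proof -
    have "J (a * real (Suc n)) = (\<integral>r. ramp a (inverse (real (Suc n)) * r) \<partial>N)"
      by (subst ramp_scale) simp_all
    also have "\<dots> = real (Suc n) powr (- \<alpha>) * J a"
      by (rule homogeneous[OF rv _ continuous_ramp ramp_bounds(3) a(1) ramp_support[OF a(1)]]) simp_all
    finally show ?thesis by (simp add: \<alpha>)
  qed
  have "(\<lambda>n. J (a * real (Suc n))) \<longlonglongrightarrow> (\<integral>r. 0 \<partial>N)"
  proof (rule integral_dominated_convergence[where w = "ramp a"])
    show "integrable N (ramp a)" by (rule integrable_ramp[OF a(1)])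
    show "ramp (a * real (Suc n)) \<in> borel_measurable N" for n
      by (rule borel_measurable_integrable[OF integrable_ramp]) (use a in simp)
    show "AE r in N. norm (ramp (a * real (Suc n)) r) \<le> ramp a r" for n
    proof (rule AE_I2)
      fix r
      have "ramp (a * real (Suc n)) r \<le> ramp a r" by (rule ramp_antimono) (use a in auto)
      then show "norm (ramp (a * real (Suc n)) r) \<le> ramp a r" using ramp_bounds(1)[of "a * real (Suc n)" r] by simp
    qed
    show "AE r in N. (\<lambda>n. ramp (a * real (Suc n)) r) \<longlonglongrightarrow> 0"
    proof (rule AE_I2)
      fix r
      obtain k :: nat where k: "r < real k * a" using reals_Archimedean3[OF a(1)] by blast
      have "ramp (a * real (Suc n)) r = 0" if "k \<le> n" for n
      proof (rule ccontr)
        assume nz: "ramp (a * real (Suc n)) r \<noteq> 0"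
        have "a * real (Suc n) \<le> r" by (rule ramp_support[OF _ nz]) (use a in simp)
        moreover have "a * real k \<le> a * real (Suc n)" using that a by (intro mult_left_mono) auto
        ultimately show False using k by (simp add: mult.commute)
      qed
      then have "eventually (\<lambda>n. ramp (a * real (Suc n)) r = 0) sequentially"
        unfolding eventually_sequentially by blast
      then show "(\<lambda>n. ramp (a * real (Suc n)) r) \<longlonglongrightarrow> 0" by (rule tendsto_eventually)
    qed
  qed simp
  then have "J a = 0" unfolding eq using LIMSEQ_const_iff by auto
  then show False using a by simp
qed

text \<open>
  Homogeneity for functions that increase to the indicator of \<open>{1<..}\<close>.
\<close>

lemma tail_power:
  assumes rv: "regularly_varying g \<alpha>" and s: "0 < s"
  shows "emeasure N {s<..} = ennreal (s powr (- \<alpha>)) * emeasure N {1<..}"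
proof -
  let ?f = "\<lambda>k r. min 1 (real k * max 0 (r - 1)) :: real"
  have fin: "emeasure N {s<..} < \<infinity>" if "0 < s" for s
  proof -
    have "emeasure N {s<..} \<le> emeasure N {s..}" using sets_N by (intro emeasure_mono) auto
    then show ?thesis using N_finite[OF that] by (rule le_less_trans)
  qed
  have lim: "(\<lambda>k. \<integral>r. ?f k (inverse s * r) \<partial>N) \<longlonglongrightarrow> measure N {s<..}" if s: "0 < s" for s
  proof -
    have "(\<lambda>k. \<integral>r. ?f k (inverse s * r) \<partial>N) \<longlonglongrightarrow> (\<integral>r. indicator {s<..} r \<partial>N)"
    proof (rule integral_dominated_convergence[where w = "indicator {s<..}"])
      show "integrable N (indicator {s<..} :: real \<Rightarrow> real)" using sets_N fin[OF s] by (simp add: integrable_indicator_iff)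
      show "(\<lambda>r. ?f k (inverse s * r)) \<in> borel_measurable N" for k
        using sets_N by (subst measurable_cong_sets[OF sets_N refl]) measurable
      show "indicator {s<..} \<in> borel_measurable N" using sets_N by simp
      have sr: "1 < inverse s * r \<longleftrightarrow> s < r" for r using s by (simp add: field_simps)
      show "AE r in N. norm (?f k (inverse s * r)) \<le> indicator {s<..} r" for k
      proof (rule AE_I2)
        fix r show "norm (?f k (inverse s * r)) \<le> indicator {s<..} r"
        proof (cases "s < r")
          case False
          then have "max 0 (inverse s * r - 1) = 0" using sr[of r] by linarith
          then show ?thesis by simp
        qed simp
      qed
      show "AE r in N. (\<lambda>k. ?f k (inverse s * r)) \<longlonglongrightarrow> indicator {s<..} r"
      proof (rule AE_I2)
        fix r show "(\<lambda>k. ?f k (inverse s * r)) \<longlonglongrightarrow> indicator {s<..} r"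
        proof (cases "s < r")
          case False
          then have "max 0 (inverse s * r - 1) = 0" using sr[of r] by linarith
          then show ?thesis using False by simp
        next
          case True
          define d where "d = inverse s * r - 1"
          have d: "0 < d" using True sr[of r] by (simp add: d_def)
          obtain n :: nat where n: "1 < real n * d" using reals_Archimedean3[OF d] by blast
          have "?f k (inverse s * r) = 1" if "n \<le> k" for k
          proof -
            have "real n * d \<le> real k * d" using that d by (intro mult_right_mono) auto
            then have "1 \<le> real k * d" using n by linarith
            then show ?thesis using d unfolding d_def[symmetric] by (simp add: min_absorb1)
          qed
          then have "eventually (\<lambda>k. ?f k (inverse s * r) = indicator {s<..} r) sequentially"
            unfolding eventually_sequentially using True by auto
          then show ?thesis by (rule tendsto_eventually)
        qed
      qed
    qed
    then show ?thesis using sets_N by simp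
  qed
  have "(\<integral>r. ?f k (inverse s * r) \<partial>N) = s powr (- \<alpha>) * (\<integral>r. ?f k r \<partial>N)" for k
  proof (rule homogeneous[OF rv s, where B = 1 and c = 1])
    show "continuous_on UNIV (?f k)" by (intro continuous_intros)
    show "1 \<le> r" if "?f k r \<noteq> 0" for r
    proof (rule ccontr)
      assume "\<not> 1 \<le> r"
      then have "max 0 (r - 1) = 0" by linarith
      then show False using that by simp
    qed
  qed simp_all
  moreover have "(\<lambda>k. s powr (- \<alpha>) * (\<integral>r. ?f k r \<partial>N)) \<longlonglongrightarrow> s powr (- \<alpha>) * measure N {1<..}"
    using tendsto_mult[OF tendsto_const lim[of 1], of "s powr (- \<alpha>)"] by simp
  ultimately have "measure N {s<..} = s powr (- \<alpha>) * measure N {1<..}"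
    using LIMSEQ_unique[OF lim[OF s]] by simp
  moreover have "emeasure N {r<..} = ennreal (measure N {r<..})" if "0 < r" for r
    using fin[OF that] by (intro emeasure_eq_ennreal_measure) simp
  ultimately show ?thesis using s by (simp add: ennreal_mult)
qed

end

section \<open>The norm of the path\<close>

lemma sets_borel_of_subtopology:
  fixes S :: "'a::topological_space set"
  assumes S: "S \<in> sets borel"
  shows "sets (borel_of (top_of_set S)) = sets (restrict_space borel S)"
proof -
  have "{U. openin (top_of_set S) U} = (\<inter>) S ` {U. open U}"
    by (auto simp: openin_open)
  then have "sets (borel_of (top_of_set S)) = sigma_sets S ((\<inter>) S ` {U. open U})"
    by (simp add: sets_borel_of)
  also have "\<dots> = (\<inter>) S ` sigma_sets UNIV {U. open U}"
    by (rule sigma_sets_Int[symmetric]) (use S in \<open>simp_all add: borel_def\<close>)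
  finally show ?thesis by (simp add: sets_restrict_space borel_def)
qed

lemma sets_\<theta>: "sets (\<theta> \<alpha>) = sets (borel_of Rplus)"
proof -
  have "sets (restrict_space lborel {0::real..}) = sets (restrict_space borel {0..})"
    by (rule sets_restrict_space_cong) simp
  then show ?thesis by (simp add: \<theta>_def Rplus_def sets_borel_of_subtopology)
qed

lemma emeasure_\<theta>:
  assumes A: "A \<in> sets borel" "A \<subseteq> {0..}"
  shows "emeasure (\<theta> \<alpha>) A = (\<integral>\<^sup>+s. ennreal (\<alpha> * s powr (- \<alpha> - 1)) * indicator (A \<inter> {0<..}) s \<partial>lborel)"
proof -
  have m: "(\<lambda>s. ennreal (indicator {0<..} s * (\<alpha> * s powr (- \<alpha> - 1)))) \<in> borel_measurable (restrict_space lborel {0..})"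
    by (rule measurable_restrict_space1) measurable
  have "A \<in> sets (restrict_space lborel {0..})"
    using A by (auto simp: sets_restrict_space)
  then have "emeasure (\<theta> \<alpha>) A = (\<integral>\<^sup>+s. ennreal (indicator {0<..} s * (\<alpha> * s powr (- \<alpha> - 1))) * indicator A s \<partial>restrict_space lborel {0..})"
    unfolding \<theta>_def by (rule emeasure_density[OF m])
  also have "\<dots> = (\<integral>\<^sup>+s. ennreal (indicator {0<..} s * (\<alpha> * s powr (- \<alpha> - 1))) * indicator A s * indicator {0..} s \<partial>lborel)"
    by (rule nn_integral_restrict_space) simp
  also have "\<dots> = (\<integral>\<^sup>+s. ennreal (\<alpha> * s powr (- \<alpha> - 1)) * indicator (A \<inter> {0<..}) s \<partial>lborel)"
    using A(2) by (intro nn_integral_cong) (auto simp: indicator_def)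
  finally show ?thesis .
qed

lemma \<theta>_tail:
  assumes \<alpha>: "0 < \<alpha>" and s: "0 < s"
  shows "emeasure (\<theta> \<alpha>) {s..} = ennreal (s powr (- \<alpha>))" "emeasure (\<theta> \<alpha>) {s<..} = ennreal (s powr (- \<alpha>))"
proof -
  have lim: "((\<lambda>x. - (x powr (- \<alpha>))) \<longlongrightarrow> - 0) at_top"
    by (intro tendsto_minus tendsto_neg_powr filterlim_ident) (use \<alpha> in simp)
  have "(\<integral>\<^sup>+x. ennreal (\<alpha> * x powr (- \<alpha> - 1)) * indicator {s..} x \<partial>lborel) = ennreal (- 0 - (- (s powr (- \<alpha>))))"
  proof (rule nn_integral_FTC_atLeast[OF _ _ _ lim])
    show "(\<lambda>x. \<alpha> * x powr (- \<alpha> - 1)) \<in> borel_measurable borel" by measurable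
    show "((\<lambda>x. - (x powr (- \<alpha>))) has_real_derivative \<alpha> * x powr (- \<alpha> - 1)) (at x)" if "s \<le> x" for x
      using s that by (auto intro!: derivative_eq_intros)
    show "0 \<le> \<alpha> * x powr (- \<alpha> - 1)" for x using \<alpha> by simp
  qed
  then have I: "(\<integral>\<^sup>+x. ennreal (\<alpha> * x powr (- \<alpha> - 1)) * indicator {s..} x \<partial>lborel) = ennreal (s powr (- \<alpha>))" by simp
  have i: "{s..} \<inter> {0<..} = {s..}" "{s<..} \<inter> {0<..} = {s<..}" using s by auto
  have J: "(\<integral>\<^sup>+x. ennreal (\<alpha> * x powr (- \<alpha> - 1)) * indicator {s<..} x \<partial>lborel) =
      (\<integral>\<^sup>+x. ennreal (\<alpha> * x powr (- \<alpha> - 1)) * indicator {s..} x \<partial>lborel)"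
  proof (rule nn_integral_cong_AE)
    show "AE x in lborel. ennreal (\<alpha> * x powr (- \<alpha> - 1)) * indicator {s<..} x =
        ennreal (\<alpha> * x powr (- \<alpha> - 1)) * indicator {s..} x"
      using AE_lborel_singleton[of s] by eventually_elim (auto simp: indicator_def)
  qed
  have b: "{s..} \<subseteq> {0..}" "{s<..} \<subseteq> {0..}" using s by auto
  have "emeasure (\<theta> \<alpha>) {s..} = (\<integral>\<^sup>+x. ennreal (\<alpha> * x powr (- \<alpha> - 1)) * indicator ({s..} \<inter> {0<..}) x \<partial>lborel)"
    by (rule emeasure_\<theta>[OF _ b(1)]) simp
  then show "emeasure (\<theta> \<alpha>) {s..} = ennreal (s powr (- \<alpha>))" unfolding i I .
  have "emeasure (\<theta> \<alpha>) {s<..} = (\<integral>\<^sup>+x. ennreal (\<alpha> * x powr (- \<alpha> - 1)) * indicator ({s<..} \<inter> {0<..}) x \<partial>lborel)"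
    by (rule emeasure_\<theta>[OF _ b(2)]) simp
  then show "emeasure (\<theta> \<alpha>) {s<..} = ennreal (s powr (- \<alpha>))" unfolding i J I .
qed

lemma half_lines_determine:
  fixes N1 N2 :: "real measure"
  assumes s: "sets N1 = sets borel" "sets N2 = sets borel" and c: "0 < c"
    and eq: "\<And>a. c \<le> a \<Longrightarrow> emeasure N1 {a<..} = emeasure N2 {a<..}" and fin: "emeasure N1 {c<..} < \<infinity>"
  shows "density N1 (indicator {c<..}) = density N2 (indicator {c<..})"
proof (rule measure_eqI_generator_eq[where \<Omega> = UNIV and E = "range (\<lambda>a. {a<..})" and A = "\<lambda>n. {- real n<..}"])
  show "Int_stable (range (\<lambda>a::real. {a<..}))"
  proof (rule Int_stableI)
    fix A B assume "A \<in> range (\<lambda>a::real. {a<..})" "B \<in> range (\<lambda>a::real. {a<..})"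
    then obtain a b where "A = {a<..}" "B = {b<..}" by blast
    then have "A \<inter> B = {max a b<..}" by auto
    then show "A \<inter> B \<in> range (\<lambda>a::real. {a<..})" by blast
  qed
  have sb: "sets (borel :: real measure) = sigma_sets UNIV (range (\<lambda>a. {a<..}))"
    by (subst borel_Ioi) simp
  show "sets (density N1 (indicator {c<..})) = sigma_sets UNIV (range (\<lambda>a. {a<..}))"
    "sets (density N2 (indicator {c<..})) = sigma_sets UNIV (range (\<lambda>a. {a<..}))"
    using s sb by simp_all
  have d: "emeasure (density N (indicator {c<..})) {a<..} = emeasure N {max a c<..}" if "sets N = sets borel" for N and a :: real
  proof -
    have "{c<..} \<inter> {a<..} = {max a c<..}" by auto
    then show ?thesis using that by (simp add: emeasure_restricted)
  qed
  show "emeasure (density N1 (indicator {c<..})) A = emeasure (density N2 (indicator {c<..})) A"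
    if "A \<in> range (\<lambda>a. {a<..})" for A
    using that d[OF s(1)] d[OF s(2)] eq by auto
  show "emeasure (density N1 (indicator {c<..})) {- real n<..} \<noteq> \<infinity>" for n
  proof -
    have "max (- real n) c = c" using c by simp
    then show ?thesis using d[OF s(1), of "- real n"] fin by simp
  qed
  show "(\<Union>n. {- real n<..}) = UNIV"
  proof (intro equalityI subsetI UNIV_I)
    fix x :: real
    obtain n where "- x < real n" using reals_Archimedean2 by blast
    then show "x \<in> (\<Union>n. {- real n<..})" by (auto intro!: exI[of _ n])
  qed
qed auto

text \<open>
  A test function of the norm is a test function of the path, so the norm satisfies the assumptions of
  \<open>real_tail\<close> with its law \<open>N\<close> under \<open>\<mu>\<close>. By \<open>tail_power\<close>, \<open>N\<close> and the multiple of \<^term>\<open>\<theta> \<alpha>\<close> agree on half-lines away from 0,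
  and this determines all integrals of test functions.
\<close>

proposition norm_regularly_varying:
  assumes M: "prob_space M" and \<xi>: "\<xi> \<in> M \<rightarrow>\<^sub>M borel_of C01" and g: "normalising g"
    and \<mu>: "tail_measure C01 C01_ideal \<mu>"
    and conv: "tail_convergence M \<xi> C01 (scale_on {0..1}) sup_norm g \<mu>"
  shows "\<exists>\<alpha>>0. regularly_varying g \<alpha> \<and>
    RV_Rplus M (\<lambda>\<omega>. sup_norm (\<xi> \<omega>)) g (scale_measure (emeasure \<mu> {x \<in> topspace C01. 1 < sup_norm x}) (\<theta> \<alpha>))"
proof -
  note T = \<mu>[unfolded C01_ideal_def tail_measure_iff[OF continuous_sup_norm]]
  have s: "sets \<mu> = sets (borel_of C01)" using T by blast
  have sp: "space \<mu> = topspace C01" using sets_eq_imp_space_eq[OF s] by simp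
  have nm: "sup_norm \<in> \<mu> \<rightarrow>\<^sub>M borel"
    using continuous_map_borel_measurable[OF continuous_sup_norm] measurable_cong_sets[OF s refl] by blast
  define N where "N = distr \<mu> borel sup_norm"
  have NA: "emeasure N A = emeasure \<mu> {x \<in> topspace C01. sup_norm x \<in> A}" if "A \<in> sets borel" for A
    unfolding N_def by (subst emeasure_distr[OF nm that]) (simp add: sp vimage_def Int_def conj_commute)
  have x0: "\<xi> \<omega> \<in> topspace C01" if "\<omega> \<in> space M" for \<omega> using measurable_space[OF \<xi> that] by simp
  define E where "E t f = (\<integral>\<omega>. f (inverse t * sup_norm (\<xi> \<omega>)) \<partial>M)" for t and f :: "real \<Rightarrow> real"
  have E_eq: "E t f = (\<integral>\<omega>. f (sup_norm (scale_on {0..1} (inverse t) (\<xi> \<omega>))) \<partial>M)" if "0 < t" for t f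
    unfolding E_def using that x0 by (intro Bochner_Integration.integral_cong) (simp_all add: sup_norm_scale)
  have E_limit: "((\<lambda>t. g t * E t f) \<longlongrightarrow> (\<integral>r. f r \<partial>N)) at_top"
    if f: "continuous_on UNIV f" "\<And>r. \<bar>f r\<bar> \<le> B" "0 < c" "\<And>r. f r \<noteq> 0 \<Longrightarrow> c \<le> r" for f B c
  proof -
    have c: "continuous_map C01 euclideanreal (f \<circ> sup_norm)"
      using f(1) by (intro continuous_map_compose[OF continuous_sup_norm]) simp
    have "((\<lambda>t. g t * (\<integral>\<omega>. (f \<circ> sup_norm) (scale_on {0..1} (inverse t) (\<xi> \<omega>)) \<partial>M)) \<longlongrightarrow> (\<integral>x. (f \<circ> sup_norm) x \<partial>\<mu>)) at_top"
      by (rule tail_convergenceD[OF conv c _ f(3)]) (use f(2,4) in auto)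
    moreover have "(\<integral>x. (f \<circ> sup_norm) x \<partial>\<mu>) = (\<integral>r. f r \<partial>N)"
      unfolding N_def using integral_distr[OF nm borel_measurable_continuous_onI[OF f(1)]] by simp
    moreover have "eventually (\<lambda>t. g t * (\<integral>\<omega>. (f \<circ> sup_norm) (scale_on {0..1} (inverse t) (\<xi> \<omega>)) \<partial>M) = g t * E t f) at_top"
      using eventually_gt_at_top[of 0] by eventually_elim (simp add: E_eq)
    ultimately show ?thesis by (subst (asm) tendsto_cong) simp_all
  qed
  interpret real_tail E g N
  proof
    show "filterlim g at_top at_top" using g by (simp add: normalising_def)
    show "sets N = sets borel" by (simp add: N_def)
    show "emeasure N {c..} < \<infinity>" if "0 < c" for c using NA[of "{c..}"] T that by simp
    show "\<exists>c>0. 0 < emeasure N {c..}" using NA T by simp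
    show "E (s * t) f = E t (\<lambda>r. f (inverse s * r))" for s t f by (simp add: E_def mult.assoc)
  qed (fact E_limit)
  obtain \<alpha> where \<alpha>0: "0 \<le> \<alpha>" and rv: "regularly_varying g \<alpha>" by (rule regular_variation_exponent)
  have \<alpha>: "0 < \<alpha>" by (rule exponent_pos[OF rv \<alpha>0])
  define v where "v = emeasure \<mu> {x \<in> topspace C01. 1 < sup_norm x}"
  have v: "v = emeasure N {1<..}" using NA[of "{1<..}"] by (simp add: v_def)
  have v_fin: "v < \<infinity>"
  proof -
    have "v \<le> emeasure N {1..}" unfolding v using sets_N by (intro emeasure_mono) auto
    then show ?thesis using N_finite[of 1] by (auto intro: le_less_trans)
  qed
  have v_pos: "0 < v"
  proof -
    obtain c where c: "0 < c" "0 < emeasure N {c..}" using N_nontrivial by blast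
    have "emeasure N {c..} \<le> emeasure N {c / 2<..}" using sets_N c(1) by (intro emeasure_mono) auto
    also have "\<dots> = ennreal ((c / 2) powr (- \<alpha>)) * v" unfolding v by (rule tail_power[OF rv]) (use c in simp)
    finally have "0 < ennreal ((c / 2) powr (- \<alpha>)) * v" using c(2) by (rule less_le_trans[rotated])
    then show ?thesis unfolding ennreal_zero_less_mult_iff by (rule conjunct2)
  qed
  let ?\<Theta> = "scale_measure v (\<theta> \<alpha>)"
  have s\<Theta>: "sets ?\<Theta> = sets (borel_of Rplus)" by (simp add: sets_\<theta>)
  have sp\<Theta>: "space ?\<Theta> = {0..}" using sets_eq_imp_space_eq[OF s\<Theta>] by (simp add: Rplus_def)
  have \<tau>: "continuous_map Rplus euclideanreal (\<lambda>s. s)" by (simp add: Rplus_def)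
  have lev: "{x \<in> topspace Rplus. c \<le> x} = {c..}" if "0 < c" for c using that by (auto simp: Rplus_def)
  have tm: "tail_measure Rplus Rplus_ideal ?\<Theta>"
    unfolding Rplus_ideal_def tail_measure_iff[OF \<tau>]
  proof (intro conjI allI impI s\<Theta>)
    show "emeasure ?\<Theta> {x \<in> topspace Rplus. c \<le> x} < \<infinity>" if "0 < c" for c
      using v_fin by (simp add: lev[OF that] \<theta>_tail[OF \<alpha> that] ennreal_mult_less_top)
    have "{x \<in> topspace Rplus. x \<le> 0} = {0}" by (auto simp: Rplus_def)
    moreover have "emeasure (\<theta> \<alpha>) {0} = 0" by (subst emeasure_\<theta>) auto
    ultimately show "emeasure ?\<Theta> {x \<in> topspace Rplus. x \<le> 0} = 0" by simp
    show "\<exists>c>0. 0 < emeasure ?\<Theta> {x \<in> topspace Rplus. c \<le> x}"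
      using v_pos by (intro exI[of _ 1]) (simp add: lev \<theta>_tail[OF \<alpha>])
  qed
  have idm: "(\<lambda>x. x) \<in> ?\<Theta> \<rightarrow>\<^sub>M borel"
    using continuous_map_borel_measurable[OF \<tau>] measurable_cong_sets[OF s\<Theta> refl] by blast
  let ?D = "distr ?\<Theta> borel (\<lambda>x. x)"
  have D: "emeasure ?D {a<..} = emeasure N {a<..}" if "0 < a" for a
  proof -
    have "emeasure ?D {a<..} = emeasure ?\<Theta> ((\<lambda>x. x) -` {a<..} \<inter> space ?\<Theta>)" by (rule emeasure_distr[OF idm]) simp
    also have "(\<lambda>x. x) -` {a<..} \<inter> space ?\<Theta> = {a<..}" unfolding sp\<Theta> using that by auto
    also have "emeasure ?\<Theta> {a<..} = v * emeasure (\<theta> \<alpha>) {a<..}" by (rule emeasure_scale_measure)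
    also have "\<dots> = ennreal (a powr (- \<alpha>)) * v" unfolding \<theta>_tail(2)[OF \<alpha> that] by (rule mult.commute)
    also have "\<dots> = emeasure N {a<..}" unfolding tail_power[OF rv that] v ..
    finally show ?thesis .
  qed
  have "tail_convergence M (\<lambda>\<omega>. sup_norm (\<xi> \<omega>)) Rplus (*) (\<lambda>s. s) g ?\<Theta>"
    unfolding tail_convergence_def
  proof (intro allI impI)
    fix f :: "real \<Rightarrow> real" and B c :: real
    assume f: "continuous_map Rplus euclideanreal f" and B: "\<forall>x\<in>topspace Rplus. \<bar>f x\<bar> \<le> B"
      and c: "0 < c" and z: "\<forall>x\<in>topspace Rplus. f x \<noteq> 0 \<longrightarrow> c \<le> x"
    define h where "h r = f (max 0 r)" for r
    have cf: "continuous_on {0..} f" using f by (simp add: Rplus_def)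
    have ch: "continuous_on UNIV h"
      unfolding h_def by (rule continuous_on_compose2[OF cf]) (auto intro!: continuous_intros)
    have hB: "\<bar>h r\<bar> \<le> B" for r using B by (simp add: h_def Rplus_def)
    have hz: "c \<le> r" if "h r \<noteq> 0" for r
    proof -
      have "c \<le> max 0 r" using z that by (simp add: h_def Rplus_def)
      then show ?thesis using c by (simp add: max_def split: if_splits)
    qed
    have hb: "h \<in> borel_measurable borel" by (rule borel_measurable_continuous_onI[OF ch])
    have "(\<integral>r. h r \<partial>N) = (\<integral>r. h r \<partial>?D)"
    proof (rule integral_cong_on_set[where G = "{c / 2<..}"])
      have "density N (indicator {c / 2<..}) = density ?D (indicator {c / 2<..})"
      proof (rule half_lines_determine)
        show "emeasure N {c / 2<..} < \<infinity>"
        proof (rule le_less_trans)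
          show "emeasure N {c / 2<..} \<le> emeasure N {c / 2..}" using sets_N by (intro emeasure_mono) auto
          show "emeasure N {c / 2..} < \<infinity>" by (rule N_finite) (use c in simp)
        qed
      qed (use c D sets_N in auto)
      then show "emeasure N A = emeasure ?D A" if "A \<in> sets N" "A \<subseteq> {c / 2<..}" for A
        using that sets_N by (subst (asm) density_indicator_eq_iff) auto
      show "h \<in> borel_measurable N" using hb measurable_cong_sets[OF sets_N refl] by blast
      show "h r = 0" if "r \<notin> {c / 2<..}" for r using hz[of r] that c by auto
    qed (use sets_N in auto)
    also have "\<dots> = (\<integral>r. h r \<partial>?\<Theta>)" by (rule integral_distr[OF idm hb])
    also have "\<dots> = (\<integral>r. f r \<partial>?\<Theta>)"
      by (rule Bochner_Integration.integral_cong) (use sp\<Theta> in \<open>auto simp: h_def\<close>)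
    finally have I: "(\<integral>r. h r \<partial>N) = (\<integral>r. f r \<partial>?\<Theta>)" .
    have "eventually (\<lambda>t. g t * E t h = g t * (\<integral>\<omega>. f (inverse t * sup_norm (\<xi> \<omega>)) \<partial>M)) at_top"
      using eventually_gt_at_top[of 0]
    proof eventually_elim
      case (elim t)
      have "h (inverse t * sup_norm (\<xi> \<omega>)) = f (inverse t * sup_norm (\<xi> \<omega>))" if "\<omega> \<in> space M" for \<omega>
        using sup_norm_nonneg[OF x0[OF that]] elim by (simp add: h_def max_absorb2)
      then have "E t h = (\<integral>\<omega>. f (inverse t * sup_norm (\<xi> \<omega>)) \<partial>M)"
        unfolding E_def by (intro Bochner_Integration.integral_cong) auto
      then show ?case by simp
    qed
    from E_limit[OF ch hB c hz] this
    show "((\<lambda>t. g t * (\<integral>\<omega>. f (inverse t * sup_norm (\<xi> \<omega>)) \<partial>M)) \<longlongrightarrow> (\<integral>r. f r \<partial>?\<Theta>)) at_top"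
      unfolding I by (rule Lim_transform_eventually)
  qed
  moreover have "(\<lambda>\<omega>. sup_norm (\<xi> \<omega>)) \<in> M \<rightarrow>\<^sub>M borel_of Rplus"
  proof -
    have "continuous_map C01 Rplus sup_norm"
      unfolding Rplus_def using continuous_sup_norm sup_norm_nonneg by (auto simp: continuous_map_in_subtopology)
    from measurable_compose[OF \<xi> continuous_map_measurable[OF this]] show ?thesis .
  qed
  ultimately have "RV_Rplus M (\<lambda>\<omega>. sup_norm (\<xi> \<omega>)) g ?\<Theta>"
    unfolding Rplus_ideal_def RV_iff[OF \<tau>] using g tm by (simp add: Rplus_ideal_def)
  then show ?thesis using \<alpha> rv unfolding v_def by blast
qed

section \<open>Necessity of the two conditions\<close>

lemma RV_C01_D:
  assumes "RV_C01 M \<xi> g \<mu>"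
  shows "\<xi> \<in> M \<rightarrow>\<^sub>M borel_of C01" "normalising g" "tail_measure C01 C01_ideal \<mu>"
    "sets \<mu> = sets (borel_of C01)" "\<And>c. 0 < c \<Longrightarrow> emeasure \<mu> {x \<in> topspace C01. c \<le> sup_norm x} < \<infinity>"
    "\<exists>c>0. 0 < emeasure \<mu> {x \<in> topspace C01. c \<le> sup_norm x}"
    "tail_convergence M \<xi> C01 (scale_on {0..1}) sup_norm g \<mu>"
  using assms unfolding C01_ideal_def RV_iff[OF continuous_sup_norm] tail_measure_iff[OF continuous_sup_norm] by auto

text \<open>
  For small radius \<open>r\<close> the event \<open>t d < modulus r \<xi>\<close> is dominated by a ramp of the modulus, which is a
  test function as the modulus is at most twice the norm. Its integral under \<open>\<mu>\<close> tends to 0 with \<open>r\<close> because paths are uniformly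
  continuous.
\<close>

lemma RV_imp_modulus_condition:
  assumes M: "prob_space M" and RV: "RV_C01 M \<xi> g \<mu>"
  shows "modulus_condition M \<xi> g"
  unfolding modulus_condition_def
proof (intro allI impI)
  fix d :: real assume d: "0 < d"
  interpret prob_space M by (rule M)
  note D = RV_C01_D[OF RV]
  have sp: "space \<mu> = topspace C01" using sets_eq_imp_space_eq[OF D(4)] by simp
  have x0: "\<xi> \<omega> \<in> topspace C01" if "\<omega> \<in> space M" for \<omega> using measurable_space[OF D(1) that] by simp
  let ?P = "\<lambda>r t. {\<omega> \<in> space M. t * d < modulus r (\<xi> \<omega>)}"
  let ?h = "\<lambda>r x. ramp (d / 2) (modulus r x)"
  have ch: "continuous_map C01 euclideanreal (?h r)" if "0 \<le> r" for r
    using continuous_map_compose[OF continuous_modulus[OF that], of euclideanreal "ramp (d / 2)"] continuous_ramp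
    by (simp add: comp_def)
  have hz: "d / 4 \<le> sup_norm x" if "0 \<le> r" "x \<in> topspace C01" "?h r x \<noteq> 0" for r x
    using ramp_support[OF _ that(3)] d modulus_le_sup_norm[OF that(2,1)] by simp
  have d4: "0 < d / 4" using d by simp
  have ev: "eventually (\<lambda>r. Limsup at_top (\<lambda>t. ereal (g t * prob (?P r t))) < ereal e) (at_right 0)" if e: "0 < e" for e
  proof -
    have int: "(\<lambda>n. \<integral>x. ?h (1 / real (Suc n)) x \<partial>\<mu>) \<longlonglongrightarrow> (\<integral>x. 0 \<partial>\<mu>)"
    proof (rule integral_dominated_convergence[where w = "indicator {x \<in> topspace C01. d / 4 \<le> sup_norm x}"])
      let ?G = "{x \<in> topspace C01. d / 4 \<le> sup_norm x}"
      have G: "?G \<in> sets \<mu>" unfolding D(4) by (rule borel_of_level[OF continuous_sup_norm])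
      show "integrable \<mu> (indicator ?G :: _ \<Rightarrow> real)" using G D(5)[OF d4] by (simp add: integrable_indicator_iff)
      show "?h (1 / real (Suc n)) \<in> borel_measurable \<mu>" for n
        unfolding measurable_cong_sets[OF D(4) refl]
        by (rule continuous_map_borel_measurable[OF ch]) simp
      show "AE x in \<mu>. norm (?h (1 / real (Suc n)) x) \<le> indicator ?G x" for n
      proof (rule AE_I2)
        fix x assume "x \<in> space \<mu>"
        then have x: "x \<in> topspace C01" using sp by simp
        show "norm (?h (1 / real (Suc n)) x) \<le> indicator ?G x"
        proof (cases "?h (1 / real (Suc n)) x = 0")
          case False
          then have "x \<in> ?G" using hz[OF _ x False] x by simp
          then show ?thesis using ramp_bounds(3) by simp
        qed simp
      qed
      show "AE x in \<mu>. (\<lambda>n. ?h (1 / real (Suc n)) x) \<longlonglongrightarrow> 0"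
      proof (rule AE_I2)
        fix x assume "x \<in> space \<mu>"
        then have x: "x \<in> topspace C01" using sp by simp
        have "eventually (\<lambda>n. modulus (1 / real (Suc n)) x < d / 2) sequentially"
          by (rule order_tendstoD(2)[OF modulus_tendsto[OF x]]) (use d in simp)
        then have "eventually (\<lambda>n. ?h (1 / real (Suc n)) x = 0) sequentially"
        proof eventually_elim
          case (elim n)
          show ?case
          proof (rule ccontr)
            assume "?h (1 / real (Suc n)) x \<noteq> 0"
            from ramp_support[OF _ this] d elim show False by simp
          qed
        qed
        then show "(\<lambda>n. ?h (1 / real (Suc n)) x) \<longlonglongrightarrow> 0" by (rule tendsto_eventually)
      qed
    qed simp
    have "eventually (\<lambda>n. (\<integral>x. ?h (1 / real (Suc n)) x \<partial>\<mu>) < e / 2) sequentially"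
      by (rule order_tendstoD(2)[OF int]) (use e in simp)
    then obtain n where n: "(\<integral>x. ?h (1 / real (Suc n)) x \<partial>\<mu>) < e / 2" by (auto dest: eventually_happens)
    let ?r = "1 / real (Suc n)"
    have r: "0 \<le> ?r" "0 < ?r" by simp_all
    have "((\<lambda>t. g t * (\<integral>\<omega>. ?h ?r (scale_on {0..1} (inverse t) (\<xi> \<omega>)) \<partial>M)) \<longlongrightarrow> (\<integral>x. ?h ?r x \<partial>\<mu>)) at_top"
      by (rule tail_convergenceD[OF D(7) ch[OF r(1)] ramp_bounds(3) d4 hz[OF r(1)]])
    then have lim: "eventually (\<lambda>t. g t * (\<integral>\<omega>. ?h ?r (scale_on {0..1} (inverse t) (\<xi> \<omega>)) \<partial>M) < e / 2) at_top"
      by (rule order_tendstoD(2)[OF _ n])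
    have bound: "eventually (\<lambda>t. ereal (g t * prob (?P s t)) \<le> ereal (e / 2)) at_top" if s: "0 < s" "s \<le> ?r" for s
      using lim eventually_gt_at_top[of 0]
    proof eventually_elim
      case (elim t)
      have t: "0 < inverse t" using elim(2) by simp
      have m: "(\<lambda>\<omega>. modulus s (\<xi> \<omega>)) \<in> borel_measurable M"
        by (rule measurable_compose[OF D(1) continuous_map_borel_measurable[OF continuous_modulus]]) (use s in simp)
      have P: "?P s t \<in> events" using m by measurable
      have int_h: "integrable M (\<lambda>\<omega>. ?h ?r (scale_on {0..1} (inverse t) (\<xi> \<omega>)))"
      proof (rule integrable_const_bound[where B = 1])
        show "(\<lambda>\<omega>. ?h ?r (scale_on {0..1} (inverse t) (\<xi> \<omega>))) \<in> borel_measurable M"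
          by (rule measurable_compose[OF D(1) measurable_compose[OF continuous_map_measurable[OF continuous_scale_C01]
                  continuous_map_borel_measurable[OF ch[OF r(1)]]]])
      qed (use ramp_bounds in simp)
      have "prob (?P s t) = (\<integral>\<omega>. indicator (?P s t) \<omega> \<partial>M)" using P by simp
      also have "\<dots> \<le> (\<integral>\<omega>. ?h ?r (scale_on {0..1} (inverse t) (\<xi> \<omega>)) \<partial>M)"
      proof (rule integral_mono[OF _ int_h])
        show "integrable M (indicator (?P s t) :: _ \<Rightarrow> real)" using P by (simp add: integrable_indicator_iff emeasure_eq_measure)
        fix \<omega> assume w: "\<omega> \<in> space M"
        show "indicator (?P s t) \<omega> \<le> ?h ?r (scale_on {0..1} (inverse t) (\<xi> \<omega>))"
        proof (cases "\<omega> \<in> ?P s t")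
          case True
          then have "t * d < modulus ?r (\<xi> \<omega>)" using modulus_mono[OF x0[OF w], of s ?r] s by simp
          then have "2 * (d / 2) \<le> inverse t * modulus ?r (\<xi> \<omega>)" using elim(2) by (simp add: field_simps del: of_nat_Suc)
          then have "ramp (d / 2) (inverse t * modulus ?r (\<xi> \<omega>)) = 1" using d by (intro ramp_eq_1) auto
          then show ?thesis unfolding modulus_scale[OF x0[OF w] t r(1)] by (simp add: indicator_def)
        qed (use ramp_bounds(1) in simp)
      qed
      finally have "g t * prob (?P s t) \<le> g t * (\<integral>\<omega>. ?h ?r (scale_on {0..1} (inverse t) (\<xi> \<omega>)) \<partial>M)"
        using normalising_nonneg[OF D(2), of t] elim(2) by (intro mult_left_mono) auto
      then show ?case using elim(1) by simp
    qed
    have lt: "Limsup at_top (\<lambda>t. ereal (g t * prob (?P s t))) < ereal e" if s: "0 < s" "s < ?r" for s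
    proof -
      have "Limsup at_top (\<lambda>t. ereal (g t * prob (?P s t))) \<le> ereal (e / 2)"
        by (rule Limsup_bounded[OF bound]) (use s in auto)
      also have "\<dots> < ereal e" using e by simp
      finally show ?thesis .
    qed
    show ?thesis unfolding eventually_at_right_field using r(2) lt by blast
  qed
  show "((\<lambda>r. Limsup at_top (\<lambda>t. ereal (g t * prob (?P r t)))) \<longlongrightarrow> 0) (at_right 0)"
  proof (rule order_tendstoI)
    fix a :: ereal assume a: "a < 0"
    have "0 \<le> Limsup at_top (\<lambda>t. ereal (g t * prob (?P r t)))" for r
    proof (rule le_Limsup)
      show "eventually (\<lambda>t. 0 \<le> ereal (g t * prob (?P r t))) at_top"
        using eventually_ge_at_top[of 0] by eventually_elim (simp add: normalising_nonneg[OF D(2)])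
    qed simp
    then show "eventually (\<lambda>r. a < Limsup at_top (\<lambda>t. ereal (g t * prob (?P r t)))) (at_right 0)"
      using a by (intro always_eventually allI) (rule less_le_trans)
  next
    fix a :: ereal assume "0 < a"
    then obtain e where e: "0 < ereal e" "ereal e < a" using ereal_dense2 by blast
    have "0 < e" using e(1) by simp
    from ev[OF this] show "eventually (\<lambda>r. Limsup at_top (\<lambda>t. ereal (g t * prob (?P r t))) < a) (at_right 0)"
    proof eventually_elim
      case (elim r) from less_trans[OF this e(2)] show ?case .
    qed
  qed
qed

text \<open>
  The sets \<open>{1 / (n + 1) \<le> \<bar>x(u)\<bar>}\<close> over all nodes \<open>u\<close> and all \<open>n\<close> exhaust the non-zero paths, so one of them is
  charged by \<open>\<mu>\<close>. Its node alone makes all projections onto larger sets of nodes non-trivial.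
\<close>

lemma RV_imp_fidi:
  assumes RV: "RV_C01 M \<xi> g \<mu>"
  shows "\<exists>\<gamma>\<^sub>0\<in>\<Gamma>. \<exists>\<mu>f. fidi_condition M \<xi> \<gamma>\<^sub>0 g \<mu>f"
proof -
  note D = RV_C01_D[OF RV]
  have sp: "space \<mu> = topspace C01" using sets_eq_imp_space_eq[OF D(4)] by simp
  let ?S = "\<lambda>i n. {x \<in> topspace C01. 1 / real (Suc n) \<le> \<bar>sample x i\<bar>}"
  have cs: "continuous_map C01 euclideanreal (\<lambda>x. \<bar>sample x i\<bar>)" for i
    unfolding sample_def by (intro continuous_map_real_abs continuous_evaluation node_in)
  have S: "?S i n \<in> sets \<mu>" for i n unfolding D(4) by (rule borel_of_level[OF cs])
  have "\<exists>i n. 0 < emeasure \<mu> (?S i n)"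
  proof (rule ccontr)
    assume "\<not> ?thesis"
    then have "?S i n \<in> null_sets \<mu>" for i n using S by (intro null_setsI) (auto simp: zero_less_iff_neq_zero)
    then have nul: "(\<Union>i. \<Union>n. ?S i n) \<in> null_sets \<mu>" by (intro null_sets_UN)
    obtain c where c: "0 < c" "0 < emeasure \<mu> {x \<in> topspace C01. c \<le> sup_norm x}" using D(6) by blast
    have "{x \<in> topspace C01. c \<le> sup_norm x} \<subseteq> (\<Union>i. \<Union>n. ?S i n)"
    proof
      fix x assume x: "x \<in> {x \<in> topspace C01. c \<le> sup_norm x}"
      then have "\<not> sup_norm x \<le> c / 2" using c(1) by auto
      then obtain i where i: "c / 2 < \<bar>sample x i\<bar>" using sup_norm_le_iff_sample[of x "c / 2"] x by (auto simp: not_le)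
      obtain n where n: "1 / real (Suc n) < c / 2" using nat_approx_posE[of "c / 2"] c(1) by auto
      have "x \<in> ?S i n" using x i n by auto
      then show "x \<in> (\<Union>i. \<Union>n. ?S i n)" by blast
    qed
    then have "emeasure \<mu> {x \<in> topspace C01. c \<le> sup_norm x} \<le> emeasure \<mu> (\<Union>i. \<Union>n. ?S i n)"
      using nul by (intro emeasure_mono) auto
    then show False using c(2) null_setsD1[OF nul] by simp
  qed
  then obtain i n where pos: "0 < emeasure \<mu> (?S i n)" by blast
  define \<gamma>\<^sub>0 where "\<gamma>\<^sub>0 = [node i]"
  have \<gamma>\<^sub>0: "\<gamma>\<^sub>0 \<in> \<Gamma>" using node_in by (simp add: \<gamma>\<^sub>0_def \<Gamma>_def)
  define \<mu>f where "\<mu>f \<gamma> = density (distr \<mu> (borel_of (Rm (length \<gamma>))) (proj \<gamma>))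
      (indicator {y \<in> topspace (Rm (length \<gamma>)). 0 < max_norm (length \<gamma>) y})" for \<gamma>
  have main: "RV_Rm (length \<gamma>) M (\<lambda>\<omega>. proj \<gamma> (\<xi> \<omega>)) g (\<mu>f \<gamma>) \<and>
      emeasure (\<mu>f \<gamma>) (B_set (length \<gamma>)) \<le> emeasure \<mu> {x \<in> topspace C01. 1 \<le> sup_norm x}"
    if \<gamma>: "\<gamma> \<in> \<Gamma>_above \<gamma>\<^sub>0" for \<gamma>
  proof -
    note \<gamma>' = \<Gamma>_above_subset[OF \<gamma>]
    let ?m = "length \<gamma>"
    let ?D = "distr \<mu> (borel_of (Rm ?m)) (proj \<gamma>)"
    let ?U = "{y \<in> topspace (Rm ?m). 0 < max_norm ?m y}"
    let ?V = "\<lambda>c. {y \<in> topspace (Rm ?m). c \<le> max_norm ?m y}"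
    note cm = continuous_max_norm[OF \<gamma>'(2)]
    have pm: "proj \<gamma> \<in> \<mu> \<rightarrow>\<^sub>M borel_of (Rm ?m)"
      using continuous_map_measurable[OF continuous_proj[OF \<gamma>'(1)]] measurable_cong_sets[OF D(4) refl] by blast
    have U: "?U \<in> sets ?D" using borel_of_strict_level[OF cm] by simp
    have eA: "emeasure (\<mu>f \<gamma>) A = emeasure ?D (?U \<inter> A)" if "A \<in> sets (borel_of (Rm ?m))" for A
      unfolding \<mu>f_def using that U by (intro emeasure_restricted) auto
    have eV: "emeasure (\<mu>f \<gamma>) (?V c) = emeasure ?D (?V c)" if c: "0 < c" for c
    proof -
      have "?U \<inter> ?V c = ?V c" using c by auto
      then show ?thesis using eA[OF borel_of_level[OF cm]] by simp
    qed
    have sets_f: "sets (\<mu>f \<gamma>) = sets (borel_of (Rm ?m))" by (simp add: \<mu>f_def)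
    have tm: "tail_measure (Rm ?m) (Rm_ideal ?m) (\<mu>f \<gamma>)"
      unfolding Rm_ideal_def tail_measure_iff[OF cm]
    proof (intro conjI allI impI sets_f)
      show "emeasure (\<mu>f \<gamma>) (?V c) < \<infinity>" if "0 < c" for c
        unfolding eV[OF that] using emeasure_proj_level_le[OF D(4) \<gamma>'] D(5)[OF that] by (rule le_less_trans)
      have Z: "{y \<in> topspace (Rm ?m). max_norm ?m y \<le> 0} \<in> sets (borel_of (Rm ?m))"
        using closedin_continuous_map_preimage[OF cm, of "{..0}"] by (auto intro: closedin_imp_borel_of)
      have "?U \<inter> {y \<in> topspace (Rm ?m). max_norm ?m y \<le> 0} = {}" by auto
      then show "emeasure (\<mu>f \<gamma>) {y \<in> topspace (Rm ?m). max_norm ?m y \<le> 0} = 0" using eA[OF Z] by simp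
      show "\<exists>c>0. 0 < emeasure (\<mu>f \<gamma>) (?V c)"
      proof (intro exI[of _ "1 / real (Suc n)"] conjI)
        have "emeasure \<mu> (?S i n) \<le> emeasure \<mu> (proj \<gamma> -` ?V (1 / real (Suc n)) \<inter> space \<mu>)"
        proof (rule emeasure_mono)
          show "?S i n \<subseteq> proj \<gamma> -` ?V (1 / real (Suc n)) \<inter> space \<mu>"
          proof
            fix x assume x: "x \<in> ?S i n"
            have "node i \<in> set \<gamma>" using \<gamma> by (simp add: \<Gamma>_above_def \<gamma>\<^sub>0_def)
            then obtain k where k: "k < ?m" "\<gamma> ! k = node i" by (auto simp: in_set_conv_nth)
            have "\<bar>proj \<gamma> x k\<bar> = \<bar>sample x i\<bar>" using k by (simp add: proj_def sample_def)
            then have "1 / real (Suc n) \<le> max_norm ?m (proj \<gamma> x)"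
              using x abs_le_max_norm[OF k(1), of "proj \<gamma> x"] by simp
            then show "x \<in> proj \<gamma> -` ?V (1 / real (Suc n)) \<inter> space \<mu>"
              using x sp by (simp add: topspace_Rm proj_def)
          qed
          show "proj \<gamma> -` ?V (1 / real (Suc n)) \<inter> space \<mu> \<in> sets \<mu>"
            by (rule measurable_sets[OF pm borel_of_level[OF cm]])
        qed
        also have "\<dots> = emeasure ?D (?V (1 / real (Suc n)))"
          by (rule emeasure_distr[OF pm borel_of_level[OF cm], symmetric])
        also have "\<dots> = emeasure (\<mu>f \<gamma>) (?V (1 / real (Suc n)))" by (rule eV[symmetric]) simp
        finally show "0 < emeasure (\<mu>f \<gamma>) (?V (1 / real (Suc n)))" using pos by (rule less_le_trans[rotated])
      qed simp
    qed
    have "tail_convergence M (\<lambda>\<omega>. proj \<gamma> (\<xi> \<omega>)) (Rm ?m) (scale_on {..<?m}) (max_norm ?m) g (\<mu>f \<gamma>)"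
      unfolding tail_convergence_def
    proof (intro allI impI)
      fix f :: "(nat \<Rightarrow> real) \<Rightarrow> real" and B c :: real
      assume f: "continuous_map (Rm ?m) euclideanreal f" and B: "\<forall>y\<in>topspace (Rm ?m). \<bar>f y\<bar> \<le> B"
        and c: "0 < c" and z: "\<forall>y\<in>topspace (Rm ?m). f y \<noteq> 0 \<longrightarrow> c \<le> max_norm ?m y"
      have fb: "f \<in> borel_measurable (borel_of (Rm ?m))" by (rule continuous_map_borel_measurable[OF f])
      have "(\<integral>y. f y \<partial>\<mu>f \<gamma>) = (\<integral>y. f y \<partial>?D)"
        unfolding \<mu>f_def
      proof (rule integral_density_indicator[OF _ U])
        show "f y = 0" if "y \<in> space ?D" "y \<notin> ?U" for y
          using that z c by force
      qed (use fb in simp)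
      also have "\<dots> = (\<integral>x. f (proj \<gamma> x) \<partial>\<mu>)" by (rule integral_distr[OF pm fb])
      finally show "((\<lambda>t. g t * (\<integral>\<omega>. f (scale_on {..<?m} (inverse t) (proj \<gamma> (\<xi> \<omega>))) \<partial>M)) \<longlongrightarrow> (\<integral>y. f y \<partial>\<mu>f \<gamma>)) at_top"
        using proj_limit[OF D(7) \<gamma>' f _ c, of B] B z by simp
    qed
    moreover have "(\<lambda>\<omega>. proj \<gamma> (\<xi> \<omega>)) \<in> M \<rightarrow>\<^sub>M borel_of (Rm ?m)"
      by (rule measurable_compose[OF D(1) continuous_map_measurable[OF continuous_proj[OF \<gamma>'(1)]]])
    ultimately have "RV_Rm ?m M (\<lambda>\<omega>. proj \<gamma> (\<xi> \<omega>)) g (\<mu>f \<gamma>)"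
      unfolding Rm_ideal_def RV_iff[OF cm] using D(2) tm by (simp add: Rm_ideal_def)
    moreover have "emeasure (\<mu>f \<gamma>) (B_set ?m) \<le> emeasure \<mu> {x \<in> topspace C01. 1 \<le> sup_norm x}"
    proof -
      have "emeasure (\<mu>f \<gamma>) (B_set ?m) \<le> emeasure (\<mu>f \<gamma>) (?V 1)"
        using borel_of_level[OF cm] sets_f by (intro emeasure_mono) (auto simp: B_set_def)
      also have "\<dots> = emeasure ?D (?V 1)" by (rule eV) simp
      also have "\<dots> \<le> emeasure \<mu> {x \<in> topspace C01. 1 \<le> sup_norm x}" by (rule emeasure_proj_level_le[OF D(4) \<gamma>'])
      finally show ?thesis .
    qed
    ultimately show ?thesis by blast
  qed
  have "sup_mass \<gamma>\<^sub>0 \<mu>f \<le> emeasure \<mu> {x \<in> topspace C01. 1 \<le> sup_norm x}"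
    unfolding sup_mass_def using main by (intro SUP_least) blast
  also have "\<dots> < \<infinity>" by (rule D(5)) simp
  finally show ?thesis using \<gamma>\<^sub>0 main unfolding fidi_condition_def by blast
qed

section \<open>The characterisation\<close>

text \<open>
  The supremum over the uncountable set of all \<open>\<gamma>\<close> is attained along the refinements of \<open>\<gamma>\<^sub>0\<close> by the first \<open>n\<close>
  nodes, because \<open>\<parallel>x\<parallel> > 1\<close> is witnessed at a node.
\<close>

lemma sup_mass_eq:
  assumes \<gamma>\<^sub>0: "\<gamma>\<^sub>0 \<in> \<Gamma>" and s: "sets \<mu> = sets (borel_of C01)"
    and proj: "\<And>\<gamma>. \<gamma> \<in> \<Gamma>_above \<gamma>\<^sub>0 \<Longrightarrow> is_projection \<gamma> \<mu> (\<mu>f \<gamma>)"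
  shows "sup_mass \<gamma>\<^sub>0 \<mu>f = emeasure \<mu> {x \<in> topspace C01. 1 < sup_norm x}"
proof -
  have sp: "space \<mu> = topspace C01" using sets_eq_imp_space_eq[OF s] by simp
  let ?A = "\<lambda>\<gamma>. {x \<in> topspace C01. 1 < max_norm (length \<gamma>) (proj \<gamma> x)}"
  have A: "emeasure (\<mu>f \<gamma>) (B_set (length \<gamma>)) = emeasure \<mu> (?A \<gamma>)" "?A \<gamma> \<in> sets \<mu>"
    "?A \<gamma> \<subseteq> {x \<in> topspace C01. 1 < sup_norm x}" if \<gamma>: "\<gamma> \<in> \<Gamma>_above \<gamma>\<^sub>0" for \<gamma>
  proof -
    note \<gamma>' = \<Gamma>_above_subset[OF \<gamma>]
    have B: "B_set (length \<gamma>) \<in> sets (borel_of (Rm (length \<gamma>)))"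
      unfolding B_set_def by (rule borel_of_strict_level[OF continuous_max_norm[OF \<gamma>'(2)]])
    have "B_set (length \<gamma>) \<in> Rm_ideal (length \<gamma>)"
      unfolding Rm_ideal_def in_ideal_away_iff by (auto simp: B_set_def intro!: exI[of _ 1])
    then have "emeasure (\<mu>f \<gamma>) (B_set (length \<gamma>)) = emeasure (distr \<mu> (borel_of (Rm (length \<gamma>))) (proj \<gamma>)) (B_set (length \<gamma>))"
      using proj[OF \<gamma>] B unfolding is_projection_def by blast
    also have pm: "proj \<gamma> \<in> \<mu> \<rightarrow>\<^sub>M borel_of (Rm (length \<gamma>))"
      using continuous_map_measurable[OF continuous_proj[OF \<gamma>'(1)]] measurable_cong_sets[OF s refl] by blast
    note emeasure_distr[OF pm B]
    also have e: "proj \<gamma> -` B_set (length \<gamma>) \<inter> space \<mu> = ?A \<gamma>"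
      using sp by (auto simp: B_set_def topspace_Rm proj_def)
    finally show "emeasure (\<mu>f \<gamma>) (B_set (length \<gamma>)) = emeasure \<mu> (?A \<gamma>)" .
    show "?A \<gamma> \<in> sets \<mu>" using measurable_sets[OF pm B] unfolding e .
    show "?A \<gamma> \<subseteq> {x \<in> topspace C01. 1 < sup_norm x}"
      using max_norm_proj_le[OF \<gamma>'] by (auto intro: less_le_trans)
  qed
  have N: "{x \<in> topspace C01. 1 < sup_norm x} \<in> sets \<mu>"
    unfolding s by (rule borel_of_strict_level[OF continuous_sup_norm])
  show ?thesis
  proof (rule antisym)
    show "sup_mass \<gamma>\<^sub>0 \<mu>f \<le> emeasure \<mu> {x \<in> topspace C01. 1 < sup_norm x}"
      unfolding sup_mass_def
    proof (rule SUP_least)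
      fix \<gamma> assume \<gamma>: "\<gamma> \<in> \<Gamma>_above \<gamma>\<^sub>0"
      show "emeasure (\<mu>f \<gamma>) (B_set (length \<gamma>)) \<le> emeasure \<mu> {x \<in> topspace C01. 1 < sup_norm x}"
        unfolding A(1)[OF \<gamma>] by (rule emeasure_mono[OF A(3)[OF \<gamma>] N])
    qed
    define \<gamma> where "\<gamma> n = refine \<gamma>\<^sub>0 {..<n}" for n
    have \<gamma>: "\<gamma> n \<in> \<Gamma>_above \<gamma>\<^sub>0" "set (\<gamma> n) = set \<gamma>\<^sub>0 \<union> node ` {..<n}" for n
      unfolding \<gamma>_def using refine_above[OF \<gamma>\<^sub>0, of "{..<n}"] set_refine[OF \<gamma>\<^sub>0, of "{..<n}"] by auto
    have ne: "\<gamma> n \<noteq> []" for n using \<Gamma>_above_subset(2)[OF \<gamma>(1)[of n]] by auto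
    have "(\<Union>n. ?A (\<gamma> n)) = {x \<in> topspace C01. 1 < sup_norm x}"
    proof (intro equalityI subsetI)
      fix x assume "x \<in> (\<Union>n. ?A (\<gamma> n))"
      then show "x \<in> {x \<in> topspace C01. 1 < sup_norm x}" using A(3)[OF \<gamma>(1)] by blast
    next
      fix x assume x: "x \<in> {x \<in> topspace C01. 1 < sup_norm x}"
      then obtain i where i: "1 < \<bar>sample x i\<bar>" using sup_norm_le_iff_sample[of x 1] by (auto simp: not_le)
      have "node i \<in> set (\<gamma> (Suc i))" unfolding \<gamma>(2) by blast
      then have "x \<in> ?A (\<gamma> (Suc i))"
        using x i unfolding less_max_norm_proj_iff[OF ne] sample_def by blast
      then show "x \<in> (\<Union>n. ?A (\<gamma> n))" by blast
    qed
    moreover have "(SUP n. emeasure \<mu> (?A (\<gamma> n))) = emeasure \<mu> (\<Union>n. ?A (\<gamma> n))"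
    proof (rule SUP_emeasure_incseq)
      show "range (\<lambda>n. ?A (\<gamma> n)) \<subseteq> sets \<mu>" using A(2)[OF \<gamma>(1)] by blast
      show "incseq (\<lambda>n. ?A (\<gamma> n))"
      proof (rule incseq_SucI)
        fix n
        have "set (\<gamma> n) \<subseteq> set (\<gamma> (Suc n))" unfolding \<gamma>(2) by auto
        then show "?A (\<gamma> n) \<subseteq> ?A (\<gamma> (Suc n))" unfolding less_max_norm_proj_iff[OF ne] by blast
      qed
    qed
    moreover have "(SUP n. emeasure \<mu> (?A (\<gamma> n))) \<le> sup_mass \<gamma>\<^sub>0 \<mu>f"
    proof (rule SUP_least)
      fix n show "emeasure \<mu> (?A (\<gamma> n)) \<le> sup_mass \<gamma>\<^sub>0 \<mu>f"
        unfolding A(1)[OF \<gamma>(1), symmetric] sup_mass_def by (rule SUP_upper[OF \<gamma>(1)])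
    qed
    ultimately show "emeasure \<mu> {x \<in> topspace C01. 1 < sup_norm x} \<le> sup_mass \<gamma>\<^sub>0 \<mu>f" by simp
  qed
qed

text \<open>
  Non-triviality of \<open>\<mu>\<close> is inherited from its projection to \<open>\<gamma>\<^sub>0\<close>.
\<close>

lemma fidi_and_modulus_imp_RV:
  assumes M: "prob_space M" and \<xi>: "\<xi> \<in> M \<rightarrow>\<^sub>M borel_of C01" and \<gamma>\<^sub>0: "\<gamma>\<^sub>0 \<in> \<Gamma>"
    and fidi: "fidi_condition M \<xi> \<gamma>\<^sub>0 g \<mu>f" and modulus: "modulus_condition M \<xi> g"
  shows "\<exists>\<mu>. RV_C01 M \<xi> g \<mu>"
proof -
  have RV: "\<And>\<gamma>. \<gamma> \<in> \<Gamma>_above \<gamma>\<^sub>0 \<Longrightarrow> RV_Rm (length \<gamma>) M (\<lambda>\<omega>. proj \<gamma> (\<xi> \<omega>)) g (\<mu>f \<gamma>)"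
    using fidi by (simp add: fidi_condition_def)
  have above: "\<gamma>\<^sub>0 \<in> \<Gamma>_above \<gamma>\<^sub>0" using \<gamma>\<^sub>0 by (simp add: \<Gamma>_above_def)
  note \<gamma>' = \<Gamma>_above_subset[OF above]
  note D = RV_RmD[OF RV[OF above] \<gamma>'(2)]
  obtain Q where Q: "sets Q = sets borel" "emeasure Q {\<lambda>_. 0} = 0"
    "\<And>K c. finite K \<Longrightarrow> 0 < c \<Longrightarrow> emeasure Q (exceed K c) < \<infinity>"
    "\<And>K c F B. finite K \<Longrightarrow> 0 < c \<Longrightarrow> continuous_on UNIV F \<Longrightarrow> (\<And>y. \<bar>F y\<bar> \<le> B) \<Longrightarrow>
       (\<And>y. y \<notin> exceed K c \<Longrightarrow> F y = 0) \<Longrightarrow> (\<And>y. F (restr K y) = F y) \<Longrightarrow>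
       ((\<lambda>t. g t * (\<integral>\<omega>. F (\<lambda>i. inverse t * sample (\<xi> \<omega>) i) \<partial>M)) \<longlongrightarrow> (\<integral>y. F y \<partial>Q)) at_top"
  proof (rule ex_sample_tail_measure[OF \<gamma>\<^sub>0 RV], goal_cases)
    case (1 \<gamma>) from 1(2) show ?case .
  next
    case (2 Q) from 2(2-) show ?case by (rule 2(1))
  qed
  interpret path_limit M \<xi> g Q
    by (intro path_limit.intro M path_limit_axioms.intro \<xi> D(2) modulus Q)
  have "is_projection \<gamma>\<^sub>0 \<mu> (\<mu>f \<gamma>\<^sub>0)"
    by (rule projection_of_limit[OF convergence sets_\<mu> \<mu>_level_finite above RV[OF above]])
  moreover obtain c where c: "0 < c" "0 < emeasure (\<mu>f \<gamma>\<^sub>0) {y \<in> topspace (Rm (length \<gamma>\<^sub>0)). c \<le> max_norm (length \<gamma>\<^sub>0) y}"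
    using D(6) by blast
  moreover have "{y \<in> topspace (Rm (length \<gamma>\<^sub>0)). c \<le> max_norm (length \<gamma>\<^sub>0) y} \<in> sets (borel_of (Rm (length \<gamma>\<^sub>0))) \<inter> Rm_ideal (length \<gamma>\<^sub>0)"
    using borel_of_level[OF continuous_max_norm[OF \<gamma>'(2)]] c(1) by (auto simp: Rm_ideal_def in_ideal_away_iff)
  ultimately have "0 < emeasure (distr \<mu> (borel_of (Rm (length \<gamma>\<^sub>0))) (proj \<gamma>\<^sub>0)) {y \<in> topspace (Rm (length \<gamma>\<^sub>0)). c \<le> max_norm (length \<gamma>\<^sub>0) y}"
    unfolding is_projection_def by force
  then have "0 < emeasure \<mu> {x \<in> topspace C01. c \<le> sup_norm x}"
    using emeasure_proj_level_le[OF sets_\<mu> \<gamma>'] by (rule less_le_trans)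
  then have "tail_measure C01 (ideal_away C01 sup_norm) \<mu>"
    unfolding tail_measure_iff[OF continuous_sup_norm] using sets_\<mu> \<mu>_level_finite \<mu>_null c(1) by blast
  then have "RV_C01 M \<xi> g \<mu>"
    unfolding C01_ideal_def RV_iff[OF continuous_sup_norm] using \<xi> D(2) convergence by blast
  then show ?thesis by blast
qed

theorem theorem4p4p2:
  fixes M :: "'w measure" and \<xi> :: "'w \<Rightarrow> real \<Rightarrow> real"
  assumes "prob_space M" and "\<xi> \<in> M \<rightarrow>\<^sub>M borel_of C01"
  shows
    "((\<exists>g \<mu>. RV_C01 M \<xi> g \<mu>) \<longleftrightarrow>
       (\<exists>\<gamma>\<^sub>0 \<in> \<Gamma>. \<exists>g. g \<in> borel_measurable (restrict_space borel {0..}) \<and>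
          (\<exists>\<mu>f. fidi_condition M \<xi> \<gamma>\<^sub>0 g \<mu>f) \<and> modulus_condition M \<xi> g)) \<and>
     (\<forall>\<gamma>\<^sub>0 \<in> \<Gamma>. \<forall>g \<mu>f. fidi_condition M \<xi> \<gamma>\<^sub>0 g \<mu>f \<and> modulus_condition M \<xi> g \<longrightarrow>
        (\<exists>\<mu>. RV_C01 M \<xi> g \<mu>) \<and>
        (\<forall>\<mu>. RV_C01 M \<xi> g \<mu> \<longrightarrow> (\<forall>\<gamma> \<in> \<Gamma>_above \<gamma>\<^sub>0. is_projection \<gamma> \<mu> (\<mu>f \<gamma>))) \<and>
        (\<exists>\<alpha>>0. regularly_varying g \<alpha> \<and>
           RV_Rplus M (\<lambda>\<omega>. sup_norm (\<xi> \<omega>)) g (scale_measure (sup_mass \<gamma>\<^sub>0 \<mu>f) (\<theta> \<alpha>))))"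
proof (intro conjI ballI allI impI iffI)
  assume "\<exists>g \<mu>. RV_C01 M \<xi> g \<mu>"
  then obtain g \<mu> where RV: "RV_C01 M \<xi> g \<mu>" by blast
  obtain \<gamma>\<^sub>0 \<mu>f where "\<gamma>\<^sub>0 \<in> \<Gamma>" "fidi_condition M \<xi> \<gamma>\<^sub>0 g \<mu>f" using RV_imp_fidi[OF RV] by blast
  moreover have "modulus_condition M \<xi> g" by (rule RV_imp_modulus_condition[OF assms(1) RV])
  moreover have "g \<in> borel_measurable (restrict_space borel {0..})"
    using RV_C01_D(2)[OF RV] measurable_restrict_space2_iff[of g _ borel "{0..}"] by (simp add: normalising_def)
  ultimately show "\<exists>\<gamma>\<^sub>0 \<in> \<Gamma>. \<exists>g. g \<in> borel_measurable (restrict_space borel {0..}) \<and>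
      (\<exists>\<mu>f. fidi_condition M \<xi> \<gamma>\<^sub>0 g \<mu>f) \<and> modulus_condition M \<xi> g" by blast
next
  assume "\<exists>\<gamma>\<^sub>0 \<in> \<Gamma>. \<exists>g. g \<in> borel_measurable (restrict_space borel {0..}) \<and>
      (\<exists>\<mu>f. fidi_condition M \<xi> \<gamma>\<^sub>0 g \<mu>f) \<and> modulus_condition M \<xi> g"
  then show "\<exists>g \<mu>. RV_C01 M \<xi> g \<mu>" using fidi_and_modulus_imp_RV[OF assms] by blast
next
  fix \<gamma>\<^sub>0 g \<mu>f assume \<gamma>\<^sub>0: "\<gamma>\<^sub>0 \<in> \<Gamma>" and h: "fidi_condition M \<xi> \<gamma>\<^sub>0 g \<mu>f \<and> modulus_condition M \<xi> g"
  show ex: "\<exists>\<mu>. RV_C01 M \<xi> g \<mu>" using fidi_and_modulus_imp_RV[OF assms \<gamma>\<^sub>0] h by blast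
  have proj: "is_projection \<gamma> \<mu> (\<mu>f \<gamma>)" if "RV_C01 M \<xi> g \<mu>" "\<gamma> \<in> \<Gamma>_above \<gamma>\<^sub>0" for \<mu> \<gamma>
  proof -
    note D = RV_C01_D[OF that(1)]
    have "RV_Rm (length \<gamma>) M (\<lambda>\<omega>. proj \<gamma> (\<xi> \<omega>)) g (\<mu>f \<gamma>)" using h that(2) by (simp add: fidi_condition_def)
    from projection_of_limit[OF D(7) D(4) D(5) that(2) this] show ?thesis .
  qed
  show "is_projection \<gamma> \<mu> (\<mu>f \<gamma>)" if "RV_C01 M \<xi> g \<mu>" "\<gamma> \<in> \<Gamma>_above \<gamma>\<^sub>0" for \<mu> \<gamma>
    by (rule proj[OF that])
  obtain \<mu> where RV: "RV_C01 M \<xi> g \<mu>" using ex by blast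
  have "sup_mass \<gamma>\<^sub>0 \<mu>f = emeasure \<mu> {x \<in> topspace C01. 1 < sup_norm x}"
    by (rule sup_mass_eq[OF \<gamma>\<^sub>0 RV_C01_D(4)[OF RV] proj[OF RV]])
  then show "\<exists>\<alpha>>0. regularly_varying g \<alpha> \<and>
      RV_Rplus M (\<lambda>\<omega>. sup_norm (\<xi> \<omega>)) g (scale_measure (sup_mass \<gamma>\<^sub>0 \<mu>f) (\<theta> \<alpha>))"
    using norm_regularly_varying[OF assms RV_C01_D(2,3,7)[OF RV]] by simp
qed

end
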